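(* Let $R$ be a root system of type $E_6$, $R_o\subset R$ a subsystem of type $D_5$, and $\mathcal C_3$ the Coble representation of $W(R)$. For each of the five subsystems $R'\subset R_o$ of type $D_4$, the crosses attached to the $4A_1$-subsystems of $R'$ span a plane in $\mathcal C_3$. These five planes make up a direct sum decomposition of $\mathcal C_3$. In particular, $\mathcal C_3$ is the irreducible representation of the $E_6$-Weyl group of degree $10$.
   Context: Let $\mathfrak h$ be the complex span of $R$. For a reduced root subsystem $S\subset R$ with a set $S^+$ of positive roots, the discriminant is $\Delta(S^+):=\prod_{\beta\in S^+}\beta\in\mathrm{Sym}^{|S|/2}\mathfrak h$ (well defined up to sign). $\mathcal C_3\subset\mathrm{Sym}^9\mathfrak h$ is the linear span of the discriminants of all subsystems of $R$ of type $3A_2$, a $W(R)$-subrepresentation. If $S\subset R$ is of type $3A_2$ and $\alpha\in R$ is a root not orthogonal to any of the three $A_2$-summands of $S$, then the roots of $S$ orthogonal to $\alpha$ form a $3A_1$-subsystem $\{\pm\alpha_1,\pm\alpha_2,\pm\alpha_3\}$, and $(1-s_\alpha)\Delta(S^+)\in\mathcal C_3$ is called a cross ($s_\alpha$ is the reflection in $\alpha$). The cross is divisible by $\alpha_1\alpha_2\alpha_3\alpha$, and it is said to be attached to the $4A_1$-subsystem $\{\pm\alpha_1,\pm\alpha_2,\pm\alpha_3,\pm\alpha\}$; each $4A_1$-subsystem of $R$ has a cross attached to it, unique up to sign. A root system of type $D_4$ has exactly three subsystems of type $4A_1$. *)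

theory Defs
  imports "HOL-Analysis.Analysis" "HOL-Library.Poly_Mapping"
begin

definition cartan_int :: "'a::euclidean_space \<Rightarrow> 'a \<Rightarrow> real" where
  "cartan_int x a = 2 * (x \<bullet> a) / (a \<bullet> a)"

definition root_refl :: "'a::euclidean_space \<Rightarrow> 'a \<Rightarrow> 'a" where
  "root_refl a x = x - cartan_int x a *\<^sub>R a"

text \<open>Reduced crystallographic root systems. They need not span the ambient space, so that
  a root subsystem of \<open>R\<close> is simply a subset of \<open>R\<close> that is a root system.\<close>

definition root_system :: "'a::euclidean_space set \<Rightarrow> bool" where
  "root_system S \<longleftrightarrow> finite S \<and> 0 \<notin> S \<and>
     (\<forall>a\<in>S. \<forall>b\<in>S. root_refl a b \<in> S \<and> cartan_int b a \<in> \<int>) \<and>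
     (\<forall>a\<in>S. \<forall>t. t *\<^sub>R a \<in> S \<longrightarrow> t = 1 \<or> t = -1)"

definition positive_roots :: "'a::euclidean_space set \<Rightarrow> 'a set \<Rightarrow> 'a set" where
  "positive_roots B S = {x \<in> S. \<exists>n :: 'a \<Rightarrow> nat. x = (\<Sum>b\<in>B. real (n b) *\<^sub>R b)}"

definition root_basis :: "'a::euclidean_space set \<Rightarrow> 'a set \<Rightarrow> bool" where
  "root_basis B S \<longleftrightarrow> B \<subseteq> S \<and> independent B \<and>
     (\<forall>x\<in>S. x \<in> positive_roots B S \<or> - x \<in> positive_roots B S)"

definition positive_system :: "'a::euclidean_space set \<Rightarrow> 'a set \<Rightarrow> bool" where
  "positive_system S P \<longleftrightarrow> (\<exists>B. root_basis B S \<and> P = positive_roots B S)"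

text \<open>\<open>S\<close> has a root basis whose Dynkin diagram is the simply laced diagram with nodes
  \<open>0, \<dots>, n - 1\<close> and edge set \<open>E\<close>.\<close>

definition has_dynkin_type :: "nat \<Rightarrow> nat set set \<Rightarrow> 'a::euclidean_space set \<Rightarrow> bool" where
  "has_dynkin_type n E S \<longleftrightarrow> root_system S \<and>
     (\<exists>a :: nat \<Rightarrow> 'a. inj_on a {..<n} \<and> root_basis (a ` {..<n}) S \<and>
        (\<forall>i<n. \<forall>j<n. cartan_int (a i) (a j) =
           (if i = j then 2 else if {i, j} \<in> E then -1 else 0)))"

definition type_A1 :: "'a::euclidean_space set \<Rightarrow> bool" where
  "type_A1 = has_dynkin_type 1 {}"

definition type_A2 :: "'a::euclidean_space set \<Rightarrow> bool" where
  "type_A2 = has_dynkin_type 2 {{0, 1}}"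

definition type_D4 :: "'a::euclidean_space set \<Rightarrow> bool" where
  "type_D4 = has_dynkin_type 4 {{0, 1}, {1, 2}, {1, 3}}"

definition type_D5 :: "'a::euclidean_space set \<Rightarrow> bool" where
  "type_D5 = has_dynkin_type 5 {{0, 1}, {1, 2}, {2, 3}, {2, 4}}"

definition type_E6 :: "'a::euclidean_space set \<Rightarrow> bool" where
  "type_E6 = has_dynkin_type 6 {{0, 1}, {1, 2}, {2, 3}, {3, 4}, {2, 5}}"

text \<open>\<open>F\<close> is a set of \<open>k\<close> pairwise orthogonal root systems of type \<open>T\<close> with union \<open>S\<close>.
  For \<open>T\<close> irreducible these are the irreducible summands of \<open>S\<close>.\<close>

definition has_summands ::
  "nat \<Rightarrow> ('a::euclidean_space set \<Rightarrow> bool) \<Rightarrow> 'a set set \<Rightarrow> 'a set \<Rightarrow> bool" where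
  "has_summands k T F S \<longleftrightarrow> finite F \<and> card F = k \<and> (\<forall>A\<in>F. T A) \<and>
     (\<forall>A\<in>F. \<forall>B\<in>F. A \<noteq> B \<longrightarrow> (\<forall>x\<in>A. \<forall>y\<in>B. x \<bullet> y = 0)) \<and> S = \<Union>F"

definition type_3A2 :: "'a::euclidean_space set \<Rightarrow> bool" where
  "type_3A2 S \<longleftrightarrow> (\<exists>F. has_summands 3 type_A2 F S)"

definition type_4A1 :: "'a::euclidean_space set \<Rightarrow> bool" where
  "type_4A1 S \<longleftrightarrow> (\<exists>F. has_summands 4 type_A1 F S)"

inductive_set weyl_group :: "'a::euclidean_space set \<Rightarrow> ('a \<Rightarrow> 'a) set"
  for R :: "'a set" where
  weyl_id: "id \<in> weyl_group R"
| weyl_refl: "w \<in> weyl_group R \<Longrightarrow> a \<in> R \<Longrightarrow> root_refl a \<circ> w \<in> weyl_group R"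

text \<open>For roots in \<open>real^'n\<close>, the space \<open>h\<close> is their complex span in the complexification of
  \<open>real^'n\<close>, and the symmetric algebra of that complexification is the polynomial ring over the
  complex numbers with one variable for each coordinate. It contains the symmetric algebra of
  \<open>h\<close>; all elements and subspaces defined below lie in the latter.\<close>

type_synonym 'n sym_alg = "('n \<Rightarrow>\<^sub>0 nat) \<Rightarrow>\<^sub>0 complex"

definition sym_scale :: "complex \<Rightarrow> 'n sym_alg \<Rightarrow> 'n sym_alg" where
  "sym_scale c p = Poly_Mapping.single 0 c * p"

global_interpretation sym: vector_space sym_scale
  by standard
    (simp_all add: sym_scale_def distrib_left distrib_right single_add mult_single
      flip: mult.assoc)

definition sym_incl :: "real^'n \<Rightarrow> 'n::finite sym_alg" where
  "sym_incl v = (\<Sum>i\<in>UNIV. Poly_Mapping.single (Poly_Mapping.single i 1) (complex_of_real (v $ i)))"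

text \<open>The algebra endomorphism induced by a linear map \<open>w\<close>: it substitutes the image under
  \<open>w\<close> of the \<open>i\<close>-th standard basis vector for the \<open>i\<close>-th variable.\<close>

definition sym_act :: "(real^'n \<Rightarrow> real^'n) \<Rightarrow> 'n::finite sym_alg \<Rightarrow> 'n sym_alg" where
  "sym_act w p = (\<Sum>m\<in>Poly_Mapping.keys p. sym_scale (Poly_Mapping.lookup p m)
     (\<Prod>i\<in>UNIV. sym_incl (w (axis i 1)) ^ Poly_Mapping.lookup m i))"

definition discriminant :: "(real^'n) set \<Rightarrow> 'n::finite sym_alg" where
  "discriminant P = (\<Prod>b\<in>P. sym_incl b)"

text \<open>\<open>U\<close> is the internal direct sum of the subspaces \<open>V i\<close>: the addition map from their
  product to \<open>U\<close> is a bijection.\<close>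

definition direct_sum_decomp :: "'i set \<Rightarrow> ('i \<Rightarrow> 'n sym_alg set) \<Rightarrow> 'n sym_alg set \<Rightarrow> bool" where
  "direct_sum_decomp I V U \<longleftrightarrow> finite I \<and> (\<forall>i\<in>I. sym.subspace (V i)) \<and>
     bij_betw (\<lambda>f. \<Sum>i\<in>I. f i) (\<Pi>\<^sub>E i\<in>I. V i) U"

definition subrep :: "(real^'n \<Rightarrow> real^'n) set \<Rightarrow> 'n::finite sym_alg set \<Rightarrow> bool" where
  "subrep W U \<longleftrightarrow> sym.subspace U \<and> (\<forall>w\<in>W. \<forall>u\<in>U. sym_act w u \<in> U)"

definition irreducible_subrep :: "(real^'n \<Rightarrow> real^'n) set \<Rightarrow> 'n::finite sym_alg set \<Rightarrow> bool" where
  "irreducible_subrep W U \<longleftrightarrow> subrep W U \<and> U \<noteq> {0} \<and>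
     (\<forall>U'. subrep W U' \<and> U' \<subseteq> U \<longrightarrow> U' = {0} \<or> U' = U)"

definition coble :: "(real^'n) set \<Rightarrow> 'n::finite sym_alg set" where
  "coble R = sym.span {discriminant P | S P. S \<subseteq> R \<and> type_3A2 S \<and> positive_system S P}"

text \<open>The cross defined by a \<open>3A2\<close>-subsystem \<open>S\<close> and a root \<open>a\<close> is attached to the
  \<open>4A1\<close>-subsystem that consists of \<open>a\<close>, \<open>- a\<close> and the roots of \<open>S\<close> orthogonal to \<open>a\<close>.\<close>

definition cross_attached :: "(real^'n) set \<Rightarrow> (real^'n) set \<Rightarrow> 'n::finite sym_alg \<Rightarrow> bool" where
  "cross_attached R T c \<longleftrightarrow> (\<exists>S F P a.
     S \<subseteq> R \<and> has_summands 3 type_A2 F S \<and> positive_system S P \<and>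
     a \<in> R \<and> (\<forall>A\<in>F. \<exists>b\<in>A. a \<bullet> b \<noteq> 0) \<and>
     T = {b \<in> S. a \<bullet> b = 0} \<union> {a, - a} \<and>
     c = discriminant P - sym_act (root_refl a) (discriminant P))"

definition cross_span :: "(real^'n) set \<Rightarrow> (real^'n) set \<Rightarrow> 'n::finite sym_alg set" where
  "cross_span R R' = sym.span {c. \<exists>T. T \<subseteq> R' \<and> type_4A1 T \<and> cross_attached R T c}"

definition D4_subsystems :: "'a::euclidean_space set \<Rightarrow> 'a set set" where
  "D4_subsystems S = {R'. R' \<subseteq> S \<and> type_D4 R'}"

end

theory Submission
  imports Defs
begin

text \<open>The subsystem \<open>R\<^sub>o\<close> of type \<open>D\<^sub>5\<close> provides orthogonal vectors \<open>f\<^sub>0, \<dots>, f\<^sub>4\<close> of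
  equal length such that its roots are the vectors \<open>\<plusminus>2 f\<^sub>i \<plusminus> 2 f\<^sub>j\<close>, and \<open>R\<close> consists of these and of the vectors
  \<open>\<Sum> x\<^sub>i f\<^sub>i + y t\<close> with \<open>x\<^sub>i, y = \<plusminus>1\<close> and \<open>\<Prod> x\<^sub>i = y\<close>, where \<open>t\<close> is orthogonal to all \<open>f\<^sub>i\<close>. Even signed
  permutations of the \<open>f\<^sub>i\<close> preserve this description, and up to them there is only one subsystem of type
  \<open>3A\<^sub>2\<close>. With \<open>X\<^sub>i\<close> the image of \<open>f\<^sub>i\<close> in the symmetric algebra, a cross attached to the \<open>D\<^sub>4\<close>-subsystem orthogonal
  to \<open>f\<^sub>p\<close> is, up to a scalar, \<open>(X\<^sub>a\<^sup>2 - X\<^sub>b\<^sup>2) (X\<^sub>c\<^sup>2 - X\<^sub>d\<^sup>2) Q\<^sub>p\<close> for a fixed polynomial \<open>Q\<^sub>p\<close> and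
  \<open>{a, b, c, d, p} = {0, \<dots>, 4}\<close>. The three such products for given \<open>p\<close> span a plane, and every discriminant
  is a combination of three crosses. Changing the signs of \<open>f\<^sub>i\<close> and \<open>f\<^sub>j\<close> is an element of the Weyl group
  that acts on the plane of \<open>p\<close> as \<open>- 1\<close> if \<open>p \<in> {i, j}\<close> and as the identity otherwise; this separates the five
  planes. Together with the permutations of the \<open>f\<^sub>i\<close>, which permute the planes transitively and act
  irreducibly on each of them, it yields the irreducibility.\<close>

section \<open>Substitution homomorphisms\<close>

text \<open>Two obstacles shape the argument. The \<open>E6\<close>-system is given only by a Dynkin
  diagram, so its roots outside \<open>D5\<close> have to be found: a parity argument on the Cartan
  matrix yields one root whose pairings with the \<open>f i\<close> are all odd multiples of the
  same number; the signs of the \<open>f i\<close> are then normalised so that this root is their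
  sum plus a vector \<open>t\<close>, and lengths force the rest. The squared length 3 of
  \<open>t\<close>, in units of that of the \<open>f i\<close>, is 8 - 5, since roots have squared
  length 8. Secondly, the Weyl group of \<open>E6\<close> does not preserve \<open>D5\<close>.
  Invariance of the Coble space is obtained by moving the whole coordinate frame by a group element,
  because every frame describes the same space; the other arguments use only even signed
  permutations. That there is one \<open>3A2\<close>-subsystem up to these rests on a pigeonhole:
  each summand contains a root of \<open>D5\<close>, the three roots are orthogonal, and five
  indices do not hold three disjoint pairs. Linear independence does not require expanded
  polynomials: an evaluation shows that crosses are nonzero, and reflections separate the
  rest.\<close>

definition psubst ::
  "(complex \<Rightarrow> 'b::comm_ring_1) \<Rightarrow> ('n::finite \<Rightarrow> 'b) \<Rightarrow> 'n sym_alg \<Rightarrow> 'b" where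
  "psubst \<phi> h p = (\<Sum>m\<in>Poly_Mapping.keys p.
     \<phi> (Poly_Mapping.lookup p m) * (\<Prod>i\<in>UNIV. h i ^ Poly_Mapping.lookup m i))"

text \<open>What is required of the action on coefficients for \<open>psubst\<close> to be a ring
  homomorphism. The two instances are the embedding of constants, which gives
  \<open>sym_act\<close>, and the identity, which gives evaluation at a point.\<close>

definition coeff_hom :: "(complex \<Rightarrow> 'b::comm_ring_1) \<Rightarrow> bool" where
  "coeff_hom \<phi> \<longleftrightarrow> \<phi> 0 = 0 \<and> \<phi> 1 = 1 \<and> (\<forall>a b. \<phi> (a + b) = \<phi> a + \<phi> b) \<and> (\<forall>a b. \<phi> (a * b) = \<phi> a * \<phi> b)"

lemma poly_mapping_eq_sum_single:
  "p = (\<Sum>m\<in>Poly_Mapping.keys p. Poly_Mapping.single m (Poly_Mapping.lookup p m))"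
proof (rule poly_mapping_eqI)
  fix k
  have "(\<Sum>m\<in>Poly_Mapping.keys p. Poly_Mapping.lookup p m when m = k) = Poly_Mapping.lookup p k"
    by (cases "k \<in> Poly_Mapping.keys p") (auto simp: when_def in_keys_iff)
  then show "Poly_Mapping.lookup p k = Poly_Mapping.lookup (\<Sum>m\<in>Poly_Mapping.keys p. Poly_Mapping.single m (Poly_Mapping.lookup p m)) k"
    by (simp add: lookup_sum lookup_single)
qed

text \<open>The sum in \<open>psubst\<close> runs over the keys of one polynomial. To add two of
  them, both sums are extended to a common finite set of monomials, the extra terms being 0.\<close>

lemma psubst_superset:
  assumes "coeff_hom \<phi>" "finite M" "Poly_Mapping.keys p \<subseteq> M"
  shows "psubst \<phi> h p = (\<Sum>m\<in>M. \<phi> (Poly_Mapping.lookup p m) * (\<Prod>i\<in>UNIV. h i ^ Poly_Mapping.lookup m i))"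
  unfolding psubst_def using assms
  by (intro sum.mono_neutral_left) (auto simp: in_keys_iff coeff_hom_def)

lemma psubst_add:
  assumes "coeff_hom \<phi>"
  shows "psubst \<phi> h (p + q) = psubst \<phi> h p + psubst \<phi> h q"
proof -
  let ?M = "Poly_Mapping.keys p \<union> Poly_Mapping.keys q"
  have "Poly_Mapping.keys (p + q) \<subseteq> ?M" by (rule keys_add)
  then show ?thesis
    using assms by (simp add: psubst_superset[where M = ?M] lookup_add sum.distrib coeff_hom_def distrib_right)
qed

lemma psubst_zero [simp]: "psubst \<phi> h 0 = 0"
  by (simp add: psubst_def)

lemma psubst_sum:
  assumes "coeff_hom \<phi>"
  shows "psubst \<phi> h (\<Sum>i\<in>I. f i) = (\<Sum>i\<in>I. psubst \<phi> h (f i))"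
  by (induction I rule: infinite_finite_induct) (simp_all add: psubst_add[OF assms])

lemma psubst_single:
  assumes "coeff_hom \<phi>"
  shows "psubst \<phi> h (Poly_Mapping.single m c) = \<phi> c * (\<Prod>i\<in>UNIV. h i ^ Poly_Mapping.lookup m i)"
  using assms by (subst psubst_superset[where M = "{m}"]) (auto simp: coeff_hom_def)

lemma psubst_mult:
  assumes "coeff_hom \<phi>"
  shows "psubst \<phi> h (p * q) = psubst \<phi> h p * psubst \<phi> h q"
proof -
  have *: "psubst \<phi> h (Poly_Mapping.single m a * Poly_Mapping.single n b) =
      psubst \<phi> h (Poly_Mapping.single m a) * psubst \<phi> h (Poly_Mapping.single n b)" for m n a b
    using assms by (simp add: psubst_single mult_single lookup_add power_add prod.distrib coeff_hom_def)
  show ?thesis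
    by (subst (1 2 3 4) poly_mapping_eq_sum_single)
      (simp only: sum_product psubst_sum[OF assms] *)
qed

lemma psubst_scale:
  assumes "coeff_hom \<phi>"
  shows "psubst \<phi> h (sym_scale c p) = \<phi> c * psubst \<phi> h p"
  by (simp add: sym_scale_def psubst_mult[OF assms] psubst_single[OF assms])

lemma coeff_hom_single: "coeff_hom (Poly_Mapping.single (0 :: 'n \<Rightarrow>\<^sub>0 nat))"
  by (simp add: coeff_hom_def single_add mult_single)

lemma coeff_hom_id: "coeff_hom (\<lambda>c. c)"
  by (simp add: coeff_hom_def)

lemma sym_act_eq_psubst: "sym_act w = psubst (Poly_Mapping.single 0) (\<lambda>i. sym_incl (w (axis i 1)))"
  by (simp add: fun_eq_iff sym_act_def psubst_def sym_scale_def)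

lemma sym_act_add: "sym_act w (p + q) = sym_act w p + sym_act w q"
  by (simp add: sym_act_eq_psubst psubst_add[OF coeff_hom_single])

lemma sym_act_mult: "sym_act w (p * q) = sym_act w p * sym_act w q"
  by (simp add: sym_act_eq_psubst psubst_mult[OF coeff_hom_single])

lemma sym_act_scale: "sym_act w (sym_scale c p) = sym_scale c (sym_act w p)"
  by (simp add: sym_act_eq_psubst psubst_scale[OF coeff_hom_single])
    (simp add: sym_scale_def)

lemma sym_act_zero [simp]: "sym_act w 0 = 0"
  by (simp add: sym_act_eq_psubst)

lemma sym_act_one [simp]: "sym_act w 1 = 1"
  unfolding sym_act_eq_psubst single_one[symmetric]
  by (subst psubst_single[OF coeff_hom_single]) simp

lemma sym_act_minus: "sym_act w (- p) = - sym_act w p"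
  using sym_act_add[of w p "- p"] by (simp add: eq_neg_iff_add_eq_0 add.commute)

lemma sym_act_diff: "sym_act w (p - q) = sym_act w p - sym_act w q"
  using sym_act_add[of w p "- q"] by (simp add: sym_act_minus)

lemma sym_act_power: "sym_act w (p ^ n) = sym_act w p ^ n"
  by (induction n) (simp_all add: sym_act_mult)

lemma sym_act_numeral [simp]: "sym_act w (numeral n) = numeral n"
proof -
  have "sym_act w (of_nat k) = of_nat k" for k
    by (induction k) (simp_all add: sym_act_add)
  from this[of "numeral n"] show ?thesis by simp
qed

lemmas sym_act_hom = sym_act_add sym_act_mult sym_act_diff sym_act_minus sym_act_power

lemma sym_incl_add: "sym_incl (v + w) = sym_incl v + sym_incl w"
  by (simp add: sym_incl_def single_add sum.distrib)

lemma sym_incl_scaleR: "sym_incl (c *\<^sub>R v) = sym_scale (of_real c) (sym_incl v)"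
  by (simp add: sym_incl_def sym_scale_def sum_distrib_left mult_single)

lemma sym_incl_zero [simp]: "sym_incl 0 = 0"
  by (simp add: sym_incl_def)

lemma sym_incl_minus: "sym_incl (- v) = - sym_incl v"
  by (simp add: sym_incl_def sum_negf single_uminus)

lemma sym_incl_diff: "sym_incl (v - w) = sym_incl v - sym_incl w"
  using sym_incl_add[of v "- w"] by (simp add: sym_incl_minus)

lemma sym_incl_sum: "sym_incl (\<Sum>i\<in>I. f i) = (\<Sum>i\<in>I. sym_incl (f i))"
  by (induction I rule: infinite_finite_induct) (simp_all add: sym_incl_add)

lemma sym_scale_mult_right: "p * sym_scale c q = sym_scale c (p * q)"
  by (simp add: sym_scale_def mult.left_commute)

lemma sym_scale_numeral: "sym_scale (numeral n) p = numeral n * p"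
  by (simp add: sym_scale_def)

lemma sym_scale_neg_numeral: "sym_scale (- numeral n) p = - (numeral n * p)"
  by (metis sym.scale_minus_left sym_scale_numeral)

lemma psubst_incl:
  assumes "coeff_hom \<phi>"
  shows "psubst \<phi> h (sym_incl v) = (\<Sum>i\<in>UNIV. \<phi> (of_real (v $ i)) * h i)"
proof -
  have "(\<Prod>j\<in>UNIV. h j ^ Poly_Mapping.lookup (Poly_Mapping.single i (1::nat)) j) = h i" for i
    by (subst prod.remove[of _ i]) (auto simp: lookup_single when_def intro!: prod.neutral)
  then show ?thesis
    by (simp add: sym_incl_def psubst_sum[OF assms] psubst_single[OF assms])
qed

lemma sym_act_incl:
  assumes "linear w"
  shows "sym_act w (sym_incl v) = sym_incl (w v)"
proof -
  have "w v = w (\<Sum>i\<in>UNIV. v $ i *\<^sub>R axis i 1)"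
    by (simp add: basis_expansion flip: scalar_mult_eq_scaleR)
  also have "\<dots> = (\<Sum>i\<in>UNIV. v $ i *\<^sub>R w (axis i 1))"
    by (simp add: linear_sum[OF assms] linear_scale[OF assms])
  finally show ?thesis
    by (simp add: sym_act_eq_psubst psubst_incl[OF coeff_hom_single] sym_incl_sum sym_incl_scaleR)
      (simp add: sym_scale_def)
qed

text \<open>Elements of the symmetric algebra as polynomial functions through the inner product: the
  image of a vector \<open>v\<close> takes the value \<open>v \<bullet> x\<close>. Serves to show
  that a cross is not 0.\<close>

definition sym_eval :: "real^'n \<Rightarrow> 'n::finite sym_alg \<Rightarrow> complex" where
  "sym_eval x = psubst (\<lambda>c. c) (\<lambda>i. complex_of_real (x $ i))"

lemma sym_eval_incl: "sym_eval x (sym_incl v) = complex_of_real (v \<bullet> x)"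
  by (simp add: sym_eval_def psubst_incl[OF coeff_hom_id] inner_vec_def)

lemma sym_eval_add: "sym_eval x (p + q) = sym_eval x p + sym_eval x q"
  by (simp add: sym_eval_def psubst_add[OF coeff_hom_id])

lemma sym_eval_mult: "sym_eval x (p * q) = sym_eval x p * sym_eval x q"
  by (simp add: sym_eval_def psubst_mult[OF coeff_hom_id])

lemma sym_eval_zero: "sym_eval x 0 = 0"
  by (simp add: sym_eval_def)

lemma sym_eval_one: "sym_eval x 1 = 1"
  unfolding sym_eval_def single_one[symmetric]
  by (subst psubst_single[OF coeff_hom_id]) simp

lemma sym_eval_diff: "sym_eval x (p - q) = sym_eval x p - sym_eval x q"
  using sym_eval_add[of x "p - q" q] by simp

lemma sym_eval_power: "sym_eval x (p ^ n) = sym_eval x p ^ n"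
  by (induction n) (simp_all add: sym_eval_mult sym_eval_one)

lemma sym_eval_numeral: "sym_eval x (numeral n) = numeral n"
proof -
  have "sym_eval x (of_nat k) = of_nat k" for k
    by (induction k) (simp_all add: sym_eval_add sym_eval_one sym_eval_zero)
  from this[of "numeral n"] show ?thesis by simp
qed

section \<open>Root systems with roots of one length\<close>

lemma root_refl_self: "a \<noteq> 0 \<Longrightarrow> root_refl a a = - a"
  by (simp add: root_refl_def cartan_int_def scaleR_2)

lemma linear_root_refl: "linear (root_refl a)"
  by (auto simp: root_refl_def cartan_int_def algebra_simps inner_add_left inner_diff_left
      add_divide_distrib intro!: linearI)

lemma root_refl_inner: "a \<noteq> 0 \<Longrightarrow> root_refl a x \<bullet> root_refl a y = x \<bullet> y"
  by (simp add: root_refl_def cartan_int_def inner_diff_left inner_diff_right inner_commute field_simps)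

lemma root_system_nonzero: "root_system S \<Longrightarrow> x \<in> S \<Longrightarrow> x \<noteq> 0"
  by (auto simp: root_system_def)

lemma root_system_refl: "root_system S \<Longrightarrow> a \<in> S \<Longrightarrow> x \<in> S \<Longrightarrow> root_refl a x \<in> S"
  by (auto simp: root_system_def)

lemma root_system_neg: "root_system S \<Longrightarrow> x \<in> S \<Longrightarrow> - x \<in> S"
  by (metis root_refl_self root_system_nonzero root_system_refl)

text \<open>The sum is the reflection of \<open>x\<close> in \<open>y\<close>, the Cartan integer
  being -1; this is how further roots are produced from simple ones.\<close>

lemma root_system_add:
  assumes "root_system S" "x \<in> S" "y \<in> S" "2 * (x \<bullet> y) = - (y \<bullet> y)"
  shows "x + y \<in> S"
proof -
  have "y \<noteq> 0" using assms root_system_nonzero by blast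
  then have "root_refl y x = x + y"
    using assms(4) by (simp add: root_refl_def cartan_int_def)
  then show ?thesis using root_system_refl[OF assms(1,3,2)] by simp
qed

lemma root_basis_finite: "root_basis B S \<Longrightarrow> finite B"
  by (auto simp: root_basis_def independent_imp_finite)

lemma independent_coeff_eq:
  assumes "independent B" "finite B" "(\<Sum>b\<in>B. f b *\<^sub>R b) = (\<Sum>b\<in>B. g b *\<^sub>R b)" "b \<in> B"
  shows "f b = g b"
proof -
  have "(\<Sum>b\<in>B. (f b - g b) *\<^sub>R b) = 0"
    using assms(3) by (simp add: scaleR_left_diff_distrib sum_subtractf)
  then have "f b - g b = 0"
    using assms(1,2,4) independentD[OF assms(1), of B "\<lambda>b. f b - g b" b] by auto
  then show ?thesis by simp
qed

text \<open>Induction on the height. As \<open>x \<bullet> x\<close> is positive, some simple root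
  \<open>b\<close> occurring in \<open>x\<close> pairs positively with \<open>x\<close>, and the
  reflection in \<open>b\<close> preserves the length while lowering the coefficient of
  \<open>b\<close> and no other. Either the result is again positive, of smaller height, or
  \<open>x\<close> is a multiple of \<open>b\<close>, hence \<open>b\<close> itself since the system
  is reduced.\<close>

lemma positive_root_length:
  fixes S :: "'a::euclidean_space set"
  assumes S: "root_system S" and B: "root_basis B S" and L: "\<And>b. b \<in> B \<Longrightarrow> b \<bullet> b = L"
  shows "x \<in> S \<Longrightarrow> x = (\<Sum>b\<in>B. real (n b) *\<^sub>R b) \<Longrightarrow> x \<bullet> x = L"
proof (induction "\<Sum>b\<in>B. n b" arbitrary: x n rule: less_induct)
  case (less n x)
  have fin: "finite B" and ind: "independent B" and BS: "B \<subseteq> S"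
    using B by (auto simp: root_basis_def root_basis_finite[OF B])
  have "x \<noteq> 0" using S less.prems root_system_nonzero by blast
  then have "0 < x \<bullet> x" by simp
  also have "x \<bullet> x = (\<Sum>b\<in>B. real (n b) * (b \<bullet> x))"
    by (subst (1) less.prems(2)) (simp add: inner_sum_left)
  finally obtain b where b: "b \<in> B" "0 < real (n b) * (b \<bullet> x)"
    by (meson not_less sum_nonpos)
  then have nb: "n b > 0" and bx: "b \<bullet> x > 0"
    by (auto simp: zero_less_mult_iff)
  have b0: "b \<noteq> 0" using bx by auto
  define c where "c = cartan_int x b"
  define x' where "x' = root_refl b x"
  have x'S: "x' \<in> S" using S BS b less.prems by (auto simp: x'_def root_system_refl)
  have norm: "x' \<bullet> x' = x \<bullet> x" using b0 by (simp add: x'_def root_refl_inner)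
  have "c \<in> \<int>" using S BS b less.prems by (auto simp: c_def root_system_def)
  moreover have "c > 0" using bx b0 by (simp add: c_def cartan_int_def inner_commute)
  ultimately have c1: "c \<ge> 1" by (auto simp: Ints_def)
  have x'sum: "x' = (\<Sum>d\<in>B. (real (n d) - (if d = b then c else 0)) *\<^sub>R d)"
  proof -
    have "(\<Sum>d\<in>B. (if d = b then c else 0) *\<^sub>R d) = c *\<^sub>R b"
      using b fin by (simp add: if_distrib[of "\<lambda>t. t *\<^sub>R _"] cong: if_cong)
    then show ?thesis
      by (simp add: x'_def root_refl_def c_def[symmetric] scaleR_left_diff_distrib sum_subtractf
          less.prems(2)[symmetric])
  qed
  consider m where "x' = (\<Sum>b\<in>B. real (m b) *\<^sub>R b)" | m where "- x' = (\<Sum>b\<in>B. real (m b) *\<^sub>R b)"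
    using B x'S by (auto simp: root_basis_def positive_roots_def)
  then show ?case
  proof cases
    case (1 m)
    have eq: "real (m d) = real (n d) - (if d = b then c else 0)" if "d \<in> B" for d
      by (rule independent_coeff_eq[OF ind fin _ that]) (metis "1" x'sum)
    have "(\<Sum>d\<in>B. m d) < (\<Sum>d\<in>B. n d)"
    proof (rule sum_strict_mono_ex1[OF fin])
      show "\<forall>d\<in>B. m d \<le> n d"
      proof
        fix d assume "d \<in> B" then show "m d \<le> n d" using eq[of d] c1 by (auto split: if_splits)
      qed
      show "\<exists>d\<in>B. m d < n d" using eq[OF b(1)] c1 b(1) by (intro bexI[of _ b]) auto
    qed
    from less.hyps[OF this x'S 1] show ?thesis using norm by simp
  next
    case (2 m)
    have x'2: "x' = (\<Sum>d\<in>B. (- real (m d)) *\<^sub>R d)"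
      by (simp add: sum_negf flip: 2)
    have eq: "- real (m d) = real (n d) - (if d = b then c else 0)" if "d \<in> B" for d
      by (rule independent_coeff_eq[OF ind fin _ that]) (metis x'2 x'sum)
    \<comment> \<open>A negative reflected root has coefficients at most 0, but away from
      \<open>b\<close> they are those of \<open>x\<close>, which are at least 0.\<close>
    have zero: "n d = 0" if "d \<in> B" "d \<noteq> b" for d
      using eq[OF that(1)] that(2) by simp
    have "x = (\<Sum>d\<in>{b}. real (n d) *\<^sub>R d)"
      unfolding less.prems(2) using fin b zero by (intro sum.mono_neutral_right) auto
    then have "x = real (n b) *\<^sub>R b" by simp
    moreover have "real (n b) = 1 \<or> real (n b) = -1"
      using S BS b less.prems(1) calculation unfolding root_system_def by blast
    ultimately show ?thesis using L b by auto
  qed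
qed

lemma root_length:
  fixes S :: "'a::euclidean_space set"
  assumes "root_system S" "root_basis B S" "\<And>b. b \<in> B \<Longrightarrow> b \<bullet> b = L" "x \<in> S"
  shows "x \<bullet> x = L"
proof -
  have "(\<exists>n :: 'a \<Rightarrow> nat. x = (\<Sum>b\<in>B. real (n b) *\<^sub>R b)) \<or>
      (- x \<in> S \<and> (\<exists>n :: 'a \<Rightarrow> nat. - x = (\<Sum>b\<in>B. real (n b) *\<^sub>R b)))"
    using assms(2,4) by (auto simp: root_basis_def positive_roots_def)
  then show ?thesis
  proof (elim disjE exE conjE)
    fix n :: "'a \<Rightarrow> nat" assume "x = (\<Sum>b\<in>B. real (n b) *\<^sub>R b)"
    then show ?thesis using positive_root_length[OF assms(1,2,3,4)] by blast
  next
    fix n :: "'a \<Rightarrow> nat" assume "- x \<in> S" "- x = (\<Sum>b\<in>B. real (n b) *\<^sub>R b)"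
    then have "- x \<bullet> - x = L" using positive_root_length[OF assms(1,2,3)] by blast
    then show ?thesis by simp
  qed
qed

text \<open>\<open>L\<close> stands for an additive subgroup containing the simple roots; it is
  instantiated with integer lattices in coordinates as well as with a linear span.\<close>

lemma root_in_lattice:
  fixes S :: "'a::euclidean_space set"
  assumes "root_basis B S" "L 0" "\<And>x y. L x \<Longrightarrow> L y \<Longrightarrow> L (x + y)" "\<And>x. L x \<Longrightarrow> L (- x)"
    "\<And>b. b \<in> B \<Longrightarrow> L b" "x \<in> S"
  shows "L x"
proof -
  have mult: "L (real k *\<^sub>R b)" if "L b" for k b
    by (induction k) (auto simp: assms(2) assms(3) that scaleR_left_distrib)
  have sums: "L (\<Sum>b\<in>C. real (n b) *\<^sub>R b)" if "C \<subseteq> B" for C n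
    using that by (induction C rule: infinite_finite_induct) (auto simp: assms(2,3,5) mult)
  have pos: "L y" if "y \<in> positive_roots B S" for y
    using that sums[of B] by (auto simp: positive_roots_def)
  have "x \<in> positive_roots B S \<or> - x \<in> positive_roots B S"
    using assms(1,6) by (auto simp: root_basis_def)
  then show ?thesis
    using pos[of x] assms(4)[OF pos[of "- x"]] by auto
qed

text \<open>The pairing is an integer multiple \<open>z\<close> of \<open>c\<close>, half the
  squared length. The squared lengths of \<open>x - y\<close> and \<open>x + y\<close> being
  nonnegative, \<open>z\<close> is at most 2 in absolute value, and at the bounds one of these two
  vectors vanishes.\<close>

lemma equal_length_pairing:
  fixes x y :: "'a::euclidean_space"
  assumes "root_system S" "x \<in> S" "y \<in> S" "x \<bullet> x = 2 * c" "y \<bullet> y = 2 * c"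
  shows "x \<bullet> y = 0 \<or> x \<bullet> y = c \<or> x \<bullet> y = - c \<or> x = y \<or> x = - y"
proof -
  have "y \<noteq> 0" using assms root_system_nonzero by blast
  then have c: "c > 0" using assms(5) inner_gt_zero_iff[of y] by simp
  have "cartan_int x y \<in> \<int>" using assms by (auto simp: root_system_def)
  then obtain z where z: "2 * (x \<bullet> y) / (2 * c) = of_int z"
    using assms(5) by (auto simp: cartan_int_def Ints_def)
  then have z': "x \<bullet> y = of_int z * c" using c by (simp add: field_simps)
  have "(x - y) \<bullet> (x - y) = 4 * c - 2 * (of_int z * c)" "(x + y) \<bullet> (x + y) = 4 * c + 2 * (of_int z * c)"
    using assms z' by (simp_all add: inner_diff inner_add inner_commute)
  then have e: "(x - y) \<bullet> (x - y) = 2 * c * (2 - of_int z)" "(x + y) \<bullet> (x + y) = 2 * c * (2 + of_int z)"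
    by (simp_all add: algebra_simps)
  then have "0 \<le> 2 * c * (2 - of_int z)" "0 \<le> 2 * c * (2 + of_int z)"
    using inner_ge_zero[of "x - y"] inner_ge_zero[of "x + y"] by simp_all
  then have "z \<le> 2" "- 2 \<le> z" using c by (simp_all add: zero_le_mult_iff)
  then consider "z = 0" | "z = 1" | "z = -1" | "z = 2" | "z = -2" by linarith
  then show ?thesis
  proof cases
    case 4
    then have "(x - y) \<bullet> (x - y) = 0" using e by simp
    then show ?thesis by simp
  next
    case 5
    then have "(x + y) \<bullet> (x + y) = 0" using e by simp
    then show ?thesis by (simp add: eq_neg_iff_add_eq_0)
  qed (use z' in auto)
qed

section \<open>Positive systems and discriminants\<close>

text \<open>A vanishing combination splits into two parts that are orthogonal and opposite to each
  other, so both vanish.\<close>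

lemma independent_orthogonal_Un:
  fixes A B :: "'a::euclidean_space set"
  assumes A: "independent A" and B: "independent B" and AB: "\<forall>x\<in>A. \<forall>y\<in>B. x \<bullet> y = 0"
  shows "independent (A \<union> B)"
proof (rule independent_if_scalars_zero)
  have fA: "finite A" and fB: "finite B" using A B by (auto intro: independent_imp_finite)
  then show "finite (A \<union> B)" by simp
  have "0 \<notin> A" using A dependent_zero by blast
  then have disj: "A \<inter> B = {}" using AB by (metis disjoint_iff inner_eq_zero_iff)
  fix f x assume sum: "(\<Sum>b\<in>A \<union> B. f b *\<^sub>R b) = 0" and x: "x \<in> A \<union> B"
  let ?u = "\<Sum>b\<in>A. f b *\<^sub>R b" and ?v = "\<Sum>b\<in>B. f b *\<^sub>R b"
  have uv: "?u + ?v = 0" using sum fA fB disj by (simp add: sum.union_disjoint)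
  have "?u \<bullet> ?v = 0" using AB by (simp add: inner_sum_left inner_sum_right)
  moreover have "?v = - ?u" using uv by (simp add: eq_neg_iff_add_eq_0 add.commute)
  ultimately have "?u = 0" by simp
  then have "?u = 0" "?v = 0" using uv by simp_all
  then show "f x = 0"
    using x independentD[OF A fA order.refl, of f x] independentD[OF B fB order.refl, of f x] by blast
qed

lemma positive_roots_mono:
  assumes "finite C" "B \<subseteq> C" "x \<in> positive_roots B S" "S \<subseteq> S'"
  shows "x \<in> positive_roots C S'"
proof -
  obtain n :: "'a \<Rightarrow> nat" where n: "x = (\<Sum>b\<in>B. real (n b) *\<^sub>R b)"
    using assms(3) by (auto simp: positive_roots_def)
  have "x = (\<Sum>b\<in>C. real (if b \<in> B then n b else 0) *\<^sub>R b)"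
    unfolding n using assms(1,2) by (intro sum.mono_neutral_cong_left) auto
  then have "\<exists>n :: 'a \<Rightarrow> nat. x = (\<Sum>b\<in>C. real (n b) *\<^sub>R b)" by (rule exI[of _ "\<lambda>b. if b \<in> B then n b else 0"])
  moreover have "x \<in> S'" using assms(3,4) by (auto simp: positive_roots_def)
  ultimately show ?thesis
    unfolding positive_roots_def by blast
qed

lemma root_basis_Un:
  fixes S :: "'a::euclidean_space set"
  assumes B: "root_basis B S" and C: "root_basis C S'" and orth: "\<forall>x\<in>S. \<forall>y\<in>S'. x \<bullet> y = 0"
  shows "root_basis (B \<union> C) (S \<union> S')"
proof -
  have "finite (B \<union> C)" using B C root_basis_finite by blast
  moreover have "independent (B \<union> C)"
    using B C orth by (intro independent_orthogonal_Un) (auto simp: root_basis_def)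
  ultimately show ?thesis
    using B C positive_roots_mono[of "B \<union> C" B _ S "S \<union> S'"] positive_roots_mono[of "B \<union> C" C _ S' "S \<union> S'"]
    by (auto simp: root_basis_def)
qed

text \<open>A choice of one root from each pair of opposite roots. The discriminant up to sign
  depends on no more than this, and unlike a positive system it can be checked for an explicit list
  of roots without a basis.\<close>

definition half_system :: "'a::euclidean_space set \<Rightarrow> 'a set \<Rightarrow> bool" where
  "half_system S P \<longleftrightarrow> finite P \<and> P \<subseteq> S \<and> (\<forall>x\<in>S. x \<in> P \<longleftrightarrow> - x \<notin> P)"

lemma positive_system_half:
  fixes S :: "'a::euclidean_space set"
  assumes "positive_system S P" "finite S" "0 \<notin> S" "\<And>x. x \<in> S \<Longrightarrow> - x \<in> S"
  shows "half_system S P"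
proof -
  obtain B where B: "root_basis B S" and P: "P = positive_roots B S"
    using assms(1) by (auto simp: positive_system_def)
  have fin: "finite B" and ind: "independent B" using B by (auto simp: root_basis_def root_basis_finite[OF B])
  have no: False if xP: "x \<in> P" and mxP: "- x \<in> P" for x
  proof -
    obtain n :: "'a \<Rightarrow> nat" where n: "x = (\<Sum>b\<in>B. real (n b) *\<^sub>R b)"
      using xP P by (auto simp: positive_roots_def)
    obtain m :: "'a \<Rightarrow> nat" where m: "- x = (\<Sum>b\<in>B. real (m b) *\<^sub>R b)"
      using mxP P by (auto simp: positive_roots_def)
    have "(\<Sum>b\<in>B. (real (n b) + real (m b)) *\<^sub>R b) = x + - x"
      by (simp only: scaleR_left_distrib sum.distrib n[symmetric] m[symmetric])
    then have "(\<Sum>b\<in>B. (real (n b) + real (m b)) *\<^sub>R b) = 0" by simp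
    then have "\<forall>b\<in>B. real (n b) + real (m b) = 0"
      by (auto intro: independentD[OF ind fin order.refl])
    then have "\<forall>b\<in>B. n b = 0" by (simp add: add_nonneg_eq_0_iff)
    then have "x = 0" using n by simp
    then show False using xP P assms(3) by (auto simp: positive_roots_def)
  qed
  have "finite P" "P \<subseteq> S" using P assms(2) by (auto simp: positive_roots_def)
  moreover have "x \<in> P \<or> - x \<in> P" if "x \<in> S" for x
    using that B P by (auto simp: root_basis_def)
  ultimately show ?thesis using no by (auto simp: half_system_def)
qed

text \<open>Passing from \<open>P\<close> to \<open>Q\<close> replaces some roots by their
  negatives, and each replacement contributes a factor -1.\<close>

lemma discriminant_half:
  assumes P: "half_system S P" and Q: "half_system S Q"
  shows "discriminant P = discriminant Q \<or> discriminant P = - discriminant Q"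
proof -
  define h where "h x = (if x \<in> Q then x else - x)" for x
  have "bij_betw h P Q"
    unfolding bij_betw_def
  proof
    show "inj_on h P"
      using P Q unfolding inj_on_def h_def half_system_def by (metis minus_minus subset_eq)
    show "h ` P = Q"
    proof
      show "h ` P \<subseteq> Q" using P Q unfolding h_def half_system_def by auto
      show "Q \<subseteq> h ` P"
      proof
        fix y assume y: "y \<in> Q"
        show "y \<in> h ` P"
        proof (cases "y \<in> P")
          case True then show ?thesis using y by (intro image_eqI[of _ _ y]) (auto simp: h_def)
        next
          case False
          then have "- y \<in> P" using P Q y by (auto simp: half_system_def)
          moreover have "- y \<notin> Q" using P Q y by (auto simp: half_system_def)
          ultimately show ?thesis by (intro image_eqI[of _ _ "- y"]) (auto simp: h_def)
        qed
      qed
    qed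
  qed
  then have "discriminant Q = (\<Prod>x\<in>P. sym_incl (h x))"
    unfolding discriminant_def by (rule prod.reindex_bij_betw[symmetric])
  also have "\<dots> = (\<Prod>x\<in>P. (if x \<in> Q then 1 else - 1) * sym_incl x)"
    by (intro prod.cong) (auto simp: h_def sym_incl_minus)
  also have "\<dots> = (\<Prod>x\<in>P. (if x \<in> Q then 1 else - 1)) * discriminant P"
    by (simp add: prod.distrib discriminant_def)
  finally have eq: "discriminant Q = (\<Prod>x\<in>P. (if x \<in> Q then 1 else - 1)) * discriminant P" .
  have "(\<Prod>x\<in>P. (if x \<in> Q then 1 else - 1)) = (1::'a sym_alg) \<or> (\<Prod>x\<in>P. (if x \<in> Q then 1 else - 1)) = (-1::'a sym_alg)"
    by (induction P rule: infinite_finite_induct) auto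
  then show ?thesis using eq by auto
qed

section \<open>Systems of type \<open>A\<^sub>1\<close> and \<open>A\<^sub>2\<close>\<close>

definition A2_set :: "'a::euclidean_space \<Rightarrow> 'a \<Rightarrow> 'a set" where
  "A2_set x y = {x, y, x + y, - x, - y, - (x + y)}"

text \<open>Equally long vectors at an angle of 120 degrees, that is, a simple pair.\<close>

definition A2_pair :: "'a::euclidean_space \<Rightarrow> 'a \<Rightarrow> bool" where
  "A2_pair x y \<longleftrightarrow> x \<noteq> 0 \<and> x \<bullet> x = y \<bullet> y \<and> 2 * (x \<bullet> y) = - (x \<bullet> x)"

text \<open>By \<open>root_length\<close> a positive root \<open>p x + q y\<close> is as long as
  \<open>x\<close>, which means \<open>p^2 - p q + q^2 = 1\<close>; with \<open>p\<close> and
  \<open>q\<close> nonnegative this leaves \<open>x\<close>, \<open>y\<close> and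
  \<open>x + y\<close>.\<close>

lemma type_A2_imp:
  assumes "type_A2 S"
  obtains x y where "A2_pair x y" "S = A2_set x y"
proof -
  obtain a :: "nat \<Rightarrow> 'a" where S: "root_system S" and inj: "inj_on a {..<2}"
    and B: "root_basis (a ` {..<2}) S" and C: "\<forall>i<2. \<forall>j<2. cartan_int (a i) (a j) =
           (if i = j then 2 else if {i, j} \<in> {{0, 1}} then -1 else 0)"
    using assms by (auto simp: type_A2_def has_dynkin_type_def)
  have B2: "a ` {..<2} = {a 0, a 1}" by (auto simp: numeral_2_eq_2 lessThan_Suc)
  define x y where "x = a 0" and "y = a 1"
  have mem: "x \<in> S" "y \<in> S" using B B2 by (auto simp: root_basis_def x_def y_def)
  then have nz: "x \<noteq> 0" "y \<noteq> 0" using S root_system_nonzero by auto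
  have c: "cartan_int x y = -1" "cartan_int y x = -1"
    using C[rule_format, of 0 1] C[rule_format, of 1 0] by (simp_all add: x_def y_def insert_commute)
  have xy: "2 * (x \<bullet> y) = - (y \<bullet> y)" "2 * (x \<bullet> y) = - (x \<bullet> x)"
    using c nz by (simp_all add: cartan_int_def field_simps inner_commute)
  have pair: "A2_pair x y" using nz xy by (simp add: A2_pair_def)
  have "x + y \<in> S" using root_system_add[OF S mem] xy by simp
  then have "A2_set x y \<subseteq> S"
    using mem root_system_neg[OF S] unfolding A2_set_def by blast
  moreover have "S \<subseteq> A2_set x y"
  proof
    have neq: "x \<noteq> y" using xy nz by auto
    have pos: "z \<in> A2_set x y" if zpos: "z \<in> positive_roots {x, y} S" for z
    proof -
      obtain n :: "'a \<Rightarrow> nat" where n: "z = (\<Sum>b\<in>{x, y}. real (n b) *\<^sub>R b)"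
        and zS: "z \<in> S" using zpos unfolding positive_roots_def by blast
      define p q where "p = int (n x)" and "q = int (n y)"
      have z: "z = of_int p *\<^sub>R x + of_int q *\<^sub>R y" using n neq by (simp add: p_def q_def)
      have "y \<bullet> y = x \<bullet> x" using xy by linarith
      then have "b \<bullet> b = x \<bullet> x" if "b \<in> a ` {..<2}" for b
        using that unfolding B2 x_def[symmetric] y_def[symmetric] by blast
      then have "z \<bullet> z = x \<bullet> x" by (rule root_length[OF S B _ zS])
      moreover have "z \<bullet> z = (of_int (p * p - p * q + q * q)) * (x \<bullet> x)"
      proof -
        have e: "y \<bullet> y = x \<bullet> x" "x \<bullet> y = - (x \<bullet> x) / 2" "y \<bullet> x = - (x \<bullet> x) / 2"
          using xy by (simp_all add: inner_commute)
        show ?thesis unfolding z by (simp add: inner_add_left inner_add_right e algebra_simps)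
      qed
      ultimately have "(of_int (p * p - p * q + q * q) :: real) = 1" using nz by simp
      then have pq: "p * p - p * q + q * q = 1" by linarith
      have "p \<ge> 0" "q \<ge> 0" by (auto simp: p_def q_def)
      \<comment> \<open>Written as a square plus a nonnegative product, the equation bounds
        \<open>p * q\<close> by 1.\<close>
      have sq: "(p - q) * (p - q) + p * q = 1" using pq by (simp add: algebra_simps)
      have "p * q \<le> 1" using sq zero_le_square[of "p - q"] by linarith
      have "p * q = 0 \<or> p * q = 1" using \<open>p * q \<le> 1\<close> \<open>p \<ge> 0\<close> \<open>q \<ge> 0\<close>
        using mult_nonneg_nonneg[of p q] by linarith
      then have "(p, q) \<in> {(1, 0), (0, 1), (1, 1)}"
      proof
        assume "p * q = 1"
        then show ?thesis using \<open>p \<ge> 0\<close> \<open>q \<ge> 0\<close> by (auto simp: zmult_eq_1_iff)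
      next
        assume "p * q = 0"
        then have "p = 0 \<and> q * q = 1 \<or> q = 0 \<and> p * p = 1" using pq by auto
        then show ?thesis using \<open>p \<ge> 0\<close> \<open>q \<ge> 0\<close> by (auto simp: zmult_eq_1_iff)
      qed
      then show ?thesis using z by (auto simp: A2_set_def)
    qed
    fix z assume "z \<in> S"
    then have "z \<in> positive_roots {x, y} S \<or> - z \<in> positive_roots {x, y} S"
      using B unfolding B2 by (auto simp: root_basis_def x_def y_def)
    then show "z \<in> A2_set x y"
    proof
      assume "- z \<in> positive_roots {x, y} S"
      from pos[OF this] show ?thesis by (auto simp: A2_set_def minus_equation_iff[of z] equation_minus_iff)
    qed (rule pos)
  qed
  ultimately show ?thesis using that pair by blast
qed

lemma A2_pair_independent:
  assumes "A2_pair x y" shows "independent {x, y}" "x \<noteq> y"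
proof -
  show ne: "x \<noteq> y" using assms by (auto simp: A2_pair_def)
  show "independent {x, y}"
  proof (rule independent_if_scalars_zero)
    fix f z assume 0: "(\<Sum>b\<in>{x, y}. f b *\<^sub>R b) = 0" and z: "z \<in> {x, y}"
    have s: "f x *\<^sub>R x + f y *\<^sub>R y = 0" using 0 ne by simp
    have "2 * ((f x *\<^sub>R x + f y *\<^sub>R y) \<bullet> x) = (2 * f x - f y) * (x \<bullet> x)"
      "2 * ((f x *\<^sub>R x + f y *\<^sub>R y) \<bullet> y) = (2 * f y - f x) * (x \<bullet> x)"
      using assms by (auto simp: A2_pair_def inner_add_left inner_commute algebra_simps)
    then have "(2 * f x - f y) * (x \<bullet> x) = 0" "(2 * f y - f x) * (x \<bullet> x) = 0" unfolding s by simp_all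
    then have "2 * f x - f y = 0" "2 * f y - f x = 0" using assms by (auto simp: A2_pair_def)
    then show "f z = 0" using z by auto
  qed simp
qed

lemma A2_pair_type_A2:
  assumes "A2_pair x y" shows "type_A2 (A2_set x y)"
proof -
  define L where "L = x \<bullet> x"
  have nz: "x \<noteq> 0" "y \<noteq> 0" using assms by (auto simp: A2_pair_def)
  have L: "x \<bullet> x = L" "y \<bullet> y = L" "x \<bullet> y = - L / 2" "y \<bullet> x = - L / 2" "L > 0"
    using assms by (auto simp: A2_pair_def L_def inner_commute)
  have len: "z \<bullet> z = L" if "z \<in> A2_set x y" for z
    using that L(5) by (auto simp: A2_set_def inner_add_left inner_add_right inner_diff_left inner_diff_right L)
  \<comment> \<open>The vectors \<open>x\<close>, \<open>y\<close>, \<open>z\<close> sum to 0 and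
    pairwise enclose 120 degrees, and the system consists of them and their negatives. This symmetry
    reduces closure under reflections to the fact \<open>base\<close>.\<close>
  define z where "z = - (x + y)"
  have set: "A2_set x y = {x, y, z} \<union> uminus ` {x, y, z}" by (auto simp: A2_set_def z_def)
  have obtuse: "root_refl a b = a + b \<and> cartan_int b a = -1" if "a \<bullet> a = L" "b \<bullet> a = - L / 2" for a b
    using that L(5) by (simp add: root_refl_def cartan_int_def add.commute)
  have same: "root_refl a a = - a \<and> cartan_int a a = 2" if "a \<bullet> a = L" for a
    using that L(5) by (auto simp: root_refl_def cartan_int_def scaleR_2)
  have gram: "z \<bullet> z = L" "x \<bullet> z = - L / 2" "z \<bullet> x = - L / 2" "y \<bullet> z = - L / 2" "z \<bullet> y = - L / 2"
    by (simp_all add: z_def inner_add_left inner_add_right inner_diff_left inner_diff_right L)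
  have sums: "x + y = - z" "y + x = - z" "x + z = - y" "z + x = - y" "y + z = - x" "z + y = - x"
    by (simp_all add: z_def)
  have base: "root_refl a b \<in> uminus ` {x, y, z} \<and> cartan_int b a \<in> {2, -1}"
    if "a \<in> {x, y, z}" "b \<in> {x, y, z}" for a b
  proof -
    have "a = b \<or> a \<bullet> a = L \<and> b \<bullet> a = - L / 2 \<and> a + b \<in> uminus ` {x, y, z}"
      using that by (auto simp: L gram sums)
    moreover have "a \<bullet> a = L" using that by (auto simp: L gram)
    ultimately show ?thesis using obtuse[of a b] same[of a] that by auto
  qed
  have refl: "root_refl a b \<in> A2_set x y \<and> cartan_int b a \<in> \<int>"
    if ab: "a \<in> A2_set x y" "b \<in> A2_set x y" for a b
  proof -
    obtain a' where a': "a' \<in> {x, y, z}" "a = a' \<or> a = - a'" using ab(1) unfolding set by blast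
    obtain b' where b': "b' \<in> {x, y, z}" "b = b' \<or> b = - b'" using ab(2) unfolding set by blast
    have "root_refl a b = root_refl a' b' \<or> root_refl a b = - root_refl a' b'"
      "cartan_int b a = cartan_int b' a' \<or> cartan_int b a = - cartan_int b' a'"
      using a'(2) b'(2) by (auto simp: root_refl_def cartan_int_def)
    moreover have "- v \<in> A2_set x y" if "v \<in> A2_set x y" for v using that unfolding set by auto
    moreover have "root_refl a' b' \<in> A2_set x y" using base[OF a'(1) b'(1)] unfolding set by blast
    moreover have "cartan_int b' a' \<in> \<int>" using base[OF a'(1) b'(1)] by auto
    ultimately show ?thesis by (metis Ints_minus)
  qed
  have "root_system (A2_set x y)"
    unfolding root_system_def
  proof (intro conjI ballI allI impI)
    show "finite (A2_set x y)" by (simp add: A2_set_def)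
    show "0 \<notin> A2_set x y" using len L(5) by fastforce
    fix a t assume a: "a \<in> A2_set x y" "t *\<^sub>R a \<in> A2_set x y"
    have "t * t * L = L" using len[OF a(2)] len[OF a(1)] by simp
    then have "t * t = 1" using L(5) by simp
    then show "t = 1 \<or> t = - 1" by (simp add: square_eq_1_iff)
  qed (use refl in auto)
  moreover have "root_basis {x, y} (A2_set x y)"
  proof -
    have ne: "x \<noteq> y" using A2_pair_independent assms by auto
    have *: "\<exists>n :: 'a \<Rightarrow> nat. z = (\<Sum>b\<in>{x, y}. real (n b) *\<^sub>R b)" if "z = x \<or> z = y \<or> z = x + y" for z
      using that
    proof (elim disjE)
      assume "z = x" then show ?thesis using ne by (intro exI[of _ "\<lambda>b. if b = x then 1 else 0"]) auto
    next
      assume "z = y" then show ?thesis using ne by (intro exI[of _ "\<lambda>b. if b = y then 1 else 0"]) auto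
    next
      assume "z = x + y" then show ?thesis using ne by (intro exI[of _ "\<lambda>b. 1"]) auto
    qed
    have "z \<in> positive_roots {x, y} (A2_set x y)" if "z = x \<or> z = y \<or> z = x + y" for z
      using *[OF that] that unfolding positive_roots_def A2_set_def by blast
    then have "\<forall>z\<in>A2_set x y. z \<in> positive_roots {x, y} (A2_set x y) \<or> - z \<in> positive_roots {x, y} (A2_set x y)"
      unfolding A2_set_def by (metis (no_types, lifting) insert_iff empty_iff minus_minus)
    then show ?thesis
      using A2_pair_independent[OF assms] by (auto simp: root_basis_def A2_set_def)
  qed
  moreover define a where "a i = (if i = 0 then x else y)" for i :: nat
  have "a ` {..<2} = {x, y}" by (auto simp: a_def numeral_2_eq_2 lessThan_Suc)
  moreover have "inj_on a {..<2}" using A2_pair_independent[OF assms] by (auto simp: inj_on_def a_def less_2_cases_iff)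
  moreover have "\<forall>i<2. \<forall>j<2. cartan_int (a i) (a j) = (if i = j then 2 else if {i, j} \<in> {{0, 1}} then -1 else 0)"
    using L by (auto simp: less_2_cases_iff a_def cartan_int_def)
  ultimately show ?thesis
    unfolding type_A2_def has_dynkin_type_def by (intro conjI exI[of _ a]) simp_all
qed

lemma pair_type_A1:
  assumes "x \<noteq> (0::'a::euclidean_space)" shows "type_A1 {x, - x}"
proof -
  have "root_system {x, - x}"
    unfolding root_system_def
  proof (intro conjI ballI allI impI)
    fix a t assume "a \<in> {x, - x}" "t *\<^sub>R a \<in> {x, - x}"
    then have "t * t * (x \<bullet> x) = x \<bullet> x" by (smt (verit) empty_iff inner_minus_left inner_minus_right
          inner_scaleR_left inner_scaleR_right insert_iff minus_minus mult.assoc)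
    then have "t * t = 1" using assms by simp
    then show "t = 1 \<or> t = - 1" by (simp add: square_eq_1_iff)
  next
    fix a b assume ab: "a \<in> {x, - x}" "b \<in> {x, - x}"
    have c: "cartan_int x x = 2" using assms by (simp add: cartan_int_def)
    have "cartan_int b a = 2 \<or> cartan_int b a = - 2"
      using ab c by (auto simp: cartan_int_def)
    then show "cartan_int b a \<in> \<int>" by auto
    have "root_refl a b = - b"
      using ab c by (auto simp: root_refl_def cartan_int_def scaleR_2)
    then show "root_refl a b \<in> {x, - x}" using ab by auto
  qed (use assms in auto)
  moreover have "x \<in> positive_roots {x} {x, - x}"
    by (auto simp: positive_roots_def intro!: exI[of _ "\<lambda>_. 1"])
  then have "root_basis {x} {x, - x}"
    using assms by (auto simp: root_basis_def)
  ultimately show ?thesis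
    using assms unfolding type_A1_def has_dynkin_type_def
    by (intro conjI exI[of _ "\<lambda>_. x"]) (auto simp: cartan_int_def lessThan_Suc)
qed

lemma type_A2_basis: "type_A2 S \<Longrightarrow> \<exists>B. root_basis B S"
  by (auto simp: type_A2_def has_dynkin_type_def)

text \<open>Ensures that every \<open>3A2\<close>-subsystem contributes a generator to the Coble
  space; the bases of the three orthogonal summands unite to a basis.\<close>

lemma summands_3A2_positive:
  assumes "has_summands 3 type_A2 F S"
  shows "\<exists>P. positive_system S P"
proof -
  obtain A1 A2 A3 where F: "F = {A1, A2, A3}" "A1 \<noteq> A2" "A1 \<noteq> A3" "A2 \<noteq> A3"
    using assms by (auto simp: has_summands_def card_3_iff)
  have S: "S = (A1 \<union> A2) \<union> A3" using assms F by (auto simp: has_summands_def)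
  have orth: "\<forall>x\<in>A1. \<forall>y\<in>A2. x \<bullet> y = 0" "\<forall>x\<in>A1 \<union> A2. \<forall>y\<in>A3. x \<bullet> y = 0"
    using assms F by (auto simp: has_summands_def)
  obtain B1 B2 B3 where "root_basis B1 A1" "root_basis B2 A2" "root_basis B3 A3"
    using assms F type_A2_basis by (metis has_summands_def insert_iff)
  then have "root_basis ((B1 \<union> B2) \<union> B3) S"
    unfolding S using orth by (intro root_basis_Un) auto
  then show ?thesis by (auto simp: positive_system_def)
qed

lemma summands_3A2_half:
  assumes "has_summands 3 type_A2 F S" "positive_system S P"
  shows "half_system S P"
proof (rule positive_system_half[OF assms(2)])
  have A: "root_system A" if "A \<in> F" for A
    using assms(1) that by (auto simp: has_summands_def type_A2_def has_dynkin_type_def)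
  show "finite S" "0 \<notin> S" using assms(1) A by (auto simp: has_summands_def root_system_def)
  show "- x \<in> S" if "x \<in> S" for x
    using assms(1) that A root_system_neg by (auto simp: has_summands_def)
qed

section \<open>Coordinates for systems of type \<open>D\<^sub>n\<close>\<close>

definition orthogonal_family :: "nat set \<Rightarrow> (nat \<Rightarrow> 'a::euclidean_space) \<Rightarrow> real \<Rightarrow> bool" where
  "orthogonal_family I f K \<longleftrightarrow> finite I \<and> K > 0 \<and> (\<forall>i\<in>I. \<forall>j\<in>I. f i \<bullet> f j = (if i = j then K else 0))"

text \<open>The standard model of \<open>Dn\<close>, scaled by 2 so that the roots of
  \<open>E6\<close> outside \<open>D5\<close> get coordinates 1 and -1 instead of halves. The index
  set is arbitrary because the \<open>D4\<close>-subsystems arise by deleting one index.\<close>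

definition D_set :: "nat set \<Rightarrow> (nat \<Rightarrow> 'a::euclidean_space) \<Rightarrow> 'a set" where
  "D_set I f = {2 *\<^sub>R (s *\<^sub>R f i + r *\<^sub>R f j) | s r i j.
     i \<in> I \<and> j \<in> I \<and> i \<noteq> j \<and> s \<in> {1, -1} \<and> r \<in> {1, -1}}"

lemma int_sum_squares_eq_2:
  fixes z :: "'i \<Rightarrow> int"
  assumes "finite I" "(\<Sum>i\<in>I. z i * z i) = 2"
  obtains i j where "i \<in> I" "j \<in> I" "i \<noteq> j" "z i \<in> {1, -1}" "z j \<in> {1, -1}"
    "\<And>k. k \<in> I \<Longrightarrow> k \<noteq> i \<Longrightarrow> k \<noteq> j \<Longrightarrow> z k = 0"
proof -
  have le: "z k \<in> {1, 0, -1}" if "k \<in> I" for k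
  proof -
    have "z k * z k \<le> 2" using member_le_sum[OF that, of "\<lambda>i. z i * z i"] assms by simp
    then have "z k ^ 2 < 2 ^ 2" by (simp add: power2_eq_square)
    then have "\<bar>z k\<bar> < 2" using abs_le_square_iff[of 2 "z k"] by simp
    then show ?thesis by auto
  qed
  have "(\<Sum>i\<in>I. z i * z i) = (\<Sum>i\<in>I. if z i \<noteq> 0 then 1 else 0)"
    using le by (intro sum.cong) fastforce+
  also have "\<dots> = int (card {i \<in> I. z i \<noteq> 0})"
    using assms(1) by (simp add: sum.If_cases Int_def)
  finally have "card {i \<in> I. z i \<noteq> 0} = 2" using assms(2) by simp
  then obtain i j where ij: "{i \<in> I. z i \<noteq> 0} = {i, j}" "i \<noteq> j" by (auto simp: card_2_iff)
  have "i \<in> I" "z i \<noteq> 0" "j \<in> I" "z j \<noteq> 0" using ij by auto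
  moreover have "z k = 0" if "k \<in> I" "k \<noteq> i" "k \<noteq> j" for k using ij that by blast
  ultimately show ?thesis using that[of i j] le[of i] le[of j] ij(2) by auto
qed

lemma orthogonal_family_inner_sum:
  assumes "orthogonal_family I f K" "i \<in> I"
  shows "(\<Sum>j\<in>I. c j *\<^sub>R f j) \<bullet> f i = c i * K" "f i \<bullet> (\<Sum>j\<in>I. c j *\<^sub>R f j) = c i * K"
proof -
  have "(\<Sum>j\<in>I. c j * (f j \<bullet> f i)) = (\<Sum>j\<in>I. if j = i then c j * K else 0)"
    using assms by (intro sum.cong) (auto simp: orthogonal_family_def)
  then show "(\<Sum>j\<in>I. c j *\<^sub>R f j) \<bullet> f i = c i * K"
    using assms by (simp add: inner_sum_left orthogonal_family_def)
  then show "f i \<bullet> (\<Sum>j\<in>I. c j *\<^sub>R f j) = c i * K" by (simp add: inner_commute)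
qed

lemma orthogonal_family_inner_sums:
  assumes "orthogonal_family I f K"
  shows "(\<Sum>j\<in>I. c j *\<^sub>R f j) \<bullet> (\<Sum>j\<in>I. d j *\<^sub>R f j) = (\<Sum>j\<in>I. c j * d j) * K"
  by (simp add: inner_sum_left[of _ I "\<Sum>j\<in>I. d j *\<^sub>R f j"] orthogonal_family_inner_sum[OF assms] sum_distrib_right mult.assoc)

lemma D_set_neg: "x \<in> D_set I f \<Longrightarrow> - x \<in> D_set I f"
proof -
  assume "x \<in> D_set I f"
  then obtain s r i j where x: "x = 2 *\<^sub>R (s *\<^sub>R f i + r *\<^sub>R f j)" "i \<in> I" "j \<in> I" "i \<noteq> j" "s \<in> {1, -1}" "r \<in> {1, -1}"
    unfolding D_set_def by blast
  have "- x = 2 *\<^sub>R ((- s) *\<^sub>R f i + (- r) *\<^sub>R f j)" "- s \<in> {1, -1}" "- r \<in> {1, -1}"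
    using x by (auto simp: algebra_simps)
  then show ?thesis using x(2-4) unfolding D_set_def by blast
qed

text \<open>One argument for \<open>D4\<close> and \<open>D5\<close>. All roots lie in the lattice
  generated by the vectors \<open>2 *\<^sub>R f i\<close> and have the length of a simple root, so
  their integral coordinates have square sum 2. Conversely, every such vector is reached from the
  simple roots by adding roots with Cartan integer -1.\<close>

lemma D_diagram_D_set:
  fixes S :: "'a::euclidean_space set"
  assumes S: "root_system S" and B: "root_basis (a ` {..<n}) S" and n: "n \<ge> 3"
    and f: "orthogonal_family {..<n} f K"
    and a: "\<And>i. Suc i < n \<Longrightarrow> a i = 2 *\<^sub>R (f i - f (Suc i))" "a (n - 1) = 2 *\<^sub>R (f (n - 2) + f (n - 1))"
  shows "S = D_set {..<n} f"
proof
  have K: "K > 0" and ff: "\<And>i j. i < n \<Longrightarrow> j < n \<Longrightarrow> f i \<bullet> f j = (if i = j then K else 0)"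
    using f by (auto simp: orthogonal_family_def)
  have aS: "a i \<in> S" if "i < n" for i using B that by (auto simp: root_basis_def)
  have len: "b \<bullet> b = 8 * K" if "b \<in> a ` {..<n}" for b
  proof -
    obtain i where i: "i < n" "b = a i" using \<open>b \<in> a ` {..<n}\<close> by auto
    show ?thesis
    proof (cases "Suc i < n")
      case True
      then show ?thesis using i a(1)[of i] by (simp add: inner_diff_left inner_diff_right ff)
    next
      case False
      then have "i = n - 1" using i by simp
      then show ?thesis using i(2) a(2) n by (simp add: inner_add_left inner_add_right ff)
    qed
  qed
  show "S \<subseteq> D_set {..<n} f"
  proof
    fix x assume x: "x \<in> S"
    let ?L = "\<lambda>x. \<exists>z :: nat \<Rightarrow> int. x = (\<Sum>i\<in>{..<n}. (2 * of_int (z i)) *\<^sub>R f i)"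
    have unit: "(\<Sum>i\<in>{..<n}. (2 * of_int (if i = j then c else 0)) *\<^sub>R f i) = (2 * of_int c) *\<^sub>R f j" if "j < n" for j c
    proof -
      have "(\<Sum>i\<in>{..<n}. (2 * of_int (if i = j then c else 0)) *\<^sub>R f i) = (\<Sum>i\<in>{..<n}. if i = j then (2 * of_int c) *\<^sub>R f i else 0)"
        by (intro sum.cong) auto
      then show ?thesis using that by simp
    qed
    have add: "?L (x + y)" if "?L x" "?L y" for x y
    proof -
      obtain z w :: "nat \<Rightarrow> int" where "x = (\<Sum>i\<in>{..<n}. (2 * of_int (z i)) *\<^sub>R f i)" "y = (\<Sum>i\<in>{..<n}. (2 * of_int (w i)) *\<^sub>R f i)"
        using \<open>?L x\<close> \<open>?L y\<close> by blast
      then show ?thesis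
        by (intro exI[of _ "\<lambda>i. z i + w i"]) (simp add: distrib_left scaleR_left_distrib sum.distrib)
    qed
    have neg: "?L (- x)" if "?L x" for x
    proof -
      obtain z :: "nat \<Rightarrow> int" where "x = (\<Sum>i\<in>{..<n}. (2 * of_int (z i)) *\<^sub>R f i)" using \<open>?L x\<close> by blast
      then show ?thesis by (intro exI[of _ "\<lambda>i. - z i"]) (simp add: sum_negf)
    qed
    have uL1: "?L (2 *\<^sub>R f j)" if "j < n" for j
      using unit[OF that, of 1, symmetric] by (intro exI[of _ "\<lambda>i. if i = j then 1 else 0"]) (simp only: of_int_1 mult_1_right)
    note uL = uL1 neg[OF uL1]
    have "?L (a i)" if "i < n" for i
    proof (cases "Suc i < n")
      case True
      then have "a i = 2 *\<^sub>R f i + - (2 *\<^sub>R f (Suc i))" using a(1) by (simp add: algebra_simps)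
      then show ?thesis using add[OF uL(1)[OF that] uL(2)[OF True]] by simp
    next
      case False
      then have "i = n - 1" using that by simp
      then have "a i = 2 *\<^sub>R f (n - 2) + 2 *\<^sub>R f (n - 1)" using a(2) by (simp add: algebra_simps)
      then show ?thesis using add[OF uL(1)[of "n - 2"] uL(1)[of "n - 1"]] n by simp
    qed
    then have basis: "?L b" if "b \<in> a ` {..<n}" for b using that by blast
    have zero: "?L 0" by (intro exI[of _ "\<lambda>_. 0"]) simp
    have "?L x" by (rule root_in_lattice[OF B zero add neg basis x])
    then obtain z :: "nat \<Rightarrow> int" where z: "x = (\<Sum>i\<in>{..<n}. (2 * of_int (z i)) *\<^sub>R f i)" by blast
    have "8 * K = x \<bullet> x" using root_length[OF S B len x] by simp
    also have "x \<bullet> x = 4 * of_int (\<Sum>i<n. z i * z i) * K"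
      unfolding z orthogonal_family_inner_sums[OF f] by (simp add: sum_distrib_left)
    finally have "real_of_int (\<Sum>i<n. z i * z i) = 2" using K by simp
    then have "(\<Sum>i<n. z i * z i) = 2" by linarith
    then obtain i j where ij: "i < n" "j < n" "i \<noteq> j" "z i \<in> {1, -1}" "z j \<in> {1, -1}"
      "\<And>k. k < n \<Longrightarrow> k \<noteq> i \<Longrightarrow> k \<noteq> j \<Longrightarrow> z k = 0"
      using int_sum_squares_eq_2[of "{..<n}" z] by auto
    have "x = (\<Sum>k\<in>{i, j}. (2 * of_int (z k)) *\<^sub>R f k)"
      unfolding z using ij by (intro sum.mono_neutral_right) auto
    then have "x = 2 *\<^sub>R (of_int (z i) *\<^sub>R f i + of_int (z j) *\<^sub>R f j)"
      using ij(3) by (simp add: scaleR_right_distrib)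
    moreover have "real_of_int (z i) \<in> {1, -1}" "real_of_int (z j) \<in> {1, -1}" using ij by auto
    ultimately show "x \<in> D_set {..<n} f" using ij unfolding D_set_def by blast
  qed
  have diff: "i < j \<Longrightarrow> j < n \<Longrightarrow> 2 *\<^sub>R (f i - f j) \<in> S" for i j
  proof (induction j)
    case (Suc j)
    show ?case
    proof (cases "i = j")
      case True then show ?thesis using aS[of i] a(1) Suc.prems by simp
    next
      case False
      then have "2 *\<^sub>R (f i - f j) \<in> S" using Suc by simp
      moreover have "2 *\<^sub>R (f j - f (Suc j)) \<in> S" using aS[of j] a(1) Suc.prems by simp
      ultimately have "2 *\<^sub>R (f i - f j) + 2 *\<^sub>R (f j - f (Suc j)) \<in> S"
        using False Suc.prems by (intro root_system_add[OF S]) (auto simp: inner_diff_left inner_diff_right ff)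
      then show ?thesis by (simp add: scaleR_right_diff_distrib)
    qed
  qed simp
  then have diff': "2 *\<^sub>R (f i - f j) \<in> S" if "i \<noteq> j" "i < n" "j < n" for i j
    using that root_system_neg[OF S, of "2 *\<^sub>R (f j - f i)"]
    by (cases "i < j") (auto simp: scaleR_right_diff_distrib)
  \<comment> \<open>Among the sums only \<open>2 (f (n - 2) + f (n - 1))\<close> is a simple root;
    the others arise from it by adding differences, which are roots by \<open>diff'\<close>.\<close>
  have last: "2 *\<^sub>R (f i + f (n - 1)) \<in> S" if "i < n - 1" for i
  proof (cases "i = n - 2")
    case True then show ?thesis using aS[of "n - 1"] a(2) n by simp
  next
    case False
    then have "2 *\<^sub>R (f i - f (n - 2)) + 2 *\<^sub>R (f (n - 2) + f (n - 1)) \<in> S"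
      using that n aS[of "n - 1"] a(2)
      by (intro root_system_add[OF S] diff') (auto simp: inner_diff_left inner_diff_right inner_add_right inner_add_left ff)
    then show ?thesis by (simp add: scaleR_right_diff_distrib scaleR_right_distrib)
  qed
  have plus: "2 *\<^sub>R (f i + f j) \<in> S" if "i \<noteq> j" "i < n" "j < n" for i j
  proof (cases "j = n - 1 \<or> i = n - 1")
    case True
    then show ?thesis using last[of i] last[of j] that by (auto simp: add.commute)
  next
    case False
    then have "2 *\<^sub>R (f i + f (n - 1)) + 2 *\<^sub>R (f j - f (n - 1)) \<in> S"
      using that n
      by (intro root_system_add[OF S] diff' last) (auto simp: inner_diff_left inner_diff_right inner_add_right inner_add_left ff)
    then show ?thesis by (simp add: scaleR_right_diff_distrib scaleR_right_distrib)
  qed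
  show "D_set {..<n} f \<subseteq> S"
  proof
    fix x assume "x \<in> D_set {..<n} f"
    then obtain s r i j where x: "x = 2 *\<^sub>R (s *\<^sub>R f i + r *\<^sub>R f j)" and ij: "i < n" "j < n" "i \<noteq> j" and sr: "s \<in> {1, -1}" "r \<in> {1, -1}"
      unfolding D_set_def by blast
    show "x \<in> S"
      using sr plus[OF ij(3,1,2)] diff'[OF ij(3,1,2)] diff'[OF ij(3)[symmetric] ij(2,1)]
        root_system_neg[OF S plus[OF ij(3,1,2)]]
      unfolding x by (auto simp: algebra_simps)
  qed
qed

text \<open>Both systems are parametrised by the same set \<open>Z\<close> of index pairs with
  signs, where \<open>i < j\<close> makes the parameters unique. Equality of the cardinalities later
  turns an inclusion of \<open>D4\<close>-systems into an equality.\<close>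

lemma card_D_set_eq:
  fixes f g :: "nat \<Rightarrow> 'a::euclidean_space"
  assumes f: "orthogonal_family {..<n} f K" and g: "orthogonal_family {..<n} g K'"
  shows "card (D_set {..<n} f) = card (D_set {..<n} g)" "finite (D_set {..<n} f)"
proof -
  define Z :: "(nat \<times> nat \<times> real \<times> real) set" where
    "Z = {(i, j, s, r). i < j \<and> j < n \<and> s \<in> {1, -1} \<and> r \<in> {1, -1}}"
  define \<Phi> where "\<Phi> f = (\<lambda>(i, j, s, r). 2 *\<^sub>R (s *\<^sub>R f i + r *\<^sub>R f j))" for f :: "nat \<Rightarrow> 'a"
  have img: "D_set {..<n} f = \<Phi> f ` Z" for f :: "nat \<Rightarrow> 'a"
  proof
    show "D_set {..<n} f \<subseteq> \<Phi> f ` Z"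
    proof
      fix x assume "x \<in> D_set {..<n} f"
      then obtain s r i j where x: "x = 2 *\<^sub>R (s *\<^sub>R f i + r *\<^sub>R f j)" "i < n" "j < n" "i \<noteq> j" "s \<in> {1, -1}" "r \<in> {1, -1}"
        unfolding D_set_def by blast
      have "x = \<Phi> f (i, j, s, r)" "x = \<Phi> f (j, i, r, s)" using x(1) by (simp_all add: \<Phi>_def add.commute)
      moreover have "(i, j, s, r) \<in> Z \<or> (j, i, r, s) \<in> Z" using x(2-) by (auto simp: Z_def)
      ultimately show "x \<in> \<Phi> f ` Z" by blast
    qed
    show "\<Phi> f ` Z \<subseteq> D_set {..<n} f"
      unfolding Z_def \<Phi>_def D_set_def by fastforce
  qed
  have inj: "inj_on (\<Phi> f) Z" if f: "orthogonal_family {..<n} f K" for f K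
  proof (rule inj_onI)
    have K: "K \<noteq> 0" and ff: "\<And>i j. i < n \<Longrightarrow> j < n \<Longrightarrow> f i \<bullet> f j = (if i = j then K else 0)"
      using f by (auto simp: orthogonal_family_def)
    fix p q assume p: "p \<in> Z" and q: "q \<in> Z" and eq: "\<Phi> f p = \<Phi> f q"
    obtain i j s r where p': "p = (i, j, s, r)" "i < j" "j < n" "s \<noteq> 0" "r \<noteq> 0" using p by (auto simp: Z_def)
    obtain i' j' s' r' where q': "q = (i', j', s', r')" "i' < j'" "j' < n" "s' \<noteq> 0" "r' \<noteq> 0" using q by (auto simp: Z_def)
    have h: "(if k = i then s else 0) + (if k = j then r else 0) = (if k = i' then s' else 0) + (if k = j' then r' else 0)" if "k < n" for k
    proof -
      have "\<Phi> f p \<bullet> f k = 2 * K * ((if k = i then s else 0) + (if k = j then r else 0))"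
        using p' that by (simp add: \<Phi>_def inner_add_left ff)
      moreover have "\<Phi> f q \<bullet> f k = 2 * K * ((if k = i' then s' else 0) + (if k = j' then r' else 0))"
        using q' that by (simp add: \<Phi>_def inner_add_left ff)
      ultimately show ?thesis using eq K by simp
    qed
    have "i < n" "i' < n" using p' q' by auto
    then have "i \<in> {i', j'}" "j \<in> {i', j'}"
      using h[of i] h[of j] p' by (auto split: if_splits)
    then have "i = i'" "j = j'" using p' q' by auto
    then show "p = q" using h[of i] h[of j] p' q' \<open>i < n\<close> by auto
  qed
  show "card (D_set {..<n} f) = card (D_set {..<n} g)"
    unfolding img card_image[OF inj[OF f]] card_image[OF inj[OF g]] ..
  have "Z \<subseteq> {..<n} \<times> {..<n} \<times> {1, -1} \<times> {1, -1}" by (auto simp: Z_def)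
  then have "finite Z" by (rule finite_subset) auto
  then show "finite (D_set {..<n} f)" unfolding img by simp
qed

lemma cartan_edge:
  assumes "cartan_int x y = -1" "cartan_int y x = -1"
  shows "x \<bullet> x = y \<bullet> y" "x \<bullet> y = - (y \<bullet> y) / 2"
proof -
  have "x \<noteq> 0" "y \<noteq> 0" using assms by (auto simp: cartan_int_def)
  then have "2 * (x \<bullet> y) = - (y \<bullet> y)" "2 * (x \<bullet> y) = - (x \<bullet> x)"
    using assms by (simp_all add: cartan_int_def field_simps inner_commute[of y x])
  then show "x \<bullet> x = y \<bullet> y" "x \<bullet> y = - (y \<bullet> y) / 2" by linarith+
qed

lemma cartan_zero: "cartan_int x y = 0 \<Longrightarrow> x \<bullet> y = 0"
  by (auto simp: cartan_int_def)

lemma type_D5_D_set: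
  assumes "type_D5 S"
  obtains f K where "orthogonal_family {..<5} f K" "S = D_set {..<5} f"
proof -
  obtain a :: "nat \<Rightarrow> 'a" where S: "root_system S" and inj: "inj_on a {..<5}"
    and B: "root_basis (a ` {..<5}) S" and C: "\<And>i j. i < 5 \<Longrightarrow> j < 5 \<Longrightarrow> cartan_int (a i) (a j) =
           (if i = j then 2 else if {i, j} \<in> {{0, 1}, {1, 2}, {2, 3}, {2, 4}} then -1 else 0)"
    using assms by (auto simp: type_D5_def has_dynkin_type_def)
  define K where "K = a 0 \<bullet> a 0 / 8"
  have "a 0 \<in> S" using B by (auto simp: root_basis_def)
  then have K: "K > 0" using S root_system_nonzero by (fastforce simp: K_def)
  have e: "a 1 \<bullet> a 1 = 8 * K" "a 2 \<bullet> a 2 = 8 * K" "a 3 \<bullet> a 3 = 8 * K" "a 4 \<bullet> a 4 = 8 * K" "a 0 \<bullet> a 0 = 8 * K"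
    "a 0 \<bullet> a 1 = - 4 * K" "a 1 \<bullet> a 2 = - 4 * K" "a 2 \<bullet> a 3 = - 4 * K" "a 2 \<bullet> a 4 = - 4 * K"
    using cartan_edge[of "a 0" "a 1"] cartan_edge[of "a 1" "a 2"] cartan_edge[of "a 2" "a 3"] cartan_edge[of "a 2" "a 4"]
    by (simp_all add: C K_def doubleton_eq_iff)
  have z: "a 0 \<bullet> a 2 = 0" "a 0 \<bullet> a 3 = 0" "a 0 \<bullet> a 4 = 0" "a 1 \<bullet> a 3 = 0" "a 1 \<bullet> a 4 = 0" "a 3 \<bullet> a 4 = 0"
    by (rule cartan_zero; simp add: C doubleton_eq_iff)+
  note g = e z e(6-)[THEN trans[OF inner_commute]] z[THEN trans[OF inner_commute]]
  \<comment> \<open>The equations \<open>a i = 2 (f i - f (i + 1))\<close> and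
    \<open>a 4 = 2 (f 3 + f 4)\<close> are solved backwards from the forked end of the
    diagram.\<close>
  define f4 f3 where "f4 = (1/4) *\<^sub>R (a 4 - a 3)" and "f3 = (1/4) *\<^sub>R (a 3 + a 4)"
  define f2 where "f2 = f3 + (1/2) *\<^sub>R a 2"
  define f1 where "f1 = f2 + (1/2) *\<^sub>R a 1"
  define f0 where "f0 = f1 + (1/2) *\<^sub>R a 0"
  define f where "f i = [f0, f1, f2, f3, f4] ! i" for i
  have fi: "f 0 = f0" "f 1 = f1" "f 2 = f2" "f 3 = f3" "f 4 = f4" by (simp_all add: f_def)
  have "f i \<bullet> f j = (if i = j then K else 0)" if "i < 5" "j < 5" for i j
  proof -
    have "i \<in> {0, 1, 2, 3, 4}" "j \<in> {0, 1, 2, 3, 4}" using that by auto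
    then show ?thesis
      by (auto simp: fi f0_def f1_def f2_def f3_def f4_def inner_add_left inner_add_right inner_diff_left inner_diff_right g simp del: One_nat_def)
  qed
  then have orth: "orthogonal_family {..<5} f K" using K by (auto simp: orthogonal_family_def)
  have a_eq: "a 0 = 2 *\<^sub>R (f0 - f1)" "a 1 = 2 *\<^sub>R (f1 - f2)" "a 2 = 2 *\<^sub>R (f2 - f3)"
    by (simp_all add: f0_def f1_def f2_def)
  have a_eq': "a 3 = 2 *\<^sub>R (f3 - f4)"
    by (simp add: f3_def f4_def algebra_simps flip: scaleR_left_distrib)
  have "a i = 2 *\<^sub>R (f i - f (Suc i))" if "Suc i < 5" for i
  proof -
    have "i \<in> {0, 1, 2, 3}" using that by auto
    then show ?thesis using a_eq a_eq' by (auto simp: f_def)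
  qed
  moreover have "a (5 - 1) = 2 *\<^sub>R (f (5 - 2) + f (5 - 1))"
    by (simp add: f_def f3_def f4_def algebra_simps flip: scaleR_left_distrib)
  ultimately have "S = D_set {..<5} f"
    by (intro D_diagram_D_set[OF S B _ orth]) auto
  then show ?thesis using that orth by blast
qed

lemma type_D4_D_set:
  assumes "type_D4 S"
  obtains f K where "orthogonal_family {..<4} f K" "S = D_set {..<4} f"
proof -
  obtain a :: "nat \<Rightarrow> 'a" where S: "root_system S" and inj: "inj_on a {..<4}"
    and B: "root_basis (a ` {..<4}) S" and C: "\<And>i j. i < 4 \<Longrightarrow> j < 4 \<Longrightarrow> cartan_int (a i) (a j) =
           (if i = j then 2 else if {i, j} \<in> {{0, 1}, {1, 2}, {1, 3}} then -1 else 0)"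
    using assms by (auto simp: type_D4_def has_dynkin_type_def)
  define K where "K = a 0 \<bullet> a 0 / 8"
  have "a 0 \<in> S" using B by (auto simp: root_basis_def)
  then have K: "K > 0" using S root_system_nonzero by (fastforce simp: K_def)
  have e: "a 1 \<bullet> a 1 = 8 * K" "a 2 \<bullet> a 2 = 8 * K" "a 3 \<bullet> a 3 = 8 * K" "a 0 \<bullet> a 0 = 8 * K"
    "a 0 \<bullet> a 1 = - 4 * K" "a 1 \<bullet> a 2 = - 4 * K" "a 1 \<bullet> a 3 = - 4 * K"
    using cartan_edge[of "a 0" "a 1"] cartan_edge[of "a 1" "a 2"] cartan_edge[of "a 1" "a 3"]
    by (simp_all add: C K_def doubleton_eq_iff)
  have z: "a 0 \<bullet> a 2 = 0" "a 0 \<bullet> a 3 = 0" "a 2 \<bullet> a 3 = 0"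
    by (rule cartan_zero; simp add: C doubleton_eq_iff)+
  note g = e z e(5-)[THEN trans[OF inner_commute]] z[THEN trans[OF inner_commute]]
  define f3 f2 where "f3 = (1/4) *\<^sub>R (a 3 - a 2)" and "f2 = (1/4) *\<^sub>R (a 2 + a 3)"
  define f1 where "f1 = f2 + (1/2) *\<^sub>R a 1"
  define f0 where "f0 = f1 + (1/2) *\<^sub>R a 0"
  define f where "f i = [f0, f1, f2, f3] ! i" for i
  have fi: "f 0 = f0" "f 1 = f1" "f 2 = f2" "f 3 = f3" by (simp_all add: f_def)
  have "f i \<bullet> f j = (if i = j then K else 0)" if "i < 4" "j < 4" for i j
  proof -
    have "i \<in> {0, 1, 2, 3}" "j \<in> {0, 1, 2, 3}" using that by auto
    then show ?thesis
      by (auto simp: fi f0_def f1_def f2_def f3_def inner_add_left inner_add_right inner_diff_left inner_diff_right g simp del: One_nat_def)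
  qed
  then have orth: "orthogonal_family {..<4} f K" using K by (auto simp: orthogonal_family_def)
  have a_eq: "a 0 = 2 *\<^sub>R (f0 - f1)" "a 1 = 2 *\<^sub>R (f1 - f2)"
    by (simp_all add: f0_def f1_def)
  have a_eq': "a 2 = 2 *\<^sub>R (f2 - f3)"
    by (simp add: f2_def f3_def algebra_simps flip: scaleR_left_distrib)
  have "a i = 2 *\<^sub>R (f i - f (Suc i))" if "Suc i < 4" for i
  proof -
    have "i \<in> {0, 1, 2}" using that by auto
    then show ?thesis using a_eq a_eq' by (auto simp: f_def)
  qed
  moreover have "a (4 - 1) = 2 *\<^sub>R (f (4 - 2) + f (4 - 1))"
    by (simp add: f_def f3_def f2_def algebra_simps flip: scaleR_left_distrib)
  ultimately have "S = D_set {..<4} f"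
    by (intro D_diagram_D_set[OF S B _ orth]) auto
  then show ?thesis using that orth by blast
qed

section \<open>Coordinates for systems of type \<open>E\<^sub>6\<close> adapted to a subsystem of type \<open>D\<^sub>5\<close>\<close>

text \<open>\<open>t\<close> is the coordinate direction of \<open>E6\<close> that is orthogonal to
  \<open>D5\<close>. A vector with all coordinates 1 or -1 has squared length
  \<open>5 K + 3 K\<close>, equal to that of the roots of \<open>D5\<close>.\<close>

definition frame :: "(nat \<Rightarrow> 'a::euclidean_space) \<Rightarrow> 'a \<Rightarrow> real \<Rightarrow> bool" where
  "frame f t K \<longleftrightarrow> orthogonal_family {..<5} f K \<and> (\<forall>i<5. f i \<bullet> t = 0) \<and> t \<bullet> t = 3 * K"

definition fvec :: "(nat \<Rightarrow> 'a::euclidean_space) \<Rightarrow> 'a \<Rightarrow> (nat \<Rightarrow> real) \<Rightarrow> real \<Rightarrow> 'a" where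
  "fvec f t x y = (\<Sum>i<5. x i *\<^sub>R f i) + y *\<^sub>R t"

text \<open>The weights of the two half-spin representations of \<open>D5\<close>: 16 with
  \<open>y = 1\<close> and their negatives with \<open>y = -1\<close>, which complete the 40 roots
  of \<open>D5\<close> to the 72 roots of \<open>E6\<close>.\<close>

definition spinor :: "(nat \<Rightarrow> real) \<Rightarrow> real \<Rightarrow> bool" where
  "spinor x y \<longleftrightarrow> y \<in> {1, -1} \<and> (\<forall>i<5. x i \<in> {1, -1}) \<and> (\<Prod>i<5. x i) = y"

definition E6_set :: "(nat \<Rightarrow> 'a::euclidean_space) \<Rightarrow> 'a \<Rightarrow> 'a set" where
  "E6_set f t = D_set {..<5} f \<union> {fvec f t x y | x y. spinor x y}"

section \<open>Computation in frame coordinates\<close>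

lemma lessThan_5: "{..<5::nat} = {0, 1, 2, 3, 4}"
  by auto

lemma sum_lessThan_5: "(\<Sum>i<5. g i) = g 0 + g 1 + g 2 + g 3 + (g (4::nat) :: 'b::comm_monoid_add)"
  by (simp add: lessThan_5 add.assoc)

lemma prod_lessThan_5: "(\<Prod>i<5. g i) = g 0 * g 1 * g 2 * g 3 * (g (4::nat) :: 'b::comm_monoid_mult)"
  by (simp add: lessThan_5 mult.assoc)

lemma all_less_5: "(\<forall>i<5. P i) \<longleftrightarrow> P 0 \<and> P 1 \<and> P 2 \<and> P 3 \<and> P (4::nat)"
proof -
  have "(\<forall>i<5. P i) \<longleftrightarrow> (\<forall>i\<in>{..<5}. P i)" by auto
  then show ?thesis by (simp add: lessThan_5)
qed

lemma frame_inner: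
  assumes "frame f t K"
  shows "K > 0" "i < 5 \<Longrightarrow> j < 5 \<Longrightarrow> f i \<bullet> f j = (if i = j then K else 0)"
    "i < 5 \<Longrightarrow> f i \<bullet> t = 0" "i < 5 \<Longrightarrow> t \<bullet> f i = 0" "t \<bullet> t = 3 * K"
  using assms by (auto simp: frame_def orthogonal_family_def inner_commute)

lemma fvec_inner:
  assumes "frame f t K"
  shows "i < 5 \<Longrightarrow> fvec f t x y \<bullet> f i = x i * K" "i < 5 \<Longrightarrow> f i \<bullet> fvec f t x y = x i * K"
    "fvec f t x y \<bullet> t = 3 * y * K"
    "fvec f t x y \<bullet> fvec f t x' y' = ((\<Sum>i<5. x i * x' i) + 3 * (y * y')) * K"
proof -
  have o: "orthogonal_family {..<5} f K" using assms by (simp add: frame_def)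
  note fi = frame_inner[OF assms]
  show "i < 5 \<Longrightarrow> fvec f t x y \<bullet> f i = x i * K" for x y
    using orthogonal_family_inner_sum[OF o, of i x] fi by (simp add: fvec_def inner_add_left)
  then show "i < 5 \<Longrightarrow> f i \<bullet> fvec f t x y = x i * K" by (simp add: inner_commute)
  show "fvec f t x y \<bullet> t = 3 * y * K"
    using fi by (simp add: fvec_def inner_add_left inner_sum_left)
  have "(\<Sum>i<5. x i *\<^sub>R f i) \<bullet> t = 0" for x using fi by (simp add: inner_sum_left)
  moreover have "t \<bullet> (\<Sum>i<5. x i *\<^sub>R f i) = 0" for x using fi by (simp add: inner_sum_right)
  ultimately show "fvec f t x y \<bullet> fvec f t x' y' = ((\<Sum>i<5. x i * x' i) + 3 * (y * y')) * K"
    using fi orthogonal_family_inner_sums[OF o, of x x']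
    by (simp add: fvec_def inner_add_left inner_add_right algebra_simps)
qed

lemma fvec_cong: "(\<And>i. i < 5 \<Longrightarrow> x i = x' i) \<Longrightarrow> fvec f t x y = fvec f t x' y"
  by (simp add: fvec_def)

lemma fvec_minus: "- fvec f t x y = fvec f t (\<lambda>i. - x i) (- y)"
  by (simp add: fvec_def sum_negf)

lemma D_set_memI:
  assumes "i \<in> I" "j \<in> I" "i \<noteq> j"
  shows "2 *\<^sub>R (f i + f j) \<in> D_set I f" "2 *\<^sub>R (f i - f j) \<in> D_set I f"
proof -
  have "2 *\<^sub>R (f i + f j) = 2 *\<^sub>R (1 *\<^sub>R f i + 1 *\<^sub>R f j)" "2 *\<^sub>R (f i - f j) = 2 *\<^sub>R (1 *\<^sub>R f i + (-1) *\<^sub>R f j)" by simp_all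
  then show "2 *\<^sub>R (f i + f j) \<in> D_set I f" "2 *\<^sub>R (f i - f j) \<in> D_set I f"
    using assms unfolding D_set_def by blast+
qed

lemma D_set_cong:
  fixes f g :: "nat \<Rightarrow> 'a::euclidean_space"
  assumes "\<And>i. i \<in> I \<Longrightarrow> f i = g i"
  shows "D_set I f = D_set I g"
proof -
  have "D_set I f \<subseteq> D_set I g" if "\<And>i. i \<in> I \<Longrightarrow> f i = g i" for f g :: "nat \<Rightarrow> 'a"
  proof
    fix x assume "x \<in> D_set I f"
    then obtain s r i j where "x = 2 *\<^sub>R (s *\<^sub>R f i + r *\<^sub>R f j)" "i \<in> I" "j \<in> I" "i \<noteq> j" "s \<in> {1, -1}" "r \<in> {1, -1}"
      unfolding D_set_def by blast
    then show "x \<in> D_set I g" using that[of i] that[of j] unfolding D_set_def by auto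
  qed
  from this[of f g] this[of g f] show ?thesis using assms by auto
qed

text \<open>This freedom is used to give the first root found outside \<open>D5\<close> the
  coordinate 1 at every index.\<close>

lemma D_set_sign:
  fixes f :: "nat \<Rightarrow> 'a::euclidean_space"
  assumes "\<And>i. i \<in> I \<Longrightarrow> c i \<in> {1, -1::real}"
  shows "D_set I (\<lambda>i. c i *\<^sub>R f i) = D_set I f"
proof -
  have sub: "D_set I (\<lambda>i. c i *\<^sub>R f i) \<subseteq> D_set I f" if c: "\<And>i. i \<in> I \<Longrightarrow> c i \<in> {1, -1::real}" for c and f :: "nat \<Rightarrow> 'a"
  proof
    fix x assume "x \<in> D_set I (\<lambda>i. c i *\<^sub>R f i)"
    then obtain s r i j where x: "x = 2 *\<^sub>R (s *\<^sub>R c i *\<^sub>R f i + r *\<^sub>R c j *\<^sub>R f j)" "i \<in> I" "j \<in> I" "i \<noteq> j" "s \<in> {1, -1}" "r \<in> {1, -1}"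
      unfolding D_set_def by blast
    then have "x = 2 *\<^sub>R ((s * c i) *\<^sub>R f i + (r * c j) *\<^sub>R f j)" "s * c i \<in> {1, -1}" "r * c j \<in> {1, -1}"
      using c[of i] c[of j] by auto
    then show "x \<in> D_set I f" using x(2-4) unfolding D_set_def by blast
  qed
  have "D_set I f = D_set I (\<lambda>i. c i *\<^sub>R c i *\<^sub>R f i)"
    using assms by (intro D_set_cong) fastforce
  also have "\<dots> \<subseteq> D_set I (\<lambda>i. c i *\<^sub>R f i)" by (rule sub) (rule assms)
  finally show ?thesis using sub[of c f] assms by blast
qed

text \<open>In units of \<open>K\<close>, the pairings \<open>X i\<close> of a root outside
  \<open>D5\<close> are such that all \<open>X i + X j\<close> and \<open>X i - X j\<close> are 0, 2
  or -2. Hence one value 1 or -1 forces such values everywhere, a value 2 or -2 makes all others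
  vanish, and otherwise all vanish. The two cases without odd values are excluded only later, by
  lengths and a further pairing.\<close>

lemma pairing_D_set:
  fixes x :: "'a::euclidean_space"
  assumes R: "root_system R" and len: "\<And>v. v \<in> R \<Longrightarrow> v \<bullet> v = 8 * K" and o: "orthogonal_family {..<5} f K"
    and D: "D_set {..<5} f \<subseteq> R" and x: "x \<in> R"
  shows "x \<in> D_set {..<5} f \<or> (\<forall>i<5. x \<bullet> f i = 0) \<or>
    (\<exists>i<5. x \<bullet> f i \<in> {2 * K, - 2 * K} \<and> (\<forall>j<5. j \<noteq> i \<longrightarrow> x \<bullet> f j = 0)) \<or>
    (\<forall>i<5. x \<bullet> f i \<in> {K, - K})"
proof (cases "x \<in> D_set {..<5} f")
  case False
  have K: "K > 0" using o by (simp add: orthogonal_family_def)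
  define X where "X i = x \<bullet> f i / K" for i
  have xf: "x \<bullet> f i = X i * K" for i using K by (simp add: X_def)
  have pm: "v \<bullet> x \<in> {0, 4 * K, - (4 * K)}" if "v \<in> D_set {..<5} f" for v
  proof -
    have "v \<noteq> x" "v \<noteq> - x" using False that D_set_neg[OF that] by auto
    then show ?thesis using equal_length_pairing[OF R, of v x "4 * K"] that D x len[of v] len[of x] by auto
  qed
  have *: "X i + X j \<in> {0, 2, -2} \<and> X i - X j \<in> {0, 2, -2}" if "i < 5" "j < 5" "i \<noteq> j" for i j
  proof -
    have ip: "(2 *\<^sub>R (f i + f j)) \<bullet> x = 2 * K * (X i + X j)" "(2 *\<^sub>R (f i - f j)) \<bullet> x = 2 * K * (X i - X j)"
      by (simp_all add: inner_add_left inner_diff_left inner_commute[of _ x] xf algebra_simps)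
    have q: "p \<in> {0, 2, -2}" if "2 * K * p \<in> {0, 4 * K, - (4 * K)}" for p
    proof -
      have "2 * K * p = 2 * K * 0 \<or> 2 * K * p = 2 * K * 2 \<or> 2 * K * p = 2 * K * (- 2)" using that by auto
      then show ?thesis using K by (simp only: mult_cancel_left) auto
    qed
    have "2 * K * (X i + X j) \<in> {0, 4 * K, - (4 * K)}" "2 * K * (X i - X j) \<in> {0, 4 * K, - (4 * K)}"
      unfolding ip[symmetric] by (rule pm; rule D_set_memI; use that in simp)+
    then show ?thesis using q by blast
  qed
  have odd_odd: "q \<in> {1, -1}" if "p + q \<in> {0, 2, -2} \<and> p - q \<in> {0, 2, -2}" "p \<in> {1, -1}" for p q :: real
    using that by auto
  have even_even: "q = 0" if "p + q \<in> {0, 2, -2} \<and> p - q \<in> {0, 2, -2}" "p \<in> {2, -2}" for p q :: real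
    using that by auto
  have other: "p = 0" if "p + q \<in> {0, 2, -2} \<and> p - q \<in> {0, 2, -2}" "p \<notin> {1, -1, 2, -2}" for p q :: real
    using that by auto
  consider i where "i < 5" "X i \<in> {1, -1}" | i where "i < 5" "X i \<in> {2, -2}" | "\<forall>i<5. X i \<notin> {1, -1, 2, -2}"
    by auto
  then show ?thesis
  proof cases
    case (1 i)
    have "X j \<in> {1, -1}" if "j < 5" for j
      using odd_odd *[OF 1(1) that] 1(2) by (cases "i = j") blast+
    then have "x \<bullet> f j \<in> {K, - K}" if "j < 5" for j using xf[of j] that by fastforce
    then have "\<forall>i<5. x \<bullet> f i \<in> {K, - K}" by blast
    then show ?thesis by blast
  next
    case (2 i)
    have "X j = 0" if "j < 5" "j \<noteq> i" for j
      using even_even *[OF 2(1) that(1)] 2(2) that(2) by blast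
    then have "\<exists>i<5. x \<bullet> f i \<in> {2 * K, - 2 * K} \<and> (\<forall>j<5. j \<noteq> i \<longrightarrow> x \<bullet> f j = 0)"
      using xf 2 by (intro exI[of _ i]) (auto simp: xf)
    then show ?thesis by blast
  next
    case 3
    have "X i = 0" if i: "i < 5" for i
    proof -
      obtain j :: nat where j: "j < 5" "j \<noteq> i" using that[of "if i = 0 then 1 else 0"] by (auto split: if_splits)
      show ?thesis using other *[OF i j(1)] j(2) 3[rule_format, OF i] by blast
    qed
    then show ?thesis using xf by auto
  qed
qed simp

text \<open>\<open>e\<close> is half the image of \<open>z\<close> under the Cartan matrix of
  \<open>E6\<close>, whose determinant 3 is odd, so that \<open>z = 2 m\<close>. Then
  \<open>e\<close> is the image of \<open>m\<close>, and the sum is twice the value at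
  \<open>m\<close> of an even quadratic form, hence divisible by 4.\<close>

lemma E6_parity:
  fixes z :: "nat \<Rightarrow> int" and e :: "nat \<Rightarrow> int"
  assumes "2 * z 0 - z 1 = 2 * e 0" "2 * z 1 - z 0 - z 2 = 2 * e 1" "2 * z 2 - z 1 - z 3 - z 5 = 2 * e 2"
    "2 * z 3 - z 2 - z 4 = 2 * e 3" "2 * z 4 - z 3 = 2 * e 4" "2 * z 5 - z 2 = 2 * e 5"
  shows "z 0 * e 0 + z 1 * e 1 + z 2 * e 2 + z 3 * e 3 + z 4 * e 4 + z 5 * e 5 \<noteq> 2"
proof -
  have "even (z 0)" "even (z 1)" "even (z 2)" "even (z 3)" "even (z 4)" "even (z 5)"
    using assms by presburger+
  then obtain m0 m1 m2 m3 m4 m5 where m: "z 0 = 2 * m0" "z 1 = 2 * m1" "z 2 = 2 * m2" "z 3 = 2 * m3" "z 4 = 2 * m4" "z 5 = 2 * m5"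
    by (elim evenE)
  have e: "e 0 = 2 * m0 - m1" "e 1 = 2 * m1 - m0 - m2" "e 2 = 2 * m2 - m1 - m3 - m5"
    "e 3 = 2 * m3 - m2 - m4" "e 4 = 2 * m4 - m3" "e 5 = 2 * m5 - m2"
    using assms by (simp_all add: m del: One_nat_def)
  have "z 0 * e 0 + z 1 * e 1 + z 2 * e 2 + z 3 * e 3 + z 4 * e 4 + z 5 * e 5 =
    4 * (m0 * m0 + m1 * m1 + m2 * m2 + m3 * m3 + m4 * m4 + m5 * m5 - m0 * m1 - m1 * m2 - m2 * m3 - m3 * m4 - m2 * m5)"
    unfolding e m by (simp add: algebra_simps)
  then show ?thesis by presburger
qed

text \<open>The vector \<open>4 f\<^sub>4\<close> is a sum of two roots of the \<open>D\<^sub>5\<close>-subsystem. If it paired evenly with all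
  roots, then, the Cartan matrix of \<open>E\<^sub>6\<close> being invertible modulo 2, its half \<open>2 f\<^sub>4\<close> would be in the root
  lattice, whose form is even; but \<open>2 f\<^sub>4\<close> has half the squared length of a root.\<close>

lemma E6_odd_root:
  fixes R :: "'a::euclidean_space set"
  assumes E6: "type_E6 R" and o: "orthogonal_family {..<5} f K" and D: "D_set {..<5} f \<subseteq> R"
  shows "\<forall>x\<in>R. x \<bullet> x = 8 * K" "\<exists>x\<in>R. \<forall>i<5. x \<bullet> f i \<in> {K, - K}" "\<exists>A. finite A \<and> card A \<le> 6 \<and> R \<subseteq> span A \<and> A \<subseteq> R"
proof -
  obtain a :: "nat \<Rightarrow> 'a" where R: "root_system R" and inj: "inj_on a {..<6}"
    and B: "root_basis (a ` {..<6}) R" and C: "\<And>i j. i < 6 \<Longrightarrow> j < 6 \<Longrightarrow> cartan_int (a i) (a j) =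
           (if i = j then 2 else if {i, j} \<in> {{0, 1}, {1, 2}, {2, 3}, {3, 4}, {2, 5}} then -1 else 0)"
    using E6 by (auto simp: type_E6_def has_dynkin_type_def)
  have K: "K > 0" and ff: "\<And>i j. i < 5 \<Longrightarrow> j < 5 \<Longrightarrow> f i \<bullet> f j = (if i = j then K else 0)"
    using o by (auto simp: orthogonal_family_def)
  have six: "{..<6::nat} = {0, 1, 2, 3, 4, 5}" by auto
  define L where "L = a 0 \<bullet> a 0"
  have e: "a 1 \<bullet> a 1 = L" "a 2 \<bullet> a 2 = L" "a 3 \<bullet> a 3 = L" "a 4 \<bullet> a 4 = L" "a 5 \<bullet> a 5 = L" "a 0 \<bullet> a 0 = L"
    "a 0 \<bullet> a 1 = - L / 2" "a 1 \<bullet> a 2 = - L / 2" "a 2 \<bullet> a 3 = - L / 2" "a 3 \<bullet> a 4 = - L / 2" "a 2 \<bullet> a 5 = - L / 2"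
    using cartan_edge[of "a 0" "a 1"] cartan_edge[of "a 1" "a 2"] cartan_edge[of "a 2" "a 3"] cartan_edge[of "a 3" "a 4"] cartan_edge[of "a 2" "a 5"]
    by (simp_all add: C L_def doubleton_eq_iff)
  have z: "a 0 \<bullet> a 2 = 0" "a 0 \<bullet> a 3 = 0" "a 0 \<bullet> a 4 = 0" "a 0 \<bullet> a 5 = 0" "a 1 \<bullet> a 3 = 0" "a 1 \<bullet> a 4 = 0" "a 1 \<bullet> a 5 = 0"
    "a 2 \<bullet> a 4 = 0" "a 3 \<bullet> a 5 = 0" "a 4 \<bullet> a 5 = 0"
    by (rule cartan_zero; simp add: C doubleton_eq_iff)+
  note g = e z e(7-)[THEN trans[OF inner_commute]] z[THEN trans[OF inner_commute]]
  have lenL: "x \<bullet> x = L" if "x \<in> R" for x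
  proof (rule root_length[OF R B _ that])
    fix b assume "b \<in> a ` {..<6}"
    then show "b \<bullet> b = L" unfolding six using e by auto
  qed
  have "2 *\<^sub>R (f 0 + f 1) \<in> R" using D D_set_memI(1)[of 0 "{..<5}" 1 f] by auto
  from lenL[OF this] have L: "L = 8 * K" by (simp add: inner_add_left inner_add_right ff)
  then show len: "\<forall>x\<in>R. x \<bullet> x = 8 * K" using lenL by blast
  have aR: "a ` {..<6} \<subseteq> R" using B by (auto simp: root_basis_def)
  have "R \<subseteq> span (a ` {..<6})"
  proof
    fix x assume "x \<in> R"
    show "x \<in> span (a ` {..<6})"
      by (rule root_in_lattice[OF B, of "\<lambda>x. x \<in> span (a ` {..<6})", OF span_zero span_add span_neg span_base \<open>x \<in> R\<close>])
  qed
  then show "\<exists>A. finite A \<and> card A \<le> 6 \<and> R \<subseteq> span A \<and> A \<subseteq> R"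
    using aR card_image_le[of "{..<6}" a] by (intro exI[of _ "a ` {..<6}"]) auto
  show "\<exists>x\<in>R. \<forall>i<5. x \<bullet> f i \<in> {K, - K}"
  proof (rule ccontr)
    assume no: "\<not> ?thesis"
    \<comment> \<open>Without a root having all pairings \<open>K\<close> or \<open>- K\<close>, the
      remaining cases of \<open>pairing_D_set\<close> make the coordinate of every root at index 4
      even.\<close>
    have even4: "x \<bullet> f 4 \<in> {0, 2 * K, - (2 * K)}" if "x \<in> R" for x
    proof -
      have "x \<bullet> f 4 \<in> {0, 2 * K, - (2 * K)}" if "x \<in> D_set {..<5} f"
      proof -
        obtain s r i j where x: "x = 2 *\<^sub>R (s *\<^sub>R f i + r *\<^sub>R f j)" "i < 5" "j < 5" "i \<noteq> j" "s \<in> {1, -1}" "r \<in> {1, -1}"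
          using \<open>x \<in> D_set {..<5} f\<close> unfolding D_set_def by blast
        have "x \<bullet> f 4 = 2 * s * (if i = 4 then K else 0) + 2 * r * (if j = 4 then K else 0)"
          using x by (simp add: inner_add_left ff)
        then show ?thesis using x by auto
      qed
      moreover have "x \<bullet> f 4 \<in> {0, 2 * K, - (2 * K)}"
        if "i < 5" "x \<bullet> f i \<in> {2 * K, - 2 * K} \<and> (\<forall>j<5. j \<noteq> i \<longrightarrow> x \<bullet> f j = 0)" for i
        using that by (cases "i = 4") auto
      ultimately show ?thesis
        using pairing_D_set[OF R bspec[OF len] o D that] no that by force
    qed
    define u where "u = 4 *\<^sub>R f 4"
    have "\<forall>i. \<exists>e :: int. i < 6 \<longrightarrow> u \<bullet> a i = 8 * K * of_int e"
    proof
      fix i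
      have "a i \<bullet> f 4 = 0 \<or> a i \<bullet> f 4 = 2 * K \<or> a i \<bullet> f 4 = - (2 * K)" if "i < 6"
        using even4[of "a i"] aR that by auto
      then show "\<exists>e :: int. i < 6 \<longrightarrow> u \<bullet> a i = 8 * K * of_int e"
        by (cases "i < 6")
          (auto simp: u_def inner_commute[of "f 4"] intro: exI[of _ 0] exI[of _ 1] exI[of _ "-1"])
    qed
    then obtain e :: "nat \<Rightarrow> int" where ue: "\<And>i. i < 6 \<Longrightarrow> u \<bullet> a i = 8 * K * of_int (e i)" by metis
    \<comment> \<open>The root lattice, with the six terms written out so that pairing with the
      simple roots gives the explicit equations of \<open>E6_parity\<close>.\<close>
    let ?L = "\<lambda>x. \<exists>z :: nat \<Rightarrow> int. x = of_int (z 0) *\<^sub>R a 0 + of_int (z 1) *\<^sub>R a 1 + of_int (z 2) *\<^sub>R a 2 +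
      of_int (z 3) *\<^sub>R a 3 + of_int (z 4) *\<^sub>R a 4 + of_int (z 5) *\<^sub>R a 5"
    have add: "?L (x + y)" if "?L x" "?L y" for x y
    proof -
      obtain z w :: "nat \<Rightarrow> int" where "x = of_int (z 0) *\<^sub>R a 0 + of_int (z 1) *\<^sub>R a 1 + of_int (z 2) *\<^sub>R a 2 +
        of_int (z 3) *\<^sub>R a 3 + of_int (z 4) *\<^sub>R a 4 + of_int (z 5) *\<^sub>R a 5"
        "y = of_int (w 0) *\<^sub>R a 0 + of_int (w 1) *\<^sub>R a 1 + of_int (w 2) *\<^sub>R a 2 +
        of_int (w 3) *\<^sub>R a 3 + of_int (w 4) *\<^sub>R a 4 + of_int (w 5) *\<^sub>R a 5" using \<open>?L x\<close> \<open>?L y\<close> by blast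
      then show ?thesis
        by (intro exI[of _ "\<lambda>i. z i + w i"]) (simp add: scaleR_left_distrib)
    qed
    have neg: "?L (- x)" if "?L x" for x
    proof -
      obtain z :: "nat \<Rightarrow> int" where "x = of_int (z 0) *\<^sub>R a 0 + of_int (z 1) *\<^sub>R a 1 + of_int (z 2) *\<^sub>R a 2 +
        of_int (z 3) *\<^sub>R a 3 + of_int (z 4) *\<^sub>R a 4 + of_int (z 5) *\<^sub>R a 5" using \<open>?L x\<close> by blast
      then show ?thesis by (intro exI[of _ "\<lambda>i. - z i"]) simp
    qed
    have zero: "?L 0" by (intro exI[of _ "\<lambda>_. 0"]) simp
    have basis: "?L b" if b: "b \<in> a ` {..<6}" for b
    proof -
      obtain k where k: "k \<in> {0, 1, 2, 3, 4, 5}" "b = a k" using b unfolding six by blast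
      then show ?thesis by (intro exI[of _ "\<lambda>i. if i = k then 1 else 0"]) auto
    qed
    have "?L x" if "x \<in> R" for x by (rule root_in_lattice[OF B zero add neg basis that])
    moreover have "2 *\<^sub>R (f 4 + f 3) \<in> R" "2 *\<^sub>R (f 4 - f 3) \<in> R" using D D_set_memI[of 4 "{..<5}" 3 f] by auto
    ultimately have "?L (2 *\<^sub>R (f 4 + f 3) + 2 *\<^sub>R (f 4 - f 3))" by (intro add) blast+
    also have "2 *\<^sub>R (f 4 + f 3) + 2 *\<^sub>R (f 4 - f 3) = u" by (simp add: u_def algebra_simps flip: scaleR_left_distrib)
    finally obtain z :: "nat \<Rightarrow> int" where z: "u = of_int (z 0) *\<^sub>R a 0 + of_int (z 1) *\<^sub>R a 1 + of_int (z 2) *\<^sub>R a 2 +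
      of_int (z 3) *\<^sub>R a 3 + of_int (z 4) *\<^sub>R a 4 + of_int (z 5) *\<^sub>R a 5" by blast
    have uz: "u \<bullet> a 0 = 4 * K * of_int (2 * z 0 - z 1)" "u \<bullet> a 1 = 4 * K * of_int (2 * z 1 - z 0 - z 2)"
      "u \<bullet> a 2 = 4 * K * of_int (2 * z 2 - z 1 - z 3 - z 5)" "u \<bullet> a 3 = 4 * K * of_int (2 * z 3 - z 2 - z 4)"
      "u \<bullet> a 4 = 4 * K * of_int (2 * z 4 - z 3)" "u \<bullet> a 5 = 4 * K * of_int (2 * z 5 - z 2)"
      unfolding z by (simp_all add: inner_add_left g L algebra_simps del: One_nat_def)
    have ue': "u \<bullet> a 0 = 8 * K * of_int (e 0)" "u \<bullet> a 1 = 8 * K * of_int (e 1)" "u \<bullet> a 2 = 8 * K * of_int (e 2)"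
      "u \<bullet> a 3 = 8 * K * of_int (e 3)" "u \<bullet> a 4 = 8 * K * of_int (e 4)" "u \<bullet> a 5 = 8 * K * of_int (e 5)"
      by (rule ue; simp)+
    have cancel: "p = 2 * q" if "4 * K * of_int p = 8 * K * of_int q" for p q :: int
    proof -
      have "real_of_int p = real_of_int (2 * q)" using K that by simp
      then show ?thesis by (simp only: of_int_eq_iff)
    qed
    have par: "2 * z 0 - z 1 = 2 * e 0" "2 * z 1 - z 0 - z 2 = 2 * e 1" "2 * z 2 - z 1 - z 3 - z 5 = 2 * e 2"
      "2 * z 3 - z 2 - z 4 = 2 * e 3" "2 * z 4 - z 3 = 2 * e 4" "2 * z 5 - z 2 = 2 * e 5"
      by (rule cancel; simp only: uz[symmetric] ue')+
    \<comment> \<open>\<open>u\<close> has twice the squared length of a root, so the sum of the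
      products \<open>z i * e i\<close> is 2, the value excluded by
      \<open>E6_parity\<close>.\<close>
    have "16 * K = u \<bullet> u" by (simp add: u_def ff)
    also have "u \<bullet> u = 8 * K * of_int (z 0 * e 0 + z 1 * e 1 + z 2 * e 2 + z 3 * e 3 + z 4 * e 4 + z 5 * e 5)"
      by (subst (2) z) (simp add: inner_add_right ue algebra_simps del: One_nat_def)
    finally have "real_of_int (z 0 * e 0 + z 1 * e 1 + z 2 * e 2 + z 3 * e 3 + z 4 * e 4 + z 5 * e 5) = 2" using K by simp
    then have "z 0 * e 0 + z 1 * e 1 + z 2 * e 2 + z 3 * e 3 + z 4 * e 4 + z 5 * e 5 = 2" by linarith
    then show False using E6_parity[OF par] by blast
  qed
qed

section \<open>Determination of all roots of \<open>E6\<close> in a frame\<close>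

lemma fvec_expansion:
  assumes fr: "frame f t K" and x: "x \<in> span (insert t (f ` {..<5}))"
  shows "x = fvec f t (\<lambda>i. x \<bullet> f i / K) (x \<bullet> t / (3 * K))"
proof -
  note fi = frame_inner[OF fr]
  define d where "d = x - fvec f t (\<lambda>i. x \<bullet> f i / K) (x \<bullet> t / (3 * K))"
  have "fvec f t c e \<in> span (insert t (f ` {..<5}))" for c e
    unfolding fvec_def by (intro span_add span_sum span_scale) (auto intro: span_base)
  then have d: "d \<in> span (insert t (f ` {..<5}))"
    unfolding d_def using x by (intro span_diff)
  have "d \<bullet> b = 0" if "b \<in> insert t (f ` {..<5})" for b
    using that fi(1) by (auto simp: d_def inner_diff_left fvec_inner[OF fr])
  then have "orthogonal d d"
    using orthogonal_to_span[OF d] by (auto simp: orthogonal_def)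
  then show ?thesis by (simp add: orthogonal_def d_def)
qed

text \<open>Six independent vectors in the span of at most six vectors span the same space. Applied
  to the simple roots of \<open>E6\<close>, this shows that \<open>t\<close> and the
  \<open>f i\<close> suffice as coordinates for all roots.\<close>

lemma frame_span:
  fixes f :: "nat \<Rightarrow> 'a::euclidean_space"
  assumes fr: "frame f t K" and A: "finite A" "card A \<le> 6" "insert t (f ` {..<5}) \<subseteq> span A"
  shows "span A \<subseteq> span (insert t (f ` {..<5}))"
proof -
  note fi = frame_inner[OF fr]
  have t0: "t \<noteq> 0" using fi(1,5) by auto
  have f0: "f i \<noteq> 0" if "i < 5" for i using fi(1) fi(2)[OF that that] by auto
  have inj: "inj_on f {..<5}"
  proof (rule inj_onI)
    fix i j assume "i \<in> {..<5}" "j \<in> {..<5}" "f i = f j"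
    then show "i = j" using fi(1) fi(2)[of i j] fi(2)[of i i] by (auto split: if_splits)
  qed
  have tf: "t \<notin> f ` {..<5}" using fi(3) fi(1,5) by auto
  have "pairwise orthogonal (insert t (f ` {..<5}))"
    unfolding pairwise_def orthogonal_def using fi(2-4) by (auto simp: inj_on_eq_iff[OF inj])
  moreover have "0 \<notin> insert t (f ` {..<5})" using t0 f0 by auto
  ultimately have ind: "independent (insert t (f ` {..<5}))"
    by (rule pairwise_orthogonal_independent)
  have "card (insert t (f ` {..<5})) = 6" using tf inj by (simp add: card_image)
  moreover have "dim (span A) \<le> 6" using dim_le_card'[of A] A by simp
  ultimately show ?thesis
    using card_ge_dim_independent[OF A(3) ind] by simp
qed

text \<open>The reflection is the one in \<open>2 (f i + f j)\<close>; it changes the number of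
  minus signs by two, in accordance with the parity condition of \<open>spinor\<close>.\<close>

lemma fvec_spinor_reflect:
  assumes fr: "frame f t K" and R: "root_system R" and D: "D_set {..<5} f \<subseteq> R"
    and x: "fvec f t x y \<in> R" and ij: "i < 5" "j < 5" "i \<noteq> j" "x i = x j"
  shows "fvec f t (x(i := - x i, j := - x j)) y \<in> R"
proof -
  note fi = frame_inner[OF fr]
  define v where "v = 2 *\<^sub>R (f i + f j)"
  have v: "v \<in> R" using D D_set_memI(1)[of i "{..<5}" j f] ij by (auto simp: v_def)
  have "v \<bullet> v = 8 * K" using ij fi by (simp add: v_def inner_add_left inner_add_right)
  moreover have "fvec f t x y \<bullet> v = 4 * x i * K"
    using ij by (simp add: v_def inner_add_right fvec_inner[OF fr])
  ultimately have "root_refl v (fvec f t x y) = fvec f t x y - x i *\<^sub>R v"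
    using fi(1) by (simp add: root_refl_def cartan_int_def)
  also have "\<dots> = fvec f t (x(i := - x i, j := - x j)) y"
  proof -
    have "(\<Sum>k<5. (x(i := - x i, j := - x j)) k *\<^sub>R f k) = (\<Sum>k<5. x k *\<^sub>R f k - ((if k = i then (2 * x i) *\<^sub>R f k else 0) + (if k = j then (2 * x i) *\<^sub>R f k else 0)))"
      using ij by (intro sum.cong) (auto simp flip: scaleR_left_diff_distrib)
    also have "\<dots> = (\<Sum>k<5. x k *\<^sub>R f k) - ((2 * x i) *\<^sub>R f i + (2 * x i) *\<^sub>R f j)"
      using ij by (simp add: sum_subtractf sum.distrib)
    finally show ?thesis by (simp add: fvec_def v_def algebra_simps)
  qed
  finally show ?thesis using root_system_refl[OF R v x] by simp
qed

lemma spinor_roots_generated: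
  assumes fr: "frame f t K" and R: "root_system R" and D: "D_set {..<5} f \<subseteq> R"
    and one: "fvec f t (\<lambda>_. 1) 1 \<in> R" and sp: "spinor x y"
  shows "fvec f t x y \<in> R"
proof -
  \<comment> \<open>Induction on the set \<open>M\<close> of negative coordinates: minus signs are
    introduced two at a time, starting from the root with all coordinates 1. The roots with
    \<open>y = -1\<close> are obtained at the end as negatives.\<close>
  have even_flip: "M \<subseteq> {..<5} \<Longrightarrow> even (card M) \<Longrightarrow> fvec f t (\<lambda>i. if i \<in> M then -1 else 1) 1 \<in> R" for M
  proof (induction "card M" arbitrary: M rule: less_induct)
    case less
    have fin: "finite M" using less.prems(1) finite_subset by blast
    show ?case
    proof (cases "M = {}")
      case True then show ?thesis using one by simp
    next
      case False
      then obtain i where i: "i \<in> M" by blast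
      have "M \<noteq> {i}" using less.prems(2) by auto
      then obtain j where j: "j \<in> M" "j \<noteq> i" using i by blast
      let ?N = "M - {i, j}"
      have card: "card M = card ?N + 2"
      proof -
        have "{i, j} \<subseteq> M" "card {i, j} = 2" using i j by auto
        then show ?thesis using card_Diff_subset[of "{i, j}" M] card_mono[OF fin, of "{i, j}"] by simp
      qed
      then have "fvec f t (\<lambda>k. if k \<in> ?N then -1 else 1) 1 \<in> R"
        using less by (intro less.hyps) auto
      from fvec_spinor_reflect[OF fr R D this, of i j] i j less.prems(1)
      have "fvec f t ((\<lambda>k. if k \<in> ?N then -1 else 1)(i := -1, j := -1)) 1 \<in> R" by auto
      moreover have "(\<lambda>k. if k \<in> ?N then -1 else 1)(i := -1, j := -1) = (\<lambda>k. if k \<in> M then -1 else 1::real)"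
        using i j by auto
      ultimately show ?thesis by simp
    qed
  qed
  have pos: "fvec f t x 1 \<in> R" if sp: "spinor x 1" for x
  proof -
    define M where "M = {i. i < 5 \<and> x i = -1}"
    have x: "x i = (if i \<in> M then -1 else 1)" if "i < 5" for i
      using sp that by (auto simp: spinor_def M_def)
    have "1 = (\<Prod>i<5. x i)" using sp by (simp add: spinor_def)
    also have "\<dots> = (\<Prod>i<5. if i \<in> M then -1 else 1)" using x by (intro prod.cong) auto
    also have "\<dots> = (-1) ^ card M"
    proof -
      have "{..<5} \<inter> M = M" by (auto simp: M_def)
      then show ?thesis by (simp add: prod.If_cases)
    qed
    finally have "even (card M)" by (cases "even (card M)") auto
    moreover have "M \<subseteq> {..<5}" by (auto simp: M_def)
    ultimately have "fvec f t (\<lambda>i. if i \<in> M then -1 else 1) 1 \<in> R" by (intro even_flip)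
    then show ?thesis using fvec_cong[of x "\<lambda>i. if i \<in> M then -1 else 1" f t 1] x by simp
  qed
  show ?thesis
  proof (cases "y = 1")
    case True then show ?thesis using pos sp by simp
  next
    case False
    then have y: "y = -1" using sp by (auto simp: spinor_def)
    then have "spinor (\<lambda>i. - x i) 1" using sp by (auto simp: spinor_def prod_lessThan_5)
    then have "fvec f t (\<lambda>i. - x i) 1 \<in> R" by (rule pos)
    then have "- fvec f t (\<lambda>i. - x i) 1 \<in> R" by (rule root_system_neg[OF R])
    then show ?thesis by (simp add: fvec_minus y)
  qed
qed

text \<open>The sum is the pairing with the root all of whose coordinates are 1, in units of
  \<open>K\<close>. With \<open>m\<close> negative \<open>X i\<close> it equals
  \<open>8 - 2 m\<close> if \<open>Y = 1\<close> and \<open>2 - 2 m\<close> if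
  \<open>Y = -1\<close>, and divisibility by 4 fixes the parity of \<open>m\<close> as
  required.\<close>

lemma spinor_of_pairing:
  fixes X :: "nat \<Rightarrow> real"
  assumes X: "\<forall>i<5. X i \<in> {1, -1}" and Y: "Y \<in> {1, -1}"
    and p: "(\<Sum>i<5. X i) + 3 * Y \<in> {0, 4, -4, 8, -8}"
  shows "spinor X Y"
proof -
  have "X 0 * X 1 * X 2 * X 3 * X 4 = Y"
    using X p Y unfolding all_less_5 sum_lessThan_5
    by (simp only: insert_iff empty_iff simp_thms) (elim conjE disjE; simp)
  then show ?thesis using X Y by (simp add: spinor_def prod_lessThan_5)
qed

text \<open>A root \<open>r\<close> with all pairings \<open>K\<close> or \<open>- K\<close> is
  chosen, the signs of the \<open>f i\<close> are changed to make all pairings \<open>K\<close>, and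
  \<open>t\<close> is the component of \<open>r\<close> orthogonal to the \<open>f i\<close>. For
  every other root, its length and its pairing with \<open>r\<close> decide between the cases of
  \<open>pairing_D_set\<close>.\<close>

lemma E6_frame:
  fixes R Ro :: "'a::euclidean_space set"
  assumes E6: "type_E6 R" and sub: "Ro \<subseteq> R" and D5: "type_D5 Ro"
  obtains f t K where "frame f t K" "R = E6_set f t" "Ro = D_set {..<5} f"
proof -
  have R: "root_system R" using E6 by (simp add: type_E6_def has_dynkin_type_def)
  obtain f' K where o': "orthogonal_family {..<5} f' K" and Ro': "Ro = D_set {..<5} f'"
    by (rule type_D5_D_set[OF D5])
  have D': "D_set {..<5} f' \<subseteq> R" using sub Ro' by simp
  note E = E6_odd_root[OF E6 o' D']
  obtain r where r: "r \<in> R" "\<forall>i<5. r \<bullet> f' i \<in> {K, - K}" using E(2) by blast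
  obtain A where A: "finite A" "card A \<le> 6" "R \<subseteq> span A" "A \<subseteq> R" using E(3) by blast
  have K: "K > 0" using o' by (simp add: orthogonal_family_def)
  define f where "f i = (r \<bullet> f' i / K) *\<^sub>R f' i" for i
  have sgn: "r \<bullet> f' i / K \<in> {1, -1}" if "i < 5" for i using r(2) that K by auto
  have ff: "f i \<bullet> f j = (if i = j then K else 0)" if "i < 5" "j < 5" for i j
  proof -
    define c where "c k = r \<bullet> f' k / K" for k
    have "f i \<bullet> f j = c i * c j * (f' i \<bullet> f' j)" by (simp add: f_def c_def)
    moreover have "c i \<in> {1, -1}" using sgn[OF that(1)] unfolding c_def .
    then have "c i * c i = 1" by auto
    ultimately show ?thesis using that o' by (auto simp: orthogonal_family_def)
  qed
  have o: "orthogonal_family {..<5} f K" using ff K by (simp add: orthogonal_family_def)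
  have Ro: "Ro = D_set {..<5} f"
    unfolding Ro' f_def using sgn by (intro D_set_sign[symmetric]) auto
  have D: "D_set {..<5} f \<subseteq> R" using sub Ro by simp
  have rf: "r \<bullet> f i = K" if "i < 5" for i
    using r(2) that K by (auto simp: f_def)
  have len: "\<And>x. x \<in> R \<Longrightarrow> x \<bullet> x = 8 * K" using E(1) by blast
  define t where "t = r - (\<Sum>i<5. 1 *\<^sub>R f i)"
  have ft: "f i \<bullet> t = 0" if "i < 5" for i
    using orthogonal_family_inner_sum(2)[OF o, of i "\<lambda>_. 1"] that rf[OF that]
    by (simp add: t_def inner_diff_right inner_commute[of _ r])
  have rt: "r = (\<Sum>i<5. 1 *\<^sub>R f i) + t" by (simp add: t_def)
  have "8 * K = r \<bullet> r" using len r(1) by simp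
  also have "r \<bullet> r = 5 * K + t \<bullet> t"
  proof -
    have "(\<Sum>i<5. 1 *\<^sub>R f i) \<bullet> t = 0" using ft by (simp add: inner_sum_left)
    then show ?thesis
      unfolding rt using orthogonal_family_inner_sums[OF o, of "\<lambda>_. 1" "\<lambda>_. 1"]
      by (simp add: inner_add_left inner_add_right inner_commute)
  qed
  finally have tt: "t \<bullet> t = 3 * K" by simp
  have fr: "frame f t K" using o ft tt by (simp add: frame_def)
  have rR: "fvec f t (\<lambda>_. 1) 1 = r" using rt by (simp add: fvec_def)
  have fspan: "f i \<in> span R" if "i < 5" for i
  proof -
    obtain j :: nat where j: "j < 5" "j \<noteq> i"
      using that[of "if i = 0 then 1 else 0"] by (auto split: if_splits)
    have "2 *\<^sub>R (f i + f j) \<in> span R" "2 *\<^sub>R (f i - f j) \<in> span R"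
      using D_set_memI[of i "{..<5}" j f] D j \<open>i < 5\<close> by (auto intro: span_base)
    then have "(1/4) *\<^sub>R (2 *\<^sub>R (f i + f j) + 2 *\<^sub>R (f i - f j)) \<in> span R"
      by (rule span_scale[OF span_add])
    also have "(1/4) *\<^sub>R (2 *\<^sub>R (f i + f j) + 2 *\<^sub>R (f i - f j)) = f i"
      by (simp add: algebra_simps flip: scaleR_left_distrib)
    finally show ?thesis .
  qed
  have "span R = span A" using span_mono[OF A(4)] span_minimal[OF A(3) subspace_span] by blast
  moreover have "t \<in> span R"
    unfolding t_def using r(1) fspan by (intro span_diff span_sum span_scale) (auto intro: span_base)
  ultimately have "insert t (f ` {..<5}) \<subseteq> span A" using fspan by auto
  from frame_span[OF fr A(1,2) this] have span: "R \<subseteq> span (insert t (f ` {..<5}))" using A(3) by blast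
  have "R \<subseteq> E6_set f t"
  proof
    fix x assume xR: "x \<in> R"
    define X Y where "X = (\<lambda>i. x \<bullet> f i / K)" and "Y = x \<bullet> t / (3 * K)"
    have x: "x = fvec f t X Y" unfolding X_def Y_def using xR span by (intro fvec_expansion[OF fr]) blast
    have xf: "x \<bullet> f i = X i * K" for i using K by (simp add: X_def)
    have "8 * K = x \<bullet> x" using len xR by simp
    also have "x \<bullet> x = ((\<Sum>i<5. X i * X i) + 3 * (Y * Y)) * K" unfolding x by (rule fvec_inner[OF fr])
    finally have norm: "(\<Sum>i<5. X i * X i) + 3 * (Y * Y) = 8" using K by simp
    have xr: "x \<bullet> r = ((\<Sum>i<5. X i) + 3 * Y) * K"
      unfolding x rR[symmetric] fvec_inner(4)[OF fr] by simp
    have "x \<bullet> r = 0 \<or> x \<bullet> r = 4 * K \<or> x \<bullet> r = - (4 * K) \<or> x \<bullet> r = 8 * K \<or> x \<bullet> r = - (8 * K)"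
      using equal_length_pairing[OF R xR r(1), of "4 * K"] len[OF xR] len[OF r(1)] by auto
    then have "((\<Sum>i<5. X i) + 3 * Y) * K = 0 * K \<or> ((\<Sum>i<5. X i) + 3 * Y) * K = 4 * K \<or>
      ((\<Sum>i<5. X i) + 3 * Y) * K = - 4 * K \<or> ((\<Sum>i<5. X i) + 3 * Y) * K = 8 * K \<or> ((\<Sum>i<5. X i) + 3 * Y) * K = - 8 * K"
      unfolding xr by simp
    then have p: "(\<Sum>i<5. X i) + 3 * Y \<in> {0, 4, -4, 8, -8}"
      using K by (simp only: mult_cancel_right) auto
    have e: "x \<bullet> f i = 2 * K \<longleftrightarrow> X i = 2" "x \<bullet> f i = - 2 * K \<longleftrightarrow> X i = - 2" "x \<bullet> f i = K \<longleftrightarrow> X i = 1"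
      "x \<bullet> f i = - K \<longleftrightarrow> X i = - 1" "x \<bullet> f i = 0 \<longleftrightarrow> X i = 0" for i
      using K by (auto simp: X_def field_simps)
    have "x \<in> D_set {..<5} f \<or> (\<forall>i<5. X i = 0) \<or>
      (\<exists>i<5. X i \<in> {2, - 2} \<and> (\<forall>j<5. j \<noteq> i \<longrightarrow> X j = 0)) \<or> (\<forall>i<5. X i \<in> {1, - 1})"
      using pairing_D_set[OF R len o D xR] by (simp only: insert_iff empty_iff simp_thms e)
    then consider "x \<in> D_set {..<5} f" | "\<forall>i<5. X i = 0" |
      i where "i < 5" "X i \<in> {2, -2}" "\<forall>j<5. j \<noteq> i \<longrightarrow> X j = 0" | "\<forall>i<5. X i \<in> {1, -1}"
      by blast
    then show "x \<in> E6_set f t"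
    proof cases
      case 1 then show ?thesis by (simp add: E6_set_def)
    next
      \<comment> \<open>A root orthogonal to all \<open>f i\<close> would satisfy
        \<open>(3 Y)^2 = 24\<close>, but its pairing with \<open>r\<close> puts \<open>3 Y\<close>
        into \<open>{0, 4, -4, 8, -8}\<close>.\<close>
      case 2
      then have "(\<Sum>i<5. X i * X i) = 0" "(\<Sum>i<5. X i) = 0" by simp_all
      then have Y: "3 * (Y * Y) = 8" "3 * Y \<in> {0, 4, -4, 8, -8}" using norm p by simp_all
      define Z where "Z = 3 * Y"
      have "Z * Z = 3 * (3 * (Y * Y))" by (simp add: Z_def)
      then have "Z * Z = 24" unfolding Y(1) by simp
      moreover have "Z \<in> {0, 4, -4, 8, -8}" unfolding Z_def by (rule Y(2))
      ultimately show ?thesis by auto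
    next
      \<comment> \<open>Here the length gives \<open>(3 Y)^2 = 12\<close>, while the pairing with
        \<open>r\<close> makes \<open>3 Y\<close> an even integer.\<close>
      case (3 i)
      have "(\<Sum>j<5. X j * X j) = (\<Sum>j\<in>{i}. X j * X j)" "(\<Sum>j<5. X j) = (\<Sum>j\<in>{i}. X j)"
        using 3(1,3) by (intro sum.mono_neutral_right; simp)+
      then have S: "(\<Sum>j<5. X j * X j) = 4" "(\<Sum>j<5. X j) = X i" using 3(2) by auto
      then have Y: "3 * (Y * Y) = 4" "X i + 3 * Y \<in> {0, 4, -4, 8, -8}" using norm p unfolding S by simp_all
      define Z where "Z = 3 * Y"
      have "Z * Z = 3 * (3 * (Y * Y))" by (simp add: Z_def)
      then have "Z * Z = 12" unfolding Y(1) by simp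
      moreover have "X i + Z \<in> {0, 4, -4, 8, -8}" unfolding Z_def by (rule Y(2))
      then have "Z = - X i \<or> Z = 4 - X i \<or> Z = - 4 - X i \<or> Z = 8 - X i \<or> Z = - 8 - X i" by auto
      ultimately show ?thesis using 3(2) by auto
    next
      case 4
      then have "(\<Sum>i<5. X i * X i) = (\<Sum>i<(5::nat). 1)" by (intro sum.cong) fastforce+
      then have "Y * Y = 1" using norm by simp
      then have "Y \<in> {1, -1}" by (simp add: square_eq_1_iff)
      then have "spinor X Y" using spinor_of_pairing[OF 4 _ p] by blast
      then show ?thesis using x by (auto simp: E6_set_def)
    qed
  qed
  moreover have "E6_set f t \<subseteq> R"
    using D spinor_roots_generated[OF fr R D] rR r(1) by (auto simp: E6_set_def)
  ultimately have "R = E6_set f t" by blast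
  then show ?thesis using that fr Ro by blast
qed

section \<open>Subsystems of type \<open>3A\<^sub>2\<close>\<close>

text \<open>The Weyl group of \<open>D5\<close> acting on frames. It is a relation between families,
  not a group of maps, because only the values at indices below 5 matter and the classification
  produces the new family rather than a group element.\<close>

definition frame_change :: "(nat \<Rightarrow> 'a::euclidean_space) \<Rightarrow> (nat \<Rightarrow> 'a) \<Rightarrow> bool" where
  "frame_change f g \<longleftrightarrow> (\<exists>\<pi> s. \<pi> permutes {..<5} \<and> (\<forall>i<5. s i \<in> {1, -1::real}) \<and> (\<Prod>i<5. s i) = 1 \<and>
     (\<forall>i<5. g i = s i *\<^sub>R f (\<pi> i)))"

lemma frame_change_refl: "frame_change f f"
  unfolding frame_change_def by (intro exI[of _ id] exI[of _ "\<lambda>_. 1"]) (auto simp: permutes_id)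

lemma frame_change_trans:
  assumes "frame_change f g" "frame_change g h"
  shows "frame_change f h"
proof -
  obtain \<pi> s where p: "\<pi> permutes {..<5}" and s: "\<forall>i<5. s i \<in> {1, -1::real}" "(\<Prod>i<5. s i) = 1"
    and g: "\<forall>i<5. g i = s i *\<^sub>R f (\<pi> i)" using assms(1) by (auto simp: frame_change_def)
  obtain \<pi>' s' where p': "\<pi>' permutes {..<5}" and s': "\<forall>i<5. s' i \<in> {1, -1::real}" "(\<Prod>i<5. s' i) = 1"
    and h: "\<forall>i<5. h i = s' i *\<^sub>R g (\<pi>' i)" using assms(2) by (auto simp: frame_change_def)
  have lt: "\<pi>' i < 5" if "i < 5" for i using permutes_in_image[OF p', of i] that by simp
  have "(\<Prod>i<5. s' i * s (\<pi>' i)) = (\<Prod>i<5. s' i) * (\<Prod>i<5. s (\<pi>' i))" by (simp add: prod.distrib)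
  also have "(\<Prod>i<5. s (\<pi>' i)) = (\<Prod>i<5. s i)" using prod.permute[OF p', of s] by (simp add: comp_def)
  finally have "(\<Prod>i<5. s' i * s (\<pi>' i)) = 1" using s s' by simp
  moreover have "s' i * s (\<pi>' i) \<in> {1, -1}" if "i < 5" for i using s(1) s'(1) that lt[OF that] by fastforce
  ultimately show ?thesis
    unfolding frame_change_def using g h lt permutes_compose[OF p' p]
    by (intro exI[of _ "\<pi> \<circ> \<pi>'"] exI[of _ "\<lambda>i. s' i * s (\<pi>' i)"]) auto
qed

lemma frame_change_sym:
  assumes "frame_change f g"
  shows "frame_change g f"
proof -
  obtain \<pi> s where p: "\<pi> permutes {..<5}" and s: "\<forall>i<5. s i \<in> {1, -1::real}" "(\<Prod>i<5. s i) = 1"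
    and g: "\<forall>i<5. g i = s i *\<^sub>R f (\<pi> i)" using assms(1) by (auto simp: frame_change_def)
  let ?q = "inv \<pi>"
  have q: "?q permutes {..<5}" by (rule permutes_inv[OF p])
  have lt: "?q i < 5" if "i < 5" for i using permutes_in_image[OF q, of i] that by simp
  have "(\<Prod>i<5. s (?q i)) = 1" using prod.permute[OF q, of s] s by (simp add: comp_def)
  moreover have "f i = s (?q i) *\<^sub>R g (?q i)" if "i < 5" for i
  proof -
    have "g (?q i) = s (?q i) *\<^sub>R f i" using g lt[OF that] permutes_inverses(1)[OF p] by simp
    moreover have "s (?q i) * s (?q i) = 1" using s(1) lt[OF that] by fastforce
    ultimately show ?thesis by simp
  qed
  ultimately show ?thesis
    unfolding frame_change_def using q s(1) lt by (intro exI[of _ ?q] exI[of _ "\<lambda>i. s (?q i)"]) auto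
qed

lemma frame_changeI:
  assumes lt: "i < 5" "j < 5" "k < 5" "l < 5" "m < (5::nat)" and dist: "distinct [i, j, k, l, m]"
    and s: "s0 \<in> {1, -1}" "s1 \<in> {1, -1}" "s2 \<in> {1, -1}" "s3 \<in> {1, -1}" "s4 \<in> {1, -1::real}" "s0 * s1 * s2 * s3 * s4 = 1"
    and g: "g 0 = s0 *\<^sub>R f i" "g 1 = s1 *\<^sub>R f j" "g 2 = s2 *\<^sub>R f k" "g 3 = s3 *\<^sub>R f l" "g 4 = s4 *\<^sub>R f m"
  shows "frame_change f g"
proof -
  define \<pi> where "\<pi> n = (if n < 5 then [i, j, k, l, m] ! n else n)" for n
  define s where "s n = [s0, s1, s2, s3, s4] ! n" for n
  have pv: "\<pi> 0 = i" "\<pi> 1 = j" "\<pi> 2 = k" "\<pi> 3 = l" "\<pi> 4 = m" by (simp_all add: \<pi>_def)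
  have sv: "s 0 = s0" "s 1 = s1" "s 2 = s2" "s 3 = s3" "s 4 = s4" by (simp_all add: s_def)
  have img: "\<pi> ` {..<5} \<subseteq> {..<5}" using lt by (auto simp: lessThan_5 pv simp del: One_nat_def)
  have "inj_on \<pi> {..<5}" using dist by (auto simp: lessThan_5 inj_on_def pv simp del: One_nat_def)
  then have "bij_betw \<pi> {..<5} {..<5}" using img by (auto simp: bij_betw_def endo_inj_surj)
  then have "\<pi> permutes {..<5}" by (rule bij_imp_permutes) (simp add: \<pi>_def)
  moreover have "\<forall>n<5. s n \<in> {1, -1}" unfolding all_less_5 sv using s by blast
  moreover have "(\<Prod>n<5. s n) = 1" unfolding prod_lessThan_5 sv by (rule s)
  moreover have "\<forall>n<5. g n = s n *\<^sub>R f (\<pi> n)" unfolding all_less_5 sv pv using g by blast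
  ultimately show ?thesis unfolding frame_change_def by blast
qed

lemma frame_change_frame:
  assumes ch: "frame_change f g" and fr: "frame f t K"
  shows "frame g t K"
proof -
  obtain \<pi> s where p: "\<pi> permutes {..<5}" and s: "\<forall>i<5. s i \<in> {1, -1::real}"
    and g: "\<forall>i<5. g i = s i *\<^sub>R f (\<pi> i)" using ch by (auto simp: frame_change_def)
  have lt: "\<pi> i < 5" if "i < 5" for i using permutes_in_image[OF p, of i] that by simp
  note fi = frame_inner[OF fr]
  have "g i \<bullet> g j = (if i = j then K else 0)" if "i < 5" "j < 5" for i j
  proof -
    have "\<pi> i = \<pi> j \<longleftrightarrow> i = j" using permutes_inj[OF p] by (auto simp: inj_eq)
    moreover have "s i * s i = 1" using s that by fastforce
    ultimately show ?thesis using g that fi(2)[OF lt[OF that(1)] lt[OF that(2)]] by (auto simp flip: mult.assoc)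
  qed
  moreover have "g i \<bullet> t = 0" if "i < 5" for i using g that fi(3)[OF lt[OF that]] by simp
  ultimately show ?thesis using fi(1,5) by (auto simp: frame_def orthogonal_family_def)
qed

lemma D_set_frame_change:
  assumes ch: "frame_change f g"
  shows "D_set {..<5} g = D_set {..<5} f"
proof -
  have sub: "D_set {..<5} g \<subseteq> D_set {..<5} f" if ch: "frame_change f g" for f g :: "nat \<Rightarrow> 'a"
  proof
    obtain \<pi> s where p: "\<pi> permutes {..<5}" and s: "\<forall>i<5. s i \<in> {1, -1::real}"
      and g: "\<forall>i<5. g i = s i *\<^sub>R f (\<pi> i)" using ch by (auto simp: frame_change_def)
    fix x assume "x \<in> D_set {..<5} g"
    then obtain a b i j where x: "x = 2 *\<^sub>R (a *\<^sub>R g i + b *\<^sub>R g j)" "i \<in> {..<5}" "j \<in> {..<5}" "i \<noteq> j" "a \<in> {1, -1}" "b \<in> {1, -1}"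
      unfolding D_set_def by blast
    have "x = 2 *\<^sub>R ((a * s i) *\<^sub>R f (\<pi> i) + (b * s j) *\<^sub>R f (\<pi> j))" using x g by simp
    moreover have "\<pi> i \<in> {..<5}" "\<pi> j \<in> {..<5}" "\<pi> i \<noteq> \<pi> j"
      using x permutes_in_image[OF p] permutes_inj[OF p] by (auto simp: inj_eq)
    moreover have "s i \<in> {1, -1}" "s j \<in> {1, -1}" using s x(2,3) by blast+
    then have "a * s i \<in> {1, -1}" "b * s j \<in> {1, -1}" using x(5,6) by auto
    ultimately show "x \<in> D_set {..<5} f" unfolding D_set_def by blast
  qed
  from sub[OF ch] sub[OF frame_change_sym[OF ch]] show ?thesis by blast
qed

text \<open>Since \<open>t\<close> is kept, the product of the five signs must be 1 to preserve the
  condition of \<open>spinor\<close>; this is the reason for the evenness in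
  \<open>frame_change\<close>.\<close>

lemma E6_set_frame_change:
  assumes ch: "frame_change f g"
  shows "E6_set g t = E6_set f t"
proof -
  have sub: "{fvec g t x y | x y. spinor x y} \<subseteq> {fvec f t x y | x y. spinor x y}" if ch: "frame_change f g" for f g :: "nat \<Rightarrow> 'a"
  proof
    obtain \<pi> s where p: "\<pi> permutes {..<5}" and s: "\<forall>i<5. s i \<in> {1, -1::real}" "(\<Prod>i<5. s i) = 1"
      and g: "\<forall>i<5. g i = s i *\<^sub>R f (\<pi> i)" using ch by (auto simp: frame_change_def)
    fix v assume "v \<in> {fvec g t x y | x y. spinor x y}"
    then obtain x y where v: "v = fvec g t x y" and sp: "spinor x y" by blast
    let ?q = "inv \<pi>"
    define x' where "x' i = s (?q i) * x (?q i)" for i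
    have q: "?q permutes {..<5}" by (rule permutes_inv[OF p])
    have lt: "?q i < 5" if "i < 5" for i using permutes_in_image[OF q, of i] that by simp
    have "(\<Sum>i<5. x' i *\<^sub>R f i) = (\<Sum>i<5. x' (\<pi> i) *\<^sub>R f (\<pi> i))"
      using sum.permute[OF p, of "\<lambda>i. x' i *\<^sub>R f i"] by (simp add: comp_def)
    also have "\<dots> = (\<Sum>i<5. x i *\<^sub>R g i)"
      using g by (intro sum.cong) (auto simp: x'_def permutes_inverses[OF p])
    finally have "v = fvec f t x' y" by (simp add: v fvec_def)
    moreover have "(\<Prod>i<5. x' i) = (\<Prod>i<5. s i) * (\<Prod>i<5. x i)"
      using prod.permute[OF q, of "\<lambda>i. s i * x i"] by (simp add: x'_def comp_def prod.distrib)
    then have "(\<Prod>i<5. x' i) = y" using s sp by (simp add: spinor_def)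
    moreover have "x' i \<in> {1, -1}" if "i < 5" for i
      using s(1) sp lt[OF that] unfolding x'_def spinor_def by fastforce
    ultimately show "v \<in> {fvec f t x y | x y. spinor x y}" using sp by (auto simp: spinor_def)
  qed
  show ?thesis
    unfolding E6_set_def D_set_frame_change[OF ch] using sub[OF ch] sub[OF frame_change_sym[OF ch]] by blast
qed

section \<open>Coordinates of single roots and neighbours in \<open>A2\<close>-systems\<close>

lemma D_set_coords:
  assumes "x \<in> D_set {..<5} f"
  obtains X where "x = fvec f t X 0" "\<forall>i<5. X i \<in> {0, 2, -2}" "(\<Sum>i<5. X i * X i) = 8"
proof -
  obtain s r i j where x: "x = 2 *\<^sub>R (s *\<^sub>R f i + r *\<^sub>R f j)" and ij: "i < 5" "j < 5" "i \<noteq> j" and sr: "s \<in> {1, -1}" "r \<in> {1, -1}"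
    using assms unfolding D_set_def by blast
  define X where "X k = (if k = i then 2 * s else if k = j then 2 * r else 0)" for k
  have "(\<Sum>k<5. X k *\<^sub>R f k) = (\<Sum>k\<in>{i, j}. X k *\<^sub>R f k)"
    using ij by (intro sum.mono_neutral_right) (auto simp: X_def)
  then have "x = fvec f t X 0" using ij by (simp add: x fvec_def X_def scaleR_right_distrib)
  moreover have "(\<Sum>k<5. X k * X k) = (\<Sum>k\<in>{i, j}. X k * X k)"
    using ij by (intro sum.mono_neutral_right) (auto simp: X_def)
  then have "(\<Sum>k<5. X k * X k) = 8" using ij sr by (auto simp: X_def)
  moreover have "\<forall>k<5. X k \<in> {0, 2, -2}" using sr by (auto simp: X_def)
  ultimately show ?thesis using that by blast
qed

lemma E6_set_coords:
  assumes "x \<in> E6_set f t"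
  obtains X Y where "x = fvec f t X Y"
    "x \<in> D_set {..<5} f \<and> Y = 0 \<and> (\<forall>i<5. X i \<in> {0, 2, -2}) \<and> (\<Sum>i<5. X i * X i) = 8 \<or> spinor X Y"
proof (cases "x \<in> D_set {..<5} f")
  case True
  obtain X where "x = fvec f t X 0" "\<forall>i<5. X i \<in> {0, 2, -2}" "(\<Sum>i<5. X i * X i) = 8"
    by (rule D_set_coords[OF True])
  then show ?thesis using that[of X 0] True by blast
next
  case False
  then obtain X Y where "x = fvec f t X Y" "spinor X Y" using assms unfolding E6_set_def by blast
  then show ?thesis using that by blast
qed

lemma E6_set_length:
  assumes "frame f t K" "x \<in> E6_set f t"
  shows "x \<bullet> x = 8 * K"
proof -
  obtain X Y where x: "x = fvec f t X Y" and
    "Y = 0 \<and> (\<Sum>i<5. X i * X i) = 8 \<or> spinor X Y" by (rule E6_set_coords[OF assms(2)]) auto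
  moreover have "(\<Sum>i<5. X i * X i) = 5 \<and> Y * Y = 1" if "spinor X Y"
  proof -
    have "(\<Sum>i<5. X i * X i) = (\<Sum>i<(5::nat). 1)"
      using that by (intro sum.cong) (fastforce simp: spinor_def)+
    then show ?thesis using that by (auto simp: spinor_def)
  qed
  ultimately have "(\<Sum>i<5. X i * X i) + 3 * (Y * Y) = 8" by auto
  then show ?thesis unfolding x fvec_inner(4)[OF assms(1)] by simp
qed

lemma A2_set_commute: "A2_set x y = A2_set y x"
  unfolding A2_set_def add.commute[of y x] by blast

lemma A2_pair_commute: "A2_pair x y \<Longrightarrow> A2_pair y x"
  by (auto simp: A2_pair_def inner_commute)

text \<open>Every root of an \<open>A2\<close>-system belongs to a simple pair, so a summand can be
  described starting from any convenient root in it.\<close>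

lemma A2_set_neighbour:
  assumes A: "A2_pair x y" and a: "a \<in> A2_set x y"
  obtains z where "A2_pair a z" "A2_set x y = A2_set a z"
proof -
  have *: "\<exists>z. A2_pair a z \<and> A2_set x y = A2_set a z" if A: "A2_pair x y" and a: "a \<in> {x, - x, x + y, - (x + y)}" for x y
  proof -
    have p: "x \<noteq> 0" "x \<bullet> x = y \<bullet> y" "2 * (x \<bullet> y) = - (y \<bullet> y)" "2 * (y \<bullet> x) = - (y \<bullet> y)"
      using A by (auto simp: A2_pair_def inner_commute)
    then have q: "(x + y) \<bullet> (x + y) = y \<bullet> y" "(x + y) \<bullet> x = (y \<bullet> y) / 2"
      by (simp_all add: inner_add_left inner_add_right field_simps)
    then have "x + y \<noteq> 0" using p by auto
    then have "A2_pair x y" "A2_pair (- x) (- y)" "A2_pair (x + y) (- x)"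
      using A p q unfolding A2_pair_def by simp_all
    moreover have "A2_pair (- v) x" if "A2_pair v (- x)" for v
      using that unfolding A2_pair_def by simp
    then have "A2_pair (- (x + y)) x" using calculation(3) by blast
    moreover have "A2_set x y = A2_set (- x) (- y)" "A2_set x y = A2_set (x + y) (- x)" "A2_set x y = A2_set (- (x + y)) x"
      unfolding A2_set_def by auto
    ultimately show ?thesis using a by blast
  qed
  have "a \<in> {x, - x, x + y, - (x + y)} \<or> a \<in> {y, - y, y + x, - (y + x)}"
    using a by (auto simp: A2_set_def)
  then show ?thesis
    using *[OF A] *[OF A2_pair_commute[OF A]] that A2_set_commute[of y x] by metis
qed

text \<open>The two roots of an \<open>A2\<close>-system at 120 degrees to \<open>a\<close> are
  \<open>z\<close> and \<open>- (a + z)\<close>; a coordinate computation may find either of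
  them.\<close>

lemma A2_set_swap:
  assumes "z' = - (a + z)"
  shows "A2_set a z' = A2_set a z"
  unfolding A2_set_def assms by auto

lemma type_A2_neighbour:
  assumes "type_A2 A" "a \<in> A"
  obtains z where "A2_pair a z" "A = A2_set a z" "z \<in> A"
proof -
  obtain x y where "A2_pair x y" "A = A2_set x y" by (rule type_A2_imp[OF assms(1)])
  moreover then obtain z where "A2_pair a z" "A2_set x y = A2_set a z" using A2_set_neighbour assms(2) by metis
  ultimately show ?thesis using that by (auto simp: A2_set_def)
qed

lemma type_A2_neg: "type_A2 A \<Longrightarrow> x \<in> A \<Longrightarrow> - x \<in> A"
  by (auto simp: type_A2_def has_dynkin_type_def root_system_neg)

text \<open>Roots outside \<open>D5\<close> have pairing \<open>3 K\<close> or \<open>- 3 K\<close>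
  with \<open>t\<close>. If \<open>x\<close> and \<open>y\<close> are both of this kind, the pairing
  of their sum is 0 or plus or minus \<open>6 K\<close>; as \<open>x + y\<close> is a root, it is 0
  and \<open>x + y\<close> lies in \<open>D5\<close>.\<close>

lemma type_A2_meets_D_set:
  assumes fr: "frame f t K" and A: "type_A2 A" "A \<subseteq> E6_set f t"
  obtains a where "a \<in> A" "a \<in> D_set {..<5} f"
proof -
  obtain x y where xy: "A = A2_set x y" by (rule type_A2_imp[OF A(1)])
  have K: "K > 0" using frame_inner[OF fr] by simp
  have h: "v \<in> D_set {..<5} f \<or> v \<bullet> t = 3 * K \<or> v \<bullet> t = - (3 * K)" if "v \<in> E6_set f t" for v
    using that by (auto simp: E6_set_def spinor_def fvec_inner[OF fr])
  have h0: "v \<in> D_set {..<5} f" if "v \<in> E6_set f t" "v \<bullet> t \<noteq> 3 * K" "v \<bullet> t \<noteq> - (3 * K)" for v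
    using h that by blast
  have mem: "x \<in> A" "y \<in> A" "x + y \<in> A" by (auto simp: xy A2_set_def)
  have "(x + y) \<bullet> t = x \<bullet> t + y \<bullet> t" by (simp add: inner_add_left)
  then have "x \<in> D_set {..<5} f \<or> y \<in> D_set {..<5} f \<or> x + y \<in> D_set {..<5} f"
    using h[of x] h[of y] h[of "x + y"] mem A(2) K by (smt (verit) subsetD)
  then show ?thesis using that mem by blast
qed

text \<open>Together with \<open>B_summand\<close> and \<open>C_summand\<close>, the normal form of
  a \<open>3A2\<close>-subsystem. This summand lies in \<open>D5\<close>; the roots of
  \<open>E6\<close> orthogonal to it form the other two, each of which meets \<open>D5\<close> in
  one pair of opposite roots, multiples of \<open>g 0 - g 1\<close> and of \<open>g 0 + g 1\<close>.
  Their second vectors are the roots at 120 degrees to the first ones with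
  \<open>t\<close>-coordinate 1.\<close>

definition A_summand :: "(nat \<Rightarrow> 'a::euclidean_space) \<Rightarrow> 'a set" where
  "A_summand g = A2_set (2 *\<^sub>R (g 2 - g 3)) (2 *\<^sub>R (g 3 - g 4))"

definition B_summand :: "(nat \<Rightarrow> 'a::euclidean_space) \<Rightarrow> 'a \<Rightarrow> 'a set" where
  "B_summand g t = A2_set (2 *\<^sub>R (g 0 - g 1)) (t - (g 2 + g 3 + g 4) - (g 0 - g 1))"

definition C_summand :: "(nat \<Rightarrow> 'a::euclidean_space) \<Rightarrow> 'a \<Rightarrow> 'a set" where
  "C_summand g t = A2_set (2 *\<^sub>R (g 0 + g 1)) (t + (g 2 + g 3 + g 4) - (g 0 + g 1))"

lemma scale_cancel: "0 < K \<Longrightarrow> p * K = q * K \<Longrightarrow> p = q" for K p q :: real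
  by simp

text \<open>Orthogonality to \<open>g 0\<close> and \<open>g 1\<close> confines the summand to the
  indices 2, 3, 4. The four roots there at 120 degrees to \<open>2 (g 2 - g 3)\<close> pair up into
  two systems, exchanged by the sign of \<open>g 4\<close>. For the second one \<open>g 1\<close> is
  negated as well, to keep the number of sign changes even.\<close>

lemma A_summand_cases:
  assumes fr: "frame g t K" and A: "type_A2 A" "A \<subseteq> E6_set g t" "2 *\<^sub>R (g 2 - g 3) \<in> A"
    and orth: "\<forall>x\<in>A. x \<bullet> g 0 = 0" "\<forall>x\<in>A. x \<bullet> g 1 = 0"
  shows "A = A_summand g \<or> A = A_summand (g(1 := - g 1, 4 := - g 4))"
proof -
  obtain z where z: "A2_pair (2 *\<^sub>R (g 2 - g 3)) z" "A = A2_set (2 *\<^sub>R (g 2 - g 3)) z" "z \<in> A"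
    by (rule type_A2_neighbour[OF A(1,3)])
  have K: "K > 0" using frame_inner[OF fr] by simp
  obtain X Y where X: "z = fvec g t X Y" and
    c: "z \<in> D_set {..<5} g \<and> Y = 0 \<and> (\<forall>i<5. X i \<in> {0, 2, -2}) \<and> (\<Sum>i<5. X i * X i) = 8 \<or> spinor X Y"
    using E6_set_coords[of z g t] z(3) A(2) by blast
  have X01: "X 0 = 0" "X 1 = 0" using orth z(3) K by (auto simp: X fvec_inner[OF fr])
  then have c: "Y = 0" "X 2 \<in> {0, 2, -2}" "X 3 \<in> {0, 2, -2}" "X 4 \<in> {0, 2, -2}" "X 2 * X 2 + X 3 * X 3 + X 4 * X 4 = 8"
    using c by (auto simp: spinor_def all_less_5 sum_lessThan_5)
  have "(X 2 - X 3) * K = (-2) * K"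
    using z(1) frame_inner(1,2)[OF fr]
    by (simp add: A2_pair_def X fvec_inner[OF fr] inner_diff_left inner_diff_right algebra_simps)
  then have d: "X 2 - X 3 = -2" by (rule scale_cancel[OF K])
  have zX: "z = X 2 *\<^sub>R g 2 + X 3 *\<^sub>R g 3 + X 4 *\<^sub>R g 4"
    unfolding X fvec_def sum_lessThan_5 X01 c(1) by simp
  have "(X 2, X 3, X 4) \<in> {(-2, 0, 2), (-2, 0, -2), (0, 2, 2), (0, 2, -2)}"
    using c(2-5) d by auto
  then show ?thesis
  proof (elim insertE)
    assume "(X 2, X 3, X 4) = (-2, 0, 2)"
    then have "z = - (2 *\<^sub>R (g 2 - g 3) + 2 *\<^sub>R (g 3 - g 4))" unfolding zX by (simp add: algebra_simps)
    then show ?thesis using A2_set_swap z(2) by (auto simp: A_summand_def)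
  next
    assume "(X 2, X 3, X 4) = (-2, 0, -2)"
    then have "z = - (2 *\<^sub>R (g 2 - g 3) + 2 *\<^sub>R (g 3 + g 4))" unfolding zX by (simp add: algebra_simps)
    then show ?thesis using A2_set_swap z(2) by (auto simp: A_summand_def)
  next
    assume "(X 2, X 3, X 4) = (0, 2, 2)"
    then have "z = 2 *\<^sub>R (g 3 + g 4)" unfolding zX by (simp add: algebra_simps)
    then show ?thesis using z(2) by (auto simp: A_summand_def)
  next
    assume "(X 2, X 3, X 4) = (0, 2, -2)"
    then have "z = 2 *\<^sub>R (g 3 - g 4)" unfolding zX by (simp add: algebra_simps)
    then show ?thesis using z(2) by (auto simp: A_summand_def)
  qed simp
qed

text \<open>For a root at 120 degrees to \<open>2 (g 0 - g 1)\<close>, orthogonality gives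
  \<open>X 1 = - X 0\<close> and \<open>X 2 = X 3 = X 4\<close>, and the angle gives
  \<open>X 0 = -1\<close>. So the root is outside \<open>D5\<close>, and the product of signs yields
  \<open>X 2 = - Y\<close>. The two values of \<open>Y\<close> are the two neighbours in one
  system.\<close>

lemma B_summand_unique:
  assumes fr: "frame g t K" and B: "type_A2 B" "B \<subseteq> E6_set g t" "2 *\<^sub>R (g 0 - g 1) \<in> B"
    and orth: "\<forall>x\<in>B. x \<bullet> (g 0 + g 1) = 0" "\<forall>x\<in>B. x \<bullet> (g 2 - g 3) = 0" "\<forall>x\<in>B. x \<bullet> (g 3 - g 4) = 0"
  shows "B = B_summand g t"
proof -
  obtain z where z: "A2_pair (2 *\<^sub>R (g 0 - g 1)) z" "B = A2_set (2 *\<^sub>R (g 0 - g 1)) z" "z \<in> B"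
    by (rule type_A2_neighbour[OF B(1,3)])
  have K: "K > 0" using frame_inner[OF fr] by simp
  obtain X Y where X: "z = fvec g t X Y" and
    c: "z \<in> D_set {..<5} g \<and> Y = 0 \<and> (\<forall>i<5. X i \<in> {0, 2, -2}) \<and> (\<Sum>i<5. X i * X i) = 8 \<or> spinor X Y"
    using E6_set_coords[of z g t] z(3) B(2) by blast
  have "X 0 * K + X 1 * K = 0" "X 2 * K - X 3 * K = 0" "X 3 * K - X 4 * K = 0"
    using bspec[OF orth(1) z(3)] bspec[OF orth(2) z(3)] bspec[OF orth(3) z(3)]
    by (simp_all add: X inner_add_right inner_diff_right fvec_inner[OF fr])
  then have e: "X 1 = - X 0" "X 3 = X 2" "X 4 = X 2" using K by (simp_all flip: distrib_right left_diff_distrib)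
  have "(X 0 - X 1) * K = (-2) * K"
    using z(1) frame_inner(1,2)[OF fr]
    by (simp add: A2_pair_def X fvec_inner[OF fr] inner_diff_left inner_diff_right algebra_simps)
  then have "X 0 - X 1 = -2" by (rule scale_cancel[OF K])
  then have d: "X 0 = -1" using e(1) by simp
  then have sp: "spinor X Y" using c by (auto simp: all_less_5)
  then have Y: "Y \<in> {1, -1}" "X 2 \<in> {1, -1}" "X 2 * X 2 * X 2 = - Y"
    using d e by (auto simp: spinor_def prod_lessThan_5)
  then have X2: "X 2 = - Y" by auto
  have zX: "z = - g 0 + g 1 - Y *\<^sub>R (g 2 + g 3 + g 4) + Y *\<^sub>R t"
    unfolding X fvec_def sum_lessThan_5 e d X2 by (simp add: algebra_simps)
  show ?thesis
  proof (cases "Y = 1")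
    case True
    then have "z = t - (g 2 + g 3 + g 4) - (g 0 - g 1)" unfolding zX by simp
    then show ?thesis using z(2) by (simp add: B_summand_def)
  next
    case False
    then have "z = - (2 *\<^sub>R (g 0 - g 1) + (t - (g 2 + g 3 + g 4) - (g 0 - g 1)))" using Y(1) unfolding zX by (auto simp: scaleR_2)
    from A2_set_swap[OF this] show ?thesis unfolding B_summand_def z(2) .
  qed
qed

text \<open>As for \<open>B_summand\<close>, with \<open>X 1 = X 0\<close>, which turns the sign
  condition into \<open>X 2 = Y\<close>.\<close>

lemma C_summand_unique:
  assumes fr: "frame g t K" and C: "type_A2 C" "C \<subseteq> E6_set g t" "2 *\<^sub>R (g 0 + g 1) \<in> C"
    and orth: "\<forall>x\<in>C. x \<bullet> (g 0 - g 1) = 0" "\<forall>x\<in>C. x \<bullet> (g 2 - g 3) = 0" "\<forall>x\<in>C. x \<bullet> (g 3 - g 4) = 0"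
  shows "C = C_summand g t"
proof -
  obtain z where z: "A2_pair (2 *\<^sub>R (g 0 + g 1)) z" "C = A2_set (2 *\<^sub>R (g 0 + g 1)) z" "z \<in> C"
    by (rule type_A2_neighbour[OF C(1,3)])
  have K: "K > 0" using frame_inner[OF fr] by simp
  obtain X Y where X: "z = fvec g t X Y" and
    c: "z \<in> D_set {..<5} g \<and> Y = 0 \<and> (\<forall>i<5. X i \<in> {0, 2, -2}) \<and> (\<Sum>i<5. X i * X i) = 8 \<or> spinor X Y"
    using E6_set_coords[of z g t] z(3) C(2) by blast
  have "X 0 * K - X 1 * K = 0" "X 2 * K - X 3 * K = 0" "X 3 * K - X 4 * K = 0"
    using bspec[OF orth(1) z(3)] bspec[OF orth(2) z(3)] bspec[OF orth(3) z(3)]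
    by (simp_all add: X inner_add_right inner_diff_right fvec_inner[OF fr])
  then have e: "X 1 = X 0" "X 3 = X 2" "X 4 = X 2" using K by (simp_all flip: distrib_right left_diff_distrib)
  have "(X 0 + X 1) * K = (-2) * K"
    using z(1) frame_inner(1,2)[OF fr]
    by (simp add: A2_pair_def X fvec_inner[OF fr] inner_add_left inner_add_right algebra_simps)
  then have "X 0 + X 1 = -2" by (rule scale_cancel[OF K])
  then have d: "X 0 = -1" using e(1) by simp
  then have sp: "spinor X Y" using c by (auto simp: all_less_5)
  then have Y: "Y \<in> {1, -1}" "X 2 \<in> {1, -1}" "X 2 * X 2 * X 2 = Y"
    using d e by (auto simp: spinor_def prod_lessThan_5)
  then have X2: "X 2 = Y" by auto
  have zX: "z = - g 0 - g 1 + Y *\<^sub>R (g 2 + g 3 + g 4) + Y *\<^sub>R t"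
    unfolding X fvec_def sum_lessThan_5 e d X2 by (simp add: algebra_simps)
  show ?thesis
  proof (cases "Y = 1")
    case True
    then have "z = t + (g 2 + g 3 + g 4) - (g 0 + g 1)" unfolding zX by simp
    then show ?thesis using z(2) by (simp add: C_summand_def)
  next
    case False
    then have "z = - (2 *\<^sub>R (g 0 + g 1) + (t + (g 2 + g 3 + g 4) - (g 0 + g 1)))" using Y(1) unfolding zX by (auto simp: scaleR_2)
    from A2_set_swap[OF this] show ?thesis unfolding C_summand_def z(2) .
  qed
qed

text \<open>The five indices are relabelled by the supports of the chosen roots, with signs that
  turn these roots into \<open>2 (g 0 - g 1)\<close>, \<open>2 (g 0 + g 1)\<close> and
  \<open>2 (g 2 - g 3)\<close>; then the uniqueness of the summands through these roots
  applies.\<close>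

lemma summands_3A2_aligned:
  assumes fr: "frame f t K" and ABC: "type_A2 A" "type_A2 B" "type_A2 C"
    "A \<subseteq> E6_set f t" "B \<subseteq> E6_set f t" "C \<subseteq> E6_set f t"
    and AB: "\<forall>x\<in>A. \<forall>y\<in>B. x \<bullet> y = 0" and AC: "\<forall>x\<in>A. \<forall>y\<in>C. x \<bullet> y = 0" and BC: "\<forall>x\<in>B. \<forall>y\<in>C. x \<bullet> y = 0"
    and lt: "i < 5" "j < 5" "k < 5" "l < 5" and dist: "distinct [i, j, k, l]"
    and sg: "s \<in> {1, -1}" "r \<in> {1, -1}" "p \<in> {1, -1}" "q \<in> {1, -1}"
    and mem: "2 *\<^sub>R (s *\<^sub>R f i + r *\<^sub>R f j) \<in> B" "2 *\<^sub>R (s *\<^sub>R f i - r *\<^sub>R f j) \<in> C" "2 *\<^sub>R (p *\<^sub>R f k + q *\<^sub>R f l) \<in> A"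
  shows "\<exists>g. frame_change f g \<and> {A, B, C} = {A_summand g, B_summand g t, C_summand g t}"
proof -
  have "card {i, j, k, l} < card {..<5::nat}" using card_insert_le_m1 dist by simp
  then obtain m where m: "m < 5" "m \<notin> {i, j, k, l}"
    by (metis card_mono finite_insert finite.emptyI lessThan_iff not_le subsetI)
  \<comment> \<open>The sign of the fifth vector is the one that makes the number of sign changes
    even.\<close>
  define g where "g n = [s *\<^sub>R f i, (- r) *\<^sub>R f j, p *\<^sub>R f k, (- q) *\<^sub>R f l, (s * r * p * q) *\<^sub>R f m] ! n" for n
  have gv: "g 0 = s *\<^sub>R f i" "g 1 = (- r) *\<^sub>R f j" "g 2 = p *\<^sub>R f k" "g 3 = (- q) *\<^sub>R f l" "g 4 = (s * r * p * q) *\<^sub>R f m"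
    by (simp_all add: g_def)
  have fg: "frame_change f g"
    by (rule frame_changeI[OF lt m(1) _ _ _ _ _ _ _ gv]) (use dist m(2) sg in auto)
  have fr_g: "frame g t K" by (rule frame_change_frame[OF fg fr])
  have E: "E6_set g t = E6_set f t" by (rule E6_set_frame_change[OF fg])
  have b: "2 *\<^sub>R (g 0 - g 1) \<in> B" and c: "2 *\<^sub>R (g 0 + g 1) \<in> C" and a: "2 *\<^sub>R (g 2 - g 3) \<in> A"
    using mem by (simp_all add: gv del: One_nat_def)
  have half: "x \<bullet> v = 0" if "x \<bullet> (2 *\<^sub>R v) = 0" for x v :: 'a using that by simp
  have Ab: "x \<bullet> (g 0 - g 1) = 0" "x \<bullet> (g 0 + g 1) = 0" if "x \<in> A" for x
    using half AB AC b c that by blast+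
  have A01: "\<forall>x\<in>A. x \<bullet> g 0 = 0" "\<forall>x\<in>A. x \<bullet> g 1 = 0"
    using Ab by (fastforce simp: inner_diff_right inner_add_right)+
  have Bc: "\<forall>x\<in>B. x \<bullet> (g 0 + g 1) = 0" "\<forall>x\<in>C. x \<bullet> (g 0 - g 1) = 0"
    using half BC b c by (blast, metis inner_commute)
  have BA: "x \<bullet> v = 0" if "x \<in> B \<or> x \<in> C" "2 *\<^sub>R v \<in> A" for x v
    using half AB AC that by (metis inner_commute)
  consider "A = A_summand g" | "A = A_summand (g(1 := - g 1, 4 := - g 4))"
    using A_summand_cases[OF fr_g ABC(1) _ a A01] ABC(4) E by auto
  then show ?thesis
  proof cases
    case 1
    have "2 *\<^sub>R (g 3 - g 4) \<in> A" by (simp add: 1 A_summand_def A2_set_def)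
    then have o: "\<forall>x\<in>B. x \<bullet> (g 2 - g 3) = 0" "\<forall>x\<in>B. x \<bullet> (g 3 - g 4) = 0" "\<forall>x\<in>C. x \<bullet> (g 2 - g 3) = 0" "\<forall>x\<in>C. x \<bullet> (g 3 - g 4) = 0"
      using BA a by blast+
    have "B = B_summand g t" using ABC(5) E by (intro B_summand_unique[OF fr_g ABC(2) _ b Bc(1) o(1,2)]) simp
    moreover have "C = C_summand g t" using ABC(6) E by (intro C_summand_unique[OF fr_g ABC(3) _ c Bc(2) o(3,4)]) simp
    ultimately show ?thesis using fg 1 by blast
  next
    case 2
    \<comment> \<open>Negating \<open>g 1\<close> exchanges \<open>2 (g 0 - g 1)\<close> and
      \<open>2 (g 0 + g 1)\<close>, so \<open>B\<close> and \<open>C\<close> exchange their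
      roles.\<close>
    define h where "h = g(1 := - g 1, 4 := - g 4)"
    have hv: "h 0 = g 0" "h 1 = - g 1" "h 2 = g 2" "h 3 = g 3" "h 4 = - g 4" by (simp_all add: h_def)
    have gh: "frame_change g h"
      by (rule frame_changeI[of 0 1 2 3 4 1 "-1" 1 1 "-1"]) (simp_all add: hv del: One_nat_def)
    then have fh: "frame_change f h" using fg frame_change_trans by blast
    have fr_h: "frame h t K" by (rule frame_change_frame[OF fh fr])
    have Eh: "E6_set h t = E6_set f t" by (rule E6_set_frame_change[OF fh])
    have "2 *\<^sub>R (h 3 - h 4) \<in> A" by (simp add: 2 A_summand_def A2_set_def h_def)
    moreover have "2 *\<^sub>R (h 2 - h 3) \<in> A" using a by (simp add: hv)
    ultimately have o: "\<forall>x\<in>B. x \<bullet> (h 2 - h 3) = 0" "\<forall>x\<in>B. x \<bullet> (h 3 - h 4) = 0" "\<forall>x\<in>C. x \<bullet> (h 2 - h 3) = 0" "\<forall>x\<in>C. x \<bullet> (h 3 - h 4) = 0"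
      using BA by blast+
    have Bc': "\<forall>x\<in>C. x \<bullet> (h 0 + h 1) = 0" "\<forall>x\<in>B. x \<bullet> (h 0 - h 1) = 0" and bc': "2 *\<^sub>R (h 0 + h 1) \<in> B" "2 *\<^sub>R (h 0 - h 1) \<in> C"
      using Bc b c by (simp_all add: hv del: One_nat_def)
    have "B = C_summand h t" using ABC(5) Eh by (intro C_summand_unique[OF fr_h ABC(2) _ bc'(1) Bc'(2) o(1,2)]) simp
    moreover have "C = B_summand h t" using ABC(6) Eh by (intro B_summand_unique[OF fr_h ABC(3) _ bc'(2) Bc'(1) o(3,4)]) simp
    ultimately show ?thesis using fh 2 unfolding h_def[symmetric] by blast
  qed
qed

section \<open>Index supports of orthogonal roots of \<open>D5\<close>\<close>

definition D_rep :: "(nat \<Rightarrow> 'a::euclidean_space) \<Rightarrow> 'a \<Rightarrow> nat \<Rightarrow> nat \<Rightarrow> real \<Rightarrow> real \<Rightarrow> bool" where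
  "D_rep f x i j s r \<longleftrightarrow> x = 2 *\<^sub>R (s *\<^sub>R f i + r *\<^sub>R f j) \<and> i < 5 \<and> j < 5 \<and> i \<noteq> j \<and> s \<in> {1, -1} \<and> r \<in> {1, -1}"

lemma D_rep_exists: "x \<in> D_set {..<5} f \<Longrightarrow> \<exists>i j s r. D_rep f x i j s r"
  unfolding D_set_def D_rep_def by blast

text \<open>If two such roots share exactly one index, that index alone contributes to the pairing,
  which is then not 0.\<close>

lemma D_rep_orthogonal:
  assumes o: "orthogonal_family {..<5} f K" and x: "D_rep f x i j s r" and y: "D_rep f y k l p q" and "x \<bullet> y = 0"
  shows "{i, j} \<inter> {k, l} = {} \<or> {i, j} = {k, l}"
proof -
  have K: "K > 0" and ff: "\<And>i j. i < 5 \<Longrightarrow> j < 5 \<Longrightarrow> f i \<bullet> f j = (if i = j then K else 0)"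
    using o by (auto simp: orthogonal_family_def)
  have "(s *\<^sub>R f i + r *\<^sub>R f j) \<bullet> (p *\<^sub>R f k + q *\<^sub>R f l) = 0" using assms by (simp add: D_rep_def)
  then show ?thesis
    using x y K unfolding D_rep_def by (auto simp: inner_add_left inner_add_right ff split: if_splits)
qed

lemma D_rep_orthogonal_same:
  assumes o: "orthogonal_family {..<5} f K" and x: "D_rep f x i j s r" and y: "D_rep f y k l p q" and "x \<bullet> y = 0"
    and same: "{i, j} = {k, l}"
  shows "y = 2 *\<^sub>R (s *\<^sub>R f i - r *\<^sub>R f j) \<or> y = - (2 *\<^sub>R (s *\<^sub>R f i - r *\<^sub>R f j))"
proof -
  have K: "K > 0" and ff: "\<And>i j. i < 5 \<Longrightarrow> j < 5 \<Longrightarrow> f i \<bullet> f j = (if i = j then K else 0)"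
    using o by (auto simp: orthogonal_family_def)
  have *: "y = 2 *\<^sub>R (s *\<^sub>R f i - r *\<^sub>R f j) \<or> y = - (2 *\<^sub>R (s *\<^sub>R f i - r *\<^sub>R f j))" if y: "D_rep f y i j p q" for p q
  proof -
    have "(s *\<^sub>R f i + r *\<^sub>R f j) \<bullet> (p *\<^sub>R f i + q *\<^sub>R f j) = 0" using assms(4) x y by (simp add: D_rep_def)
    then have "(s * p + r * q) * K = 0" using x unfolding D_rep_def by (auto simp: inner_add_left inner_add_right ff algebra_simps)
    then have "s * p + r * q = 0" using K by simp
    then have "p = s \<and> q = - r \<or> p = - s \<and> q = r" using x y by (auto simp: D_rep_def)
    then show ?thesis using y by (auto simp: D_rep_def algebra_simps)
  qed
  have "k = i \<and> l = j \<or> k = j \<and> l = i" using same by (auto simp: doubleton_eq_iff)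
  then have "D_rep f y i j p q \<or> D_rep f y i j q p" using y by (auto simp: D_rep_def add.commute)
  then show ?thesis using * by blast
qed

lemma summands_3A2_same_support:
  assumes fr: "frame f t K" and ABC: "type_A2 A" "type_A2 B" "type_A2 C"
    "A \<subseteq> E6_set f t" "B \<subseteq> E6_set f t" "C \<subseteq> E6_set f t"
    and AB: "\<forall>x\<in>A. \<forall>y\<in>B. x \<bullet> y = 0" and AC: "\<forall>x\<in>A. \<forall>y\<in>C. x \<bullet> y = 0" and BC: "\<forall>x\<in>B. \<forall>y\<in>C. x \<bullet> y = 0"
    and a: "a \<in> A" "D_rep f a k l p q" and b: "b \<in> B" "D_rep f b i j s r" and c: "c \<in> C" "D_rep f c i' j' s' r'"
    and same: "{i, j} = {i', j'}"
  shows "\<exists>g. frame_change f g \<and> {A, B, C} = {A_summand g, B_summand g t, C_summand g t}"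
proof -
  have o: "orthogonal_family {..<5} f K" using fr by (simp add: frame_def)
  have K: "K > 0" using o by (auto simp: orthogonal_family_def)
  have bc: "b \<bullet> c = 0" "a \<bullet> b = 0" "a \<bullet> c = 0" "b \<bullet> a = 0" using AB AC BC a b c by (auto simp: inner_commute)
  let ?c = "2 *\<^sub>R (s *\<^sub>R f i - r *\<^sub>R f j)"
  have c': "c = ?c \<or> c = - ?c" by (rule D_rep_orthogonal_same[OF o b(2) c(2) bc(1) same])
  then have cC: "?c \<in> C" using c(1) type_A2_neg[OF ABC(3) c(1)] by auto
  \<comment> \<open>Up to sign, \<open>c\<close> is the only root with the support of
    \<open>b\<close> that is orthogonal to \<open>b\<close>; a root of \<open>A\<close> with this
    support would be \<open>c\<close> or \<open>- c\<close>, although it is orthogonal to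
    \<open>c\<close>.\<close>
  have "{i, j} \<noteq> {k, l}"
  proof
    assume "{i, j} = {k, l}"
    from D_rep_orthogonal_same[OF o b(2) a(2) bc(4) this] c' have "a = c \<or> a = - c" by auto
    then have "a \<bullet> a = 0" using bc(3) by auto
    moreover have "a \<bullet> a = 8 * K" using E6_set_length[OF fr] a(1) ABC(4) by blast
    ultimately show False using K by simp
  qed
  then have dis: "{i, j} \<inter> {k, l} = {}" using D_rep_orthogonal[OF o b(2) a(2) bc(4)] by blast
  show ?thesis
    by (rule summands_3A2_aligned[OF fr ABC AB AC BC, of i j k l s r p q])
      (use a b cC dis in \<open>auto simp: D_rep_def\<close>)
qed

lemma summands_3A2_classification:
  assumes fr: "frame f t K" and F: "has_summands 3 type_A2 F S" and sub: "S \<subseteq> E6_set f t"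
  shows "\<exists>g. frame_change f g \<and> F = {A_summand g, B_summand g t, C_summand g t}"
proof -
  obtain A B C where ABC: "F = {A, B, C}" "A \<noteq> B" "A \<noteq> C" "B \<noteq> C"
    using F by (auto simp: has_summands_def card_3_iff)
  have ty: "type_A2 A" "type_A2 B" "type_A2 C" and su: "A \<subseteq> E6_set f t" "B \<subseteq> E6_set f t" "C \<subseteq> E6_set f t"
    using F sub ABC by (auto simp: has_summands_def)
  have orth: "\<forall>x\<in>A. \<forall>y\<in>B. x \<bullet> y = 0" "\<forall>x\<in>A. \<forall>y\<in>C. x \<bullet> y = 0" "\<forall>x\<in>B. \<forall>y\<in>C. x \<bullet> y = 0"
    "\<forall>x\<in>B. \<forall>y\<in>A. x \<bullet> y = 0" "\<forall>x\<in>C. \<forall>y\<in>A. x \<bullet> y = 0" "\<forall>x\<in>C. \<forall>y\<in>B. x \<bullet> y = 0"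
    using F ABC unfolding has_summands_def by blast+
  have o: "orthogonal_family {..<5} f K" using fr by (simp add: frame_def)
  obtain a where a: "a \<in> A" "a \<in> D_set {..<5} f" by (rule type_A2_meets_D_set[OF fr ty(1) su(1)])
  obtain b where b: "b \<in> B" "b \<in> D_set {..<5} f" by (rule type_A2_meets_D_set[OF fr ty(2) su(2)])
  obtain c where c: "c \<in> C" "c \<in> D_set {..<5} f" by (rule type_A2_meets_D_set[OF fr ty(3) su(3)])
  obtain i j s r where ra: "D_rep f a i j s r" using D_rep_exists[OF a(2)] by blast
  obtain i' j' s' r' where rb: "D_rep f b i' j' s' r'" using D_rep_exists[OF b(2)] by blast
  obtain i'' j'' s'' r'' where rc: "D_rep f c i'' j'' s'' r''" using D_rep_exists[OF c(2)] by blast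
  have ab: "{i, j} \<inter> {i', j'} = {} \<or> {i, j} = {i', j'}"
    using orth(1) a(1) b(1) by (intro D_rep_orthogonal[OF o ra rb]) blast
  have ac: "{i, j} \<inter> {i'', j''} = {} \<or> {i, j} = {i'', j''}"
    using orth(2) a(1) c(1) by (intro D_rep_orthogonal[OF o ra rc]) blast
  have bc: "{i', j'} \<inter> {i'', j''} = {} \<or> {i', j'} = {i'', j''}"
    using orth(3) b(1) c(1) by (intro D_rep_orthogonal[OF o rb rc]) blast
  have "\<not> ({i, j} \<inter> {i', j'} = {} \<and> {i, j} \<inter> {i'', j''} = {} \<and> {i', j'} \<inter> {i'', j''} = {})"
  proof
    assume dis: "{i, j} \<inter> {i', j'} = {} \<and> {i, j} \<inter> {i'', j''} = {} \<and> {i', j'} \<inter> {i'', j''} = {}"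
    have "card {i, j, i', j', i'', j''} = 6" using dis ra rb rc by (auto simp: D_rep_def)
    moreover have "card {i, j, i', j', i'', j''} \<le> card {..<5::nat}"
      using ra rb rc by (intro card_mono) (auto simp: D_rep_def)
    ultimately show False by simp
  qed
  then have "{i', j'} = {i'', j''} \<or> {i, j} = {i', j'} \<or> {i, j} = {i'', j''}" using ab ac bc by argo
  \<comment> \<open>In each case the summand outside the coinciding pair takes the role of
    \<open>A\<close>.\<close>
  then consider "{i', j'} = {i'', j''}" | "{i, j} = {i', j'}" | "{i, j} = {i'', j''}" by argo
  then show ?thesis
  proof cases
    case 1
    show ?thesis unfolding ABC(1)
      by (rule summands_3A2_same_support[OF fr ty su orth(1,2,3) a(1) ra b(1) rb c(1) rc 1])
  next
    case 2
    have "\<exists>g. frame_change f g \<and> {C, A, B} = {A_summand g, B_summand g t, C_summand g t}"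
      by (rule summands_3A2_same_support[OF fr ty(3,1,2) su(3,1,2) orth(5,6,1) c(1) rc a(1) ra b(1) rb 2])
    then show ?thesis unfolding ABC(1) by (simp add: insert_commute)
  next
    case 3
    have "\<exists>g. frame_change f g \<and> {B, A, C} = {A_summand g, B_summand g t, C_summand g t}"
      by (rule summands_3A2_same_support[OF fr ty(2,1,3) su(2,1,3) orth(4,3,2) b(1) rb a(1) ra c(1) rc 3])
    then show ?thesis unfolding ABC(1) by (simp add: insert_commute)
  qed
qed

section \<open>Realisation of the normal form inside \<open>E6\<close>\<close>

lemma spinor_memI:
  assumes "c0 \<in> {1, -1}" "c1 \<in> {1, -1}" "c2 \<in> {1, -1}" "c3 \<in> {1, -1}" "c4 \<in> {1, -1::real}" "c0 * c1 * c2 * c3 * c4 = 1"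
    and "v = c0 *\<^sub>R g 0 + c1 *\<^sub>R g 1 + c2 *\<^sub>R g 2 + c3 *\<^sub>R g 3 + c4 *\<^sub>R g 4 + t"
  shows "v \<in> E6_set g t"
proof -
  define x where "x n = [c0, c1, c2, c3, c4] ! n" for n
  have xv: "x 0 = c0" "x 1 = c1" "x 2 = c2" "x 3 = c3" "x 4 = c4" by (simp_all add: x_def)
  have "spinor x 1" unfolding spinor_def all_less_5 prod_lessThan_5 xv using assms by simp
  moreover have "v = fvec g t x 1" unfolding fvec_def sum_lessThan_5 xv assms(7) by simp
  ultimately show ?thesis unfolding E6_set_def by blast
qed

lemma E6_set_neg:
  assumes "x \<in> E6_set f t"
  shows "- x \<in> E6_set f t"
proof (cases "x \<in> D_set {..<5} f")
  case True
  then show ?thesis using D_set_neg by (auto simp: E6_set_def)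
next
  case False
  then obtain X Y where x: "x = fvec f t X Y" and sp: "spinor X Y" using assms by (auto simp: E6_set_def)
  have "spinor (\<lambda>i. - X i) (- Y)" using sp by (auto simp: spinor_def prod_lessThan_5)
  then show ?thesis unfolding x fvec_minus E6_set_def by blast
qed

lemma A2_set_orthogonal:
  assumes "x \<bullet> z = 0" "x \<bullet> w = 0" "y \<bullet> z = 0" "y \<bullet> w = 0"
  shows "\<forall>u\<in>A2_set x y. \<forall>v\<in>A2_set z w. u \<bullet> v = 0"
  using assms by (auto simp: A2_set_def inner_add_left inner_add_right inner_diff_left inner_diff_right)

lemma summand_pairs:
  assumes fr: "frame g t K"
  shows "A2_pair (2 *\<^sub>R (g 2 - g 3)) (2 *\<^sub>R (g 3 - g 4))"
    "A2_pair (2 *\<^sub>R (g 0 - g 1)) (t - (g 2 + g 3 + g 4) - (g 0 - g 1))"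
    "A2_pair (2 *\<^sub>R (g 0 + g 1)) (t + (g 2 + g 3 + g 4) - (g 0 + g 1))"
proof -
  have K: "K > 0" by (rule frame_inner[OF fr])
  have nz: "v \<noteq> 0" if "v \<bullet> v = 8 * K" for v :: 'a using that K by auto
  note [simp] = frame_inner(2-5)[OF fr] inner_add_left inner_add_right inner_diff_left inner_diff_right
  have "2 *\<^sub>R (g 2 - g 3) \<noteq> 0" "2 *\<^sub>R (g 0 - g 1) \<noteq> 0" "2 *\<^sub>R (g 0 + g 1) \<noteq> 0"
    by (rule nz; simp)+
  then show "A2_pair (2 *\<^sub>R (g 2 - g 3)) (2 *\<^sub>R (g 3 - g 4))"
    "A2_pair (2 *\<^sub>R (g 0 - g 1)) (t - (g 2 + g 3 + g 4) - (g 0 - g 1))"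
    "A2_pair (2 *\<^sub>R (g 0 + g 1)) (t + (g 2 + g 3 + g 4) - (g 0 + g 1))"
    unfolding A2_pair_def by simp_all
qed

lemma summands_orthogonal:
  assumes fr: "frame g t K"
  shows "\<forall>x\<in>A_summand g. \<forall>y\<in>B_summand g t. x \<bullet> y = 0" "\<forall>x\<in>A_summand g. \<forall>y\<in>C_summand g t. x \<bullet> y = 0"
    "\<forall>x\<in>B_summand g t. \<forall>y\<in>C_summand g t. x \<bullet> y = 0"
  unfolding A_summand_def B_summand_def C_summand_def
  by (rule A2_set_orthogonal; simp add: frame_inner[OF fr] inner_add_left inner_add_right inner_diff_left inner_diff_right)+

lemma summands_disjoint:
  assumes fr: "frame g t K"
  shows "A_summand g \<inter> B_summand g t = {}" "A_summand g \<inter> C_summand g t = {}" "B_summand g t \<inter> C_summand g t = {}"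
proof -
  have nz: "0 \<notin> A_summand g" "0 \<notin> B_summand g t"
    using summand_pairs[OF fr] A2_pair_type_A2 unfolding A_summand_def B_summand_def type_A2_def has_dynkin_type_def root_system_def
    by blast+
  show "A_summand g \<inter> B_summand g t = {}" "A_summand g \<inter> C_summand g t = {}" "B_summand g t \<inter> C_summand g t = {}"
    using summands_orthogonal[OF fr] nz by (metis disjoint_iff inner_eq_zero_iff)+
qed

lemma summands_has_summands:
  assumes fr: "frame g t K"
  shows "has_summands 3 type_A2 {A_summand g, B_summand g t, C_summand g t} (A_summand g \<union> B_summand g t \<union> C_summand g t)"
proof -
  have ne: "A_summand g \<noteq> {}" "B_summand g t \<noteq> {}" by (auto simp: A_summand_def B_summand_def A2_set_def)
  then have dist: "A_summand g \<noteq> B_summand g t" "A_summand g \<noteq> C_summand g t" "B_summand g t \<noteq> C_summand g t"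
    using summands_disjoint[OF fr] by auto
  have "type_A2 (A_summand g)" "type_A2 (B_summand g t)" "type_A2 (C_summand g t)"
    unfolding A_summand_def B_summand_def C_summand_def using summand_pairs[OF fr] by (auto intro: A2_pair_type_A2)
  moreover have "\<forall>X\<in>{A_summand g, B_summand g t, C_summand g t}. \<forall>Y\<in>{A_summand g, B_summand g t, C_summand g t}.
      X \<noteq> Y \<longrightarrow> (\<forall>x\<in>X. \<forall>y\<in>Y. x \<bullet> y = 0)"
  proof -
    note o = summands_orthogonal[OF fr]
    have "\<forall>x\<in>B_summand g t. \<forall>y\<in>A_summand g. x \<bullet> y = 0" "\<forall>x\<in>C_summand g t. \<forall>y\<in>A_summand g. x \<bullet> y = 0"
      "\<forall>x\<in>C_summand g t. \<forall>y\<in>B_summand g t. x \<bullet> y = 0"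
      using o inner_commute by metis+
    with o show ?thesis by blast
  qed
  ultimately show ?thesis using dist unfolding has_summands_def by auto
qed

lemma summands_subset:
  assumes fr: "frame g t K"
  shows "A_summand g \<union> B_summand g t \<union> C_summand g t \<subseteq> E6_set g t"
proof -
  have sub: "A2_set x y \<subseteq> E6_set g t" if "x \<in> E6_set g t" "y \<in> E6_set g t" "x + y \<in> E6_set g t" for x y
    using that E6_set_neg unfolding A2_set_def by blast
  have D: "2 *\<^sub>R (g i - g j) \<in> E6_set g t" "2 *\<^sub>R (g i + g j) \<in> E6_set g t" if "i < 5" "j < 5" "i \<noteq> j" for i j
    using D_set_memI[of i "{..<5}" j g] that by (auto simp: E6_set_def)
  have "A_summand g \<subseteq> E6_set g t"
    unfolding A_summand_def
  proof (rule sub)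
    have "2 *\<^sub>R (g 2 - g 3) + 2 *\<^sub>R (g 3 - g 4) = 2 *\<^sub>R (g 2 - g 4)" by (simp add: algebra_simps)
    then show "2 *\<^sub>R (g 2 - g 3) + 2 *\<^sub>R (g 3 - g 4) \<in> E6_set g t" using D by simp
  qed (use D in simp_all)
  moreover have "B_summand g t \<subseteq> E6_set g t"
    unfolding B_summand_def
  proof (rule sub)
    show "t - (g 2 + g 3 + g 4) - (g 0 - g 1) \<in> E6_set g t"
      by (rule spinor_memI[of "-1" 1 "-1" "-1" "-1"]) (simp_all add: algebra_simps)
    show "2 *\<^sub>R (g 0 - g 1) + (t - (g 2 + g 3 + g 4) - (g 0 - g 1)) \<in> E6_set g t"
      by (rule spinor_memI[of 1 "-1" "-1" "-1" "-1"]) (simp_all add: scaleR_2)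
  qed (use D in simp_all)
  moreover have "C_summand g t \<subseteq> E6_set g t"
    unfolding C_summand_def
  proof (rule sub)
    show "t + (g 2 + g 3 + g 4) - (g 0 + g 1) \<in> E6_set g t"
      by (rule spinor_memI[of "-1" "-1" 1 1 1]) (simp_all add: algebra_simps)
    show "2 *\<^sub>R (g 0 + g 1) + (t + (g 2 + g 3 + g 4) - (g 0 + g 1)) \<in> E6_set g t"
      by (rule spinor_memI[of 1 1 1 1 1]) (simp_all add: scaleR_2)
  qed (use D in simp_all)
  ultimately show ?thesis by blast
qed

section \<open>Discriminants and crosses as polynomials\<close>

text \<open>The discriminant of the normal form up to the factor 32 and sign, with
  \<open>k, l, u, v, w\<close> for \<open>g 0\<close>, ..., \<open>g 4\<close>. The first factor
  comes from the \<open>D5\<close>-roots of \<open>B_summand\<close> and \<open>C_summand\<close>,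
  the Vandermonde product from \<open>A_summand\<close>, the two differences of squares from the
  four positive roots involving \<open>t\<close>.\<close>

definition coble_poly :: "'b::comm_ring_1 \<Rightarrow> 'b \<Rightarrow> 'b \<Rightarrow> 'b \<Rightarrow> 'b \<Rightarrow> 'b \<Rightarrow> 'b" where
  "coble_poly k l u v w t = (k ^ 2 - l ^ 2) * ((u - v) * (u - w) * (v - w) *
     (((t - (u + v + w)) ^ 2 - (k - l) ^ 2) * ((t + (u + v + w)) ^ 2 - (k + l) ^ 2)))"

text \<open>What remains of a cross after division by \<open>k^2 - l^2\<close> and
  \<open>u^2 - v^2\<close>; it comes out of the computation in \<open>coble_poly_reflect\<close>.
  Although the cross singles out two pairs of variables, this factor is symmetric in
  \<open>k, l, u, v\<close>, so it is common to all crosses with the same \<open>w\<close>.\<close>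

definition cross_factor :: "'b::comm_ring_1 \<Rightarrow> 'b \<Rightarrow> 'b \<Rightarrow> 'b \<Rightarrow> 'b \<Rightarrow> 'b \<Rightarrow> 'b" where
  "cross_factor k l u v w t = 16 * t * (k * l * u * v) -
     2 * w * (t ^ 4 - 2 * t ^ 2 * (k ^ 2 + l ^ 2 + u ^ 2 + v ^ 2 - w ^ 2) + 2 * w ^ 2 * (k ^ 2 + l ^ 2 + u ^ 2 + v ^ 2)
       - 3 * w ^ 4 + 2 * (k ^ 4 + l ^ 4 + u ^ 4 + v ^ 4) - (k ^ 2 + l ^ 2 + u ^ 2 + v ^ 2) ^ 2)"

definition cross_poly :: "'b::comm_ring_1 \<Rightarrow> 'b \<Rightarrow> 'b \<Rightarrow> 'b \<Rightarrow> 'b \<Rightarrow> 'b \<Rightarrow> 'b" where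
  "cross_poly k l u v w t = (k ^ 2 - l ^ 2) * ((u ^ 2 - v ^ 2) * cross_factor k l u v w t)"

text \<open>With \<open>q = u + v + w\<close>, the product of the two last factors of the discriminant is a quartic in \<open>q\<close>
  without cubic term, so that identities between discriminants and crosses can be checked on the powers of \<open>q\<close>.\<close>

definition quartic :: "'b::comm_ring_1 \<Rightarrow> 'b \<Rightarrow> 'b \<Rightarrow> 'b \<Rightarrow> 'b" where
  "quartic k l t q = q ^ 4 - 2 * (t ^ 2 + k ^ 2 + l ^ 2) * q ^ 2 + 8 * t * (k * l) * q + (t ^ 4 - 2 * (k ^ 2 + l ^ 2) * t ^ 2 + (k ^ 2 - l ^ 2) ^ 2)"

lemma quartic_eq: "((t - q) ^ 2 - (k - l) ^ 2) * ((t + q) ^ 2 - (k + l) ^ 2) = quartic k l t q"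
  unfolding quartic_def by (simp add: power2_eq_square power4_eq_xxxx algebra_simps)

text \<open>The coefficients of \<open>quartic\<close> do not involve \<open>q\<close>, so a
  combination of its values at different points is determined by the moments of order 0, 1, 2 and 4.
  In the applications these are polynomials in \<open>u, v, w\<close> alone.\<close>

lemma quartic_combination:
  "x * quartic k l t q - y * quartic k l t r = (x * q ^ 4 - y * r ^ 4) - 2 * (t ^ 2 + k ^ 2 + l ^ 2) * (x * q ^ 2 - y * r ^ 2) +
     8 * t * (k * l) * (x * q - y * r) + (t ^ 4 - 2 * (k ^ 2 + l ^ 2) * t ^ 2 + (k ^ 2 - l ^ 2) ^ 2) * (x - y)"
proof -
  have "x * (q4 - a * q2 + b * q + c) - y * (r4 - a * r2 + b * r + c) = (x * q4 - y * r4) - a * (x * q2 - y * r2) + b * (x * q - y * r) + c * (x - y)"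
    for a b c q4 q2 r4 r2 by (simp add: algebra_simps)
  then show ?thesis unfolding quartic_def .
qed

lemma quartic_sum:
  assumes "x * (q ^ 4) + y * (r ^ 4) + z * (s ^ 4) = d * p ^ 4" "x * (q ^ 2) + y * (r ^ 2) + z * (s ^ 2) = d * p ^ 2"
    "x * q + y * r + z * s = d * p" "x + y + z = d"
  shows "x * quartic k l t q + y * quartic k l t r + z * quartic k l t s = d * quartic k l t p"
proof -
  have "x * (q4 - a * q2 + b * q + c) + y * (r4 - a * r2 + b * r + c) + z * (s4 - a * s2 + b * s + c) =
    (x * q4 + y * r4 + z * s4) - a * (x * q2 + y * r2 + z * s2) + b * (x * q + y * r + z * s) + c * (x + y + z)"
    for a b c q4 q2 r4 r2 s4 s2 by (simp add: algebra_simps)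
  moreover have "d * p4 - a * (d * p2) + b * (d * p) + c * d = d * (p4 - a * p2 + b * p + c)" for a b c p4 p2
    by (simp add: algebra_simps)
  ultimately show ?thesis unfolding quartic_def by (simp only: assms)
qed

lemma coble_poly_quartic:
  "coble_poly k l u v w t = (k ^ 2 - l ^ 2) * ((u - v) * ((u - w) * (v - w) * quartic k l t (u + v + w)))"
  unfolding coble_poly_def quartic_eq by (simp only: mult.assoc)

text \<open>Exchanging \<open>u\<close> and \<open>v\<close> with both signs changed is the effect
  of the reflection in \<open>2 (g 2 + g 3)\<close>; the factor \<open>u - v\<close> is
  invariant.\<close>

lemma coble_poly_flip:
  "coble_poly k l (- v) (- u) w t = (k ^ 2 - l ^ 2) * ((u - v) * ((u + w) * (v + w) * quartic k l t (w - u - v)))"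
proof -
  have "- v - - u = u - v" "(- v - w) * (- u - w) = (u + w) * (v + w)" "- v + - u + w = w - u - v"
    by (simp_all add: algebra_simps)
  then show ?thesis unfolding coble_poly_quartic by (simp only:)
qed

text \<open>This and the next three facts are the moments for the reflection. In each of them the
  two terms on the left agree when \<open>v = - u\<close>, whence the factor \<open>u + v\<close>,
  which belongs to the reflecting root.\<close>

lemma reflect_power_0:
  fixes u v w :: "'b::comm_ring_1"
  shows "(u - w) * (v - w) - (u + w) * (v + w) = (u + v) * (- 2 * w)"
  by (simp add: algebra_simps)

lemma reflect_power_1:
  fixes u v w :: "'b::comm_ring_1"
  shows "(u - w) * (v - w) * (u + v + w) - (u + w) * (v + w) * (w - u - v) = (u + v) * (2 * (u * v))"
  by (simp add: algebra_simps)

lemma reflect_power_2: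
  fixes u v w :: "'b::comm_ring_1"
  shows "(u - w) * (v - w) * (u + v + w) ^ 2 - (u + w) * (v + w) * (w - u - v) ^ 2 =
    (u + v) * (2 * w * (w ^ 2 - u ^ 2 - v ^ 2))"
  by (simp add: power2_eq_square algebra_simps)

lemma reflect_power_4:
  fixes u v w :: "'b::comm_ring_1"
  shows "(u - w) * (v - w) * (u + v + w) ^ 4 - (u + w) * (v + w) * (w - u - v) ^ 4 =
    (u + v) * (2 * w * (3 * w ^ 4 - 2 * w ^ 2 * (u ^ 2 + v ^ 2) - (u ^ 2 - v ^ 2) ^ 2))"
  by (simp add: power2_eq_square power4_eq_xxxx algebra_simps)

text \<open>After \<open>u - v\<close> is split off, a difference of two values of
  \<open>quartic\<close> remains; its four moments contribute the factor \<open>u + v\<close>, which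
  completes \<open>u^2 - v^2\<close>.\<close>

lemma coble_poly_reflect:
  fixes k l u v w t :: "'b::comm_ring_1"
  shows "coble_poly k l u v w t - coble_poly k l (- v) (- u) w t = cross_poly k l u v w t"
proof -
  have "(u + v) * r4 - a * ((u + v) * r2) + b * ((u + v) * r1) + c * ((u + v) * r0) = (u + v) * (r4 - a * r2 + b * r1 + c * r0)"
    for a b c r0 r1 r2 r4 by (simp add: algebra_simps)
  then have "(u - w) * (v - w) * quartic k l t (u + v + w) - (u + w) * (v + w) * quartic k l t (w - u - v) =
    (u + v) * (2 * w * (3 * w ^ 4 - 2 * w ^ 2 * (u ^ 2 + v ^ 2) - (u ^ 2 - v ^ 2) ^ 2) -
      2 * (t ^ 2 + k ^ 2 + l ^ 2) * (2 * w * (w ^ 2 - u ^ 2 - v ^ 2)) + 8 * t * (k * l) * (2 * (u * v)) +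
      (t ^ 4 - 2 * (k ^ 2 + l ^ 2) * t ^ 2 + (k ^ 2 - l ^ 2) ^ 2) * (- 2 * w))"
    unfolding quartic_combination reflect_power_0 reflect_power_1 reflect_power_2 reflect_power_4 by blast
  also have "\<dots> = (u + v) * cross_factor k l u v w t"
    unfolding cross_factor_def by (simp add: power2_eq_square power4_eq_xxxx algebra_simps)
  finally have "(u - v) * ((u - w) * (v - w) * quartic k l t (u + v + w)) - (u - v) * ((u + w) * (v + w) * quartic k l t (w - u - v)) =
    (u - v) * ((u + v) * cross_factor k l u v w t)"
    by (simp only: right_diff_distrib[symmetric])
  also have "\<dots> = (u ^ 2 - v ^ 2) * cross_factor k l u v w t"
    by (simp add: power2_eq_square algebra_simps)
  finally show ?thesis
    unfolding coble_poly_flip unfolding coble_poly_quartic cross_poly_def by (simp only: right_diff_distrib[symmetric])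
qed

text \<open>Moments for the sum of the three images of a discriminant under the reflections in
  \<open>2 (g 2 + g 3)\<close>, \<open>2 (g 3 + g 4)\<close> and \<open>2 (g 4 + g 2)\<close>; each
  sum reproduces the moment of the discriminant itself.\<close>

lemma cyclic_power:
  fixes u v w :: "'b::comm_ring_1"
  shows "(u - v) * ((u + w) * (v + w)) + (v - w) * ((v + u) * (w + u)) + (w - u) * ((w + v) * (u + v)) = (u - v) * (u - w) * (v - w)"
    "(u - v) * ((u + w) * (v + w) * (w - u - v)) + (v - w) * ((v + u) * (w + u) * (u - v - w)) + (w - u) * ((w + v) * (u + v) * (v - w - u)) =
      (u - v) * (u - w) * (v - w) * (u + v + w)"
    "(u - v) * ((u + w) * (v + w) * (w - u - v) ^ 2) + (v - w) * ((v + u) * (w + u) * (u - v - w) ^ 2) + (w - u) * ((w + v) * (u + v) * (v - w - u) ^ 2) =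
      (u - v) * (u - w) * (v - w) * (u + v + w) ^ 2"
    "(u - v) * ((u + w) * (v + w) * (w - u - v) ^ 4) + (v - w) * ((v + u) * (w + u) * (u - v - w) ^ 4) + (w - u) * ((w + v) * (u + v) * (v - w - u) ^ 4) =
      (u - v) * (u - w) * (v - w) * (u + v + w) ^ 4"
  by (simp_all add: power2_eq_square power4_eq_xxxx algebra_simps)

text \<open>The three crosses add up to three times the discriminant, which is invariant under
  cyclic shifts of \<open>u, v, w\<close>, minus the three reflected discriminants. By
  \<open>cyclic_power\<close> the latter add up to the discriminant once.\<close>

lemma coble_poly_eq_crosses:
  fixes k l u v w t :: "'b::comm_ring_1"
  shows "2 * coble_poly k l u v w t =
    cross_poly k l u v w t + cross_poly k l v w u t + cross_poly k l w u v t"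
proof -
  let ?F = "coble_poly k l u v w t"
  have c: "coble_poly k l v w u t = ?F" "coble_poly k l w u v t = ?F"
  proof -
    have "v + w + u = u + v + w" "w + u + v = u + v + w" by simp_all
    then show "coble_poly k l v w u t = ?F" "coble_poly k l w u v t = ?F"
      unfolding coble_poly_quartic by (simp_all add: algebra_simps)
  qed
  have "(u - v) * ((u + w) * (v + w)) * quartic k l t (w - u - v) + (v - w) * ((v + u) * (w + u)) * quartic k l t (u - v - w) +
    (w - u) * ((w + v) * (u + v)) * quartic k l t (v - w - u) = (u - v) * (u - w) * (v - w) * quartic k l t (u + v + w)"
    using cyclic_power[of u v w] by (intro quartic_sum) (simp_all only: mult.assoc)
  then have "(k ^ 2 - l ^ 2) * ((u - v) * ((u + w) * (v + w)) * quartic k l t (w - u - v)) +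
    (k ^ 2 - l ^ 2) * ((v - w) * ((v + u) * (w + u)) * quartic k l t (u - v - w)) +
    (k ^ 2 - l ^ 2) * ((w - u) * ((w + v) * (u + v)) * quartic k l t (v - w - u)) =
    (k ^ 2 - l ^ 2) * ((u - v) * (u - w) * (v - w) * quartic k l t (u + v + w))"
    by (simp only: distrib_left[symmetric])
  then have "coble_poly k l (- v) (- u) w t + coble_poly k l (- w) (- v) u t + coble_poly k l (- u) (- w) v t = ?F"
    unfolding coble_poly_flip unfolding coble_poly_quartic by (simp only: mult.assoc)
  moreover have "cross_poly k l u v w t + cross_poly k l v w u t + cross_poly k l w u v t =
    ?F + ?F + ?F - (coble_poly k l (- v) (- u) w t + coble_poly k l (- w) (- v) u t + coble_poly k l (- u) (- w) v t)"
    unfolding coble_poly_reflect[symmetric] c by (simp add: algebra_simps)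
  ultimately show ?thesis by simp
qed

section \<open>Discriminants of \<open>3A2\<close>-subsystems\<close>

lemma A2_half_system:
  assumes "A2_pair x y"
  shows "half_system (A2_set x y) {x, y, x + y}" "discriminant {x, y, x + y} = sym_incl x * sym_incl y * sym_incl (x + y)"
proof -
  have p: "x \<noteq> 0" "x \<bullet> x = y \<bullet> y" "2 * (x \<bullet> y) = - (x \<bullet> x)" "x \<bullet> x > 0"
    using assms by (auto simp: A2_pair_def)
  have q: "x \<bullet> y = - (x \<bullet> x) / 2" "y \<bullet> x = - (x \<bullet> x) / 2" "y \<bullet> y = x \<bullet> x" using p by (simp_all add: inner_commute)
  have ne: "v \<noteq> - w" if "v \<in> {x, y, x + y}" "w \<in> {x, y, x + y}" for v w
  proof
    assume vw: "v = - w"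
    \<comment> \<open>The vector \<open>3 x + 2 y\<close> pairs positively with \<open>x\<close> and
      \<open>y\<close> and so with their sum; opposite vectors cannot both pair positively with
      it.\<close>
    have "v \<bullet> (2 *\<^sub>R (x + y) + x) > 0 \<and> w \<bullet> (2 *\<^sub>R (x + y) + x) > 0 "
      using that p(4) by (auto simp: inner_add_left inner_add_right q)
    then show False unfolding vw inner_minus_left by linarith
  qed
  have "(v \<in> {x, y, x + y}) = (- v \<notin> {x, y, x + y})" if v: "v \<in> A2_set x y" for v
  proof (cases "v \<in> {x, y, x + y}")
    case True
    then have "- v \<notin> {x, y, x + y}" using ne[OF True] by (metis minus_minus)
    then show ?thesis using True by blast
  next
    case False
    then have "- v \<in> {x, y, x + y}" using v unfolding A2_set_def by auto
    then show ?thesis using False by blast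
  qed
  then show "half_system (A2_set x y) {x, y, x + y}"
    unfolding half_system_def by (auto simp: A2_set_def)
  have "x \<noteq> y" "x \<noteq> x + y" "y \<noteq> x + y" using p by auto
  then show "discriminant {x, y, x + y} = sym_incl x * sym_incl y * sym_incl (x + y)"
    by (simp add: discriminant_def mult.assoc)
qed

lemma half_system_Un:
  assumes P: "half_system S P" and Q: "half_system S' Q" and dis: "S \<inter> S' = {}"
    and neg: "\<And>x. x \<in> S \<Longrightarrow> - x \<in> S" "\<And>x. x \<in> S' \<Longrightarrow> - x \<in> S'"
  shows "half_system (S \<union> S') (P \<union> Q)" "discriminant (P \<union> Q) = discriminant P * discriminant Q"
proof -
  show "half_system (S \<union> S') (P \<union> Q)"
    using assms unfolding half_system_def by blast
  have "P \<inter> Q = {}" "finite P" "finite Q" using P Q dis by (auto simp: half_system_def)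
  then show "discriminant (P \<union> Q) = discriminant P * discriminant Q"
    unfolding discriminant_def by (rule prod.union_disjoint[rotated 2])
qed

definition frame_coble_poly :: "(nat \<Rightarrow> real^'n) \<Rightarrow> real^'n \<Rightarrow> 'n::finite sym_alg" where
  "frame_coble_poly g t = coble_poly (sym_incl (g 0)) (sym_incl (g 1)) (sym_incl (g 2)) (sym_incl (g 3)) (sym_incl (g 4)) (sym_incl t)"

definition frame_cross_poly :: "(nat \<Rightarrow> real^'n) \<Rightarrow> real^'n \<Rightarrow> 'n::finite sym_alg" where
  "frame_cross_poly g t = cross_poly (sym_incl (g 0)) (sym_incl (g 1)) (sym_incl (g 2)) (sym_incl (g 3)) (sym_incl (g 4)) (sym_incl t)"

lemma sym_incl_2: "sym_incl (2 *\<^sub>R v) = 2 * sym_incl v"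
  using sym_incl_scaleR[of 2 v] by (simp add: sym_scale_numeral)

lemma discriminant_summands:
  fixes g :: "nat \<Rightarrow> real^'n::finite"
  assumes fr: "frame g t K" and P: "half_system (A_summand g \<union> B_summand g t \<union> C_summand g t) P"
  shows "discriminant P = 32 * frame_coble_poly g t \<or> discriminant P = - (32 * frame_coble_poly g t)"
proof -
  note pairs = summand_pairs[OF fr] and dis = summands_disjoint[OF fr]
  have neg: "- x \<in> A2_set y z" if "x \<in> A2_set y z" for x y z :: "real^'n" using that by (auto simp: A2_set_def)
  let ?A = "{2 *\<^sub>R (g 2 - g 3), 2 *\<^sub>R (g 3 - g 4), 2 *\<^sub>R (g 2 - g 3) + 2 *\<^sub>R (g 3 - g 4)}"
  let ?B = "{2 *\<^sub>R (g 0 - g 1), t - (g 2 + g 3 + g 4) - (g 0 - g 1), 2 *\<^sub>R (g 0 - g 1) + (t - (g 2 + g 3 + g 4) - (g 0 - g 1))}"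
  let ?C = "{2 *\<^sub>R (g 0 + g 1), t + (g 2 + g 3 + g 4) - (g 0 + g 1), 2 *\<^sub>R (g 0 + g 1) + (t + (g 2 + g 3 + g 4) - (g 0 + g 1))}"
  note h = A2_half_system[OF pairs(1), folded A_summand_def] A2_half_system[OF pairs(2), folded B_summand_def]
    A2_half_system[OF pairs(3), folded C_summand_def]
  have negs: "x \<in> A_summand g \<Longrightarrow> - x \<in> A_summand g" "x \<in> B_summand g t \<Longrightarrow> - x \<in> B_summand g t"
    "x \<in> C_summand g t \<Longrightarrow> - x \<in> C_summand g t" for x
    unfolding A_summand_def B_summand_def C_summand_def by (rule neg, assumption)+
  note AB = half_system_Un[OF h(1) h(3) dis(1) negs(1,2)]
  have d2: "(A_summand g \<union> B_summand g t) \<inter> C_summand g t = {}" using dis by blast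
  have n2: "x \<in> A_summand g \<union> B_summand g t \<Longrightarrow> - x \<in> A_summand g \<union> B_summand g t" for x using negs by blast
  note ABC = half_system_Un[OF AB(1) h(5) d2 n2 negs(3)]
  have "discriminant (?A \<union> ?B \<union> ?C) = discriminant ?A * discriminant ?B * discriminant ?C"
    using ABC(2) AB(2) by simp
  also have "\<dots> = 32 * frame_coble_poly g t"
  proof -
    \<comment> \<open>The number 32 consists of three factors 2 from \<open>A_summand\<close> and
      one each from \<open>B_summand\<close> and \<open>C_summand\<close>.\<close>
    have id: "2 * (u - v) * (2 * (v - w)) * (2 * (u - v) + 2 * (v - w)) *
      (2 * (k - l) * (\<tau> - (u + v + w) - (k - l)) * (2 * (k - l) + (\<tau> - (u + v + w) - (k - l)))) *
      (2 * (k + l) * (\<tau> + (u + v + w) - (k + l)) * (2 * (k + l) + (\<tau> + (u + v + w) - (k + l)))) =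
      32 * coble_poly k l u v w \<tau>" for k l u v w \<tau> :: "'n sym_alg"
    proof -
      have e1: "2 * (u - v) * (2 * (v - w)) * (2 * (u - v) + 2 * (v - w)) = 8 * ((u - v) * (u - w) * (v - w))"
        by (simp add: algebra_simps)
      have e2: "2 * p * (m - p) * (2 * p + (m - p)) = 2 * p * (m ^ 2 - p ^ 2)" for m p :: "'n sym_alg"
        by (simp add: algebra_simps power2_eq_square)
      have e3: "8 * a * (2 * p * b) * (2 * q * c) = 32 * ((p * q) * (a * (b * c)))" for a b c p q :: "'n sym_alg"
        by (simp add: algebra_simps)
      have e4: "(k - l) * (k + l) = k ^ 2 - l ^ 2" by (simp add: algebra_simps power2_eq_square)
      show ?thesis unfolding coble_poly_def e1 e2 e3 e4 ..
    qed
    show ?thesis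
      unfolding h(2,4,6) frame_coble_poly_def sym_incl_add sym_incl_diff sym_incl_2 by (rule id)
  qed
  finally have d: "discriminant (?A \<union> ?B \<union> ?C) = 32 * frame_coble_poly g t" .
  show ?thesis using discriminant_half[OF P ABC(1)] unfolding d .
qed

text \<open>By the classification, the generators of the Coble space are the polynomials of all
  frames related to \<open>f\<close>, up to a factor 32 and signs, which disappear in the
  span.\<close>

lemma coble_eq_span:
  fixes f :: "nat \<Rightarrow> real^'n::finite"
  assumes fr: "frame f t K"
  shows "coble (E6_set f t) = sym.span {frame_coble_poly g t | g. frame_change f g}"
proof -
  have sc: "32 * p = sym_scale 32 p" "- (32 * p) = sym_scale (- 32) p" for p :: "'n sym_alg"
    by (simp_all add: sym_scale_numeral sym_scale_neg_numeral)
  have "{discriminant P | S P. S \<subseteq> E6_set f t \<and> type_3A2 S \<and> positive_system S P} \<subseteq> sym.span {frame_coble_poly g t | g. frame_change f g}"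
  proof clarify
    fix S P assume S: "S \<subseteq> E6_set f t" "type_3A2 S" "positive_system S P"
    obtain F where F: "has_summands 3 type_A2 F S" using S(2) by (auto simp: type_3A2_def)
    obtain g where g: "frame_change f g" "F = {A_summand g, B_summand g t, C_summand g t}"
      using summands_3A2_classification[OF fr F S(1)] by blast
    have "S = A_summand g \<union> B_summand g t \<union> C_summand g t" using F g(2) by (auto simp: has_summands_def)
    then have "half_system (A_summand g \<union> B_summand g t \<union> C_summand g t) P" using summands_3A2_half[OF F S(3)] by simp
    then have d: "discriminant P = 32 * frame_coble_poly g t \<or> discriminant P = - (32 * frame_coble_poly g t)"
      by (rule discriminant_summands[OF frame_change_frame[OF g(1) fr]])
    have m: "sym_scale c (frame_coble_poly g t) \<in> sym.span {frame_coble_poly g t | g. frame_change f g}" for c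
      using g(1) by (intro sym.span_scale sym.span_base) blast
    show "discriminant P \<in> sym.span {frame_coble_poly g t | g. frame_change f g}"
      using d by (elim disjE) (simp_all only: m[of 32, folded sc(1)] m[of "- 32", folded sc(2)])
  qed
  moreover have "{frame_coble_poly g t | g. frame_change f g} \<subseteq> coble (E6_set f t)"
  proof clarify
    fix g assume g: "frame_change f g"
    let ?S = "A_summand g \<union> B_summand g t \<union> C_summand g t"
    have fr_g: "frame g t K" by (rule frame_change_frame[OF g fr])
    note F = summands_has_summands[OF fr_g]
    obtain P where P: "positive_system ?S P" using summands_3A2_positive[OF F] by blast
    have "?S \<subseteq> E6_set f t" using summands_subset[OF fr_g] E6_set_frame_change[OF g] by simp
    then have "discriminant P \<in> coble (E6_set f t)"
      unfolding coble_def type_3A2_def using F P by (intro sym.span_base CollectI exI[of _ ?S] exI[of _ P]) blast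
    moreover have d: "discriminant P = 32 * frame_coble_poly g t \<or> discriminant P = - (32 * frame_coble_poly g t)"
      by (rule discriminant_summands[OF fr_g summands_3A2_half[OF F P]])
    have "frame_coble_poly g t = sym_scale (1/32) (discriminant P) \<or> frame_coble_poly g t = sym_scale (- 1/32) (discriminant P)"
    proof -
      have c1: "sym_scale (1/32) (32 * p) = p" for p :: "'n sym_alg" unfolding sc(1) by simp
      have c2: "sym_scale (- 1/32) (- (32 * p)) = p" for p :: "'n sym_alg" unfolding sc(2) by simp
      show ?thesis using d by (elim disjE) (simp_all only: c1 c2 simp_thms)
    qed
    ultimately show "frame_coble_poly g t \<in> coble (E6_set f t)"
      unfolding coble_def by (elim disjE) (simp_all only: sym.span_scale)
  qed
  ultimately show ?thesis
    unfolding coble_def by (intro subset_antisym sym.span_minimal sym.subspace_span)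
qed

section \<open>Crosses attached to \<open>4A1\<close>-subsystems of a
  \<open>D4\<close>-subsystem\<close>

lemma D_set_minus:
  assumes o: "orthogonal_family {..<5} f K" and p: "p < 5"
  shows "D_set ({..<5} - {p}) f = {x \<in> D_set {..<5} f. x \<bullet> f p = 0}"
proof -
  have K: "K > 0" and ff: "\<And>i j. i < 5 \<Longrightarrow> j < 5 \<Longrightarrow> f i \<bullet> f j = (if i = j then K else 0)"
    using o by (auto simp: orthogonal_family_def)
  have inner: "2 *\<^sub>R (s *\<^sub>R f i + r *\<^sub>R f j) \<bullet> f p = 0 \<longleftrightarrow> i \<noteq> p \<and> j \<noteq> p"
    if "i < 5" "j < 5" "i \<noteq> j" "s \<in> {1, -1}" "r \<in> {1, -1}" for i j s r
    using that K p by (auto simp: inner_add_left ff)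
  show ?thesis
  proof (intro subset_antisym subsetI)
    fix x assume "x \<in> D_set ({..<5} - {p}) f"
    then obtain s r i j where x: "x = 2 *\<^sub>R (s *\<^sub>R f i + r *\<^sub>R f j)" "i < 5" "j < 5" "i \<noteq> p" "j \<noteq> p" "i \<noteq> j" "s \<in> {1, -1}" "r \<in> {1, -1}"
      unfolding D_set_def by blast
    have "x \<bullet> f p = 0" using inner[OF x(2,3,6,7,8)] x by simp
    moreover have "x \<in> D_set {..<5} f" using x unfolding D_set_def by blast
    ultimately show "x \<in> {x \<in> D_set {..<5} f. x \<bullet> f p = 0}" by blast
  next
    fix x assume "x \<in> {x \<in> D_set {..<5} f. x \<bullet> f p = 0}"
    then obtain s r i j where x: "x = 2 *\<^sub>R (s *\<^sub>R f i + r *\<^sub>R f j)" "i < 5" "j < 5" "i \<noteq> j" "s \<in> {1, -1}" "r \<in> {1, -1}" and 0: "x \<bullet> f p = 0"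
      unfolding D_set_def by blast
    have "i \<noteq> p" "j \<noteq> p" using inner[OF x(2-6)] 0 x(1) by auto
    then have "i \<in> {..<5} - {p}" "j \<in> {..<5} - {p}" using x by auto
    then show "x \<in> D_set ({..<5} - {p}) f" using x unfolding D_set_def by blast
  qed
qed

lemma cross_reflection:
  fixes g :: "nat \<Rightarrow> real^'n::finite"
  assumes fr: "frame g t K" and a: "a = 2 *\<^sub>R (g 2 + g 3) \<or> a = - (2 *\<^sub>R (g 2 + g 3))"
    and P: "discriminant P = 32 * frame_coble_poly g t \<or> discriminant P = - (32 * frame_coble_poly g t)"
  shows "discriminant P - sym_act (root_refl a) (discriminant P) = 32 * frame_cross_poly g t \<or>
    discriminant P - sym_act (root_refl a) (discriminant P) = - (32 * frame_cross_poly g t)"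
proof -
  note fi = frame_inner[OF fr]
  have aa: "a \<bullet> a = 8 * K" using a by (auto simp: fi inner_add_left inner_add_right)
  have r: "root_refl a x = x - ((g 2 + g 3) \<bullet> x / K) *\<^sub>R (g 2 + g 3)" for x
    using a fi(1) unfolding root_refl_def cartan_int_def aa by (auto simp: inner_commute)
  have "root_refl a (g 0) = g 0" "root_refl a (g 1) = g 1" "root_refl a (g 2) = - g 3" "root_refl a (g 3) = - g 2"
    "root_refl a (g 4) = g 4" "root_refl a t = t"
    unfolding r using less_imp_neq[OF fi(1)] by (simp_all add: fi(2-) inner_add_left)
  then have s: "sym_act (root_refl a) (sym_incl (g 0)) = sym_incl (g 0)" "sym_act (root_refl a) (sym_incl (g 1)) = sym_incl (g 1)"
    "sym_act (root_refl a) (sym_incl (g 2)) = - sym_incl (g 3)" "sym_act (root_refl a) (sym_incl (g 3)) = - sym_incl (g 2)"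
    "sym_act (root_refl a) (sym_incl (g 4)) = sym_incl (g 4)" "sym_act (root_refl a) (sym_incl t) = sym_incl t"
    by (simp_all only: sym_act_incl[OF linear_root_refl] sym_incl_minus)
  have "sym_act (root_refl a) (frame_coble_poly g t) =
    coble_poly (sym_incl (g 0)) (sym_incl (g 1)) (- sym_incl (g 3)) (- sym_incl (g 2)) (sym_incl (g 4)) (sym_incl t)"
    unfolding frame_coble_poly_def coble_poly_def sym_act_hom s ..
  then have d: "frame_coble_poly g t - sym_act (root_refl a) (frame_coble_poly g t) = frame_cross_poly g t"
    unfolding frame_cross_poly_def coble_poly_reflect[symmetric] by (simp add: frame_coble_poly_def)
  have e: "sym_act (root_refl a) (32 * frame_coble_poly g t) = 32 * sym_act (root_refl a) (frame_coble_poly g t)"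
    by (simp add: sym_act_mult)
  show ?thesis
    using P
  proof
    assume "discriminant P = 32 * frame_coble_poly g t"
    then have "discriminant P - sym_act (root_refl a) (discriminant P) = 32 * frame_cross_poly g t"
      by (simp only: e right_diff_distrib d[symmetric])
    then show ?thesis ..
  next
    assume "discriminant P = - (32 * frame_coble_poly g t)"
    then have "discriminant P - sym_act (root_refl a) (discriminant P) = - (32 * frame_cross_poly g t)"
      by (simp only: e right_diff_distrib d[symmetric] sym_act_minus) simp
    then show ?thesis ..
  qed
qed

lemma A2_set_orthogonal_part:
  assumes "a \<bullet> x = 0" "a \<bullet> y \<noteq> 0"
  shows "{b \<in> A2_set x y. a \<bullet> b = 0} = {x, - x}"
  using assms by (auto simp: A2_set_def inner_add_right inner_diff_right)

lemma orthogonal_type_4A1: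
  fixes v w x y :: "'a::euclidean_space"
  assumes nz: "v \<noteq> 0" "w \<noteq> 0" "x \<noteq> 0" "y \<noteq> 0"
    and o: "v \<bullet> w = 0" "v \<bullet> x = 0" "v \<bullet> y = 0" "w \<bullet> x = 0" "w \<bullet> y = 0" "x \<bullet> y = 0"
  shows "type_4A1 ({v, - v} \<union> {w, - w} \<union> {x, - x} \<union> {y, - y})"
proof -
  have ne: "{u, - u} \<noteq> {u', - u'}" if "u \<noteq> 0" "u \<bullet> u' = 0" for u u' :: 'a
  proof
    assume "{u, - u} = {u', - u'}"
    then have "u = u' \<or> u = - u'" by blast
    then show False using that by auto
  qed
  have "has_summands 4 type_A1 {{v, - v}, {w, - w}, {x, - x}, {y, - y}} ({v, - v} \<union> {w, - w} \<union> {x, - x} \<union> {y, - y})"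
    unfolding has_summands_def
  proof (intro conjI)
    show "card {{v, - v}, {w, - w}, {x, - x}, {y, - y}} = 4"
      using ne[OF nz(1) o(1)] ne[OF nz(1) o(2)] ne[OF nz(1) o(3)] ne[OF nz(2) o(4)] ne[OF nz(2) o(5)] ne[OF nz(3) o(6)]
      by (simp only: card_insert_if finite.intros insert_iff empty_iff simp_thms if_False card.empty)
    show "\<forall>A\<in>{{v, - v}, {w, - w}, {x, - x}, {y, - y}}. type_A1 A"
      using nz by (auto intro: pair_type_A1)
    have pair: "\<forall>a\<in>{u, - u}. \<forall>b\<in>{u', - u'}. a \<bullet> b = 0" if "u \<bullet> u' = 0" for u u' :: 'a
      using that by auto
    have o': "w \<bullet> v = 0" "x \<bullet> v = 0" "y \<bullet> v = 0" "x \<bullet> w = 0" "y \<bullet> w = 0" "y \<bullet> x = 0"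
      using o by (simp_all add: inner_commute)
    show "\<forall>A\<in>{{v, - v}, {w, - w}, {x, - x}, {y, - y}}. \<forall>B\<in>{{v, - v}, {w, - w}, {x, - x}, {y, - y}}.
        A \<noteq> B \<longrightarrow> (\<forall>a\<in>A. \<forall>b\<in>B. a \<bullet> b = 0)"
    proof (intro ballI impI)
      fix A B a b
      assume A: "A \<in> {{v, - v}, {w, - w}, {x, - x}, {y, - y}}" and B: "B \<in> {{v, - v}, {w, - w}, {x, - x}, {y, - y}}"
        and ne: "A \<noteq> B" and a: "a \<in> A" and b: "b \<in> B"
      obtain u where u: "u \<in> {v, w, x, y}" "A = {u, - u}" using A by blast
      obtain u' where u': "u' \<in> {v, w, x, y}" "B = {u', - u'}" using B by blast
      have "u \<noteq> u'" using ne u u' by blast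
      then have "u \<bullet> u' = 0" using u(1) u'(1) o o' by fastforce
      then show "a \<bullet> b = 0" using pair a b u(2) u'(2) by blast
    qed
  qed auto
  then show ?thesis unfolding type_4A1_def by blast
qed

text \<open>In each summand the root orthogonal to \<open>g 2 + g 3\<close> is unique up to sign.
  Together with \<open>2 (g 2 + g 3)\<close> these roots form the \<open>4A1\<close>-subsystem on
  the index pairs \<open>0, 1\<close> and \<open>2, 3\<close>, inside the
  \<open>D4\<close>-subsystem orthogonal to \<open>g 4\<close>.\<close>

lemma summands_orthogonal_part:
  assumes fr: "frame g t K"
  shows "{b \<in> A_summand g \<union> B_summand g t \<union> C_summand g t. 2 *\<^sub>R (g 2 + g 3) \<bullet> b = 0} =
    {2 *\<^sub>R (g 2 - g 3), - (2 *\<^sub>R (g 2 - g 3))} \<union> {2 *\<^sub>R (g 0 - g 1), - (2 *\<^sub>R (g 0 - g 1))} \<union> {2 *\<^sub>R (g 0 + g 1), - (2 *\<^sub>R (g 0 + g 1))}"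
proof -
  note fi = frame_inner[OF fr] inner_add_left inner_add_right inner_diff_left inner_diff_right
  have K: "K > 0" by (rule fi)
  let ?a = "2 *\<^sub>R (g 2 + g 3)"
  have "{b \<in> A_summand g. ?a \<bullet> b = 0} = {2 *\<^sub>R (g 2 - g 3), - (2 *\<^sub>R (g 2 - g 3))}"
    unfolding A_summand_def by (rule A2_set_orthogonal_part) (use K in \<open>simp_all add: fi(2-)\<close>)
  moreover have "{b \<in> B_summand g t. ?a \<bullet> b = 0} = {2 *\<^sub>R (g 0 - g 1), - (2 *\<^sub>R (g 0 - g 1))}"
    unfolding B_summand_def by (rule A2_set_orthogonal_part) (use K in \<open>simp_all add: fi(2-)\<close>)
  moreover have "{b \<in> C_summand g t. ?a \<bullet> b = 0} = {2 *\<^sub>R (g 0 + g 1), - (2 *\<^sub>R (g 0 + g 1))}"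
    unfolding C_summand_def by (rule A2_set_orthogonal_part) (use K in \<open>simp_all add: fi(2-)\<close>)
  ultimately show ?thesis by blast
qed

lemma cross_exists:
  fixes f :: "nat \<Rightarrow> real^'n::finite"
  assumes fr: "frame f t K" and p: "p < 5" and g: "frame_change f g" and g4: "g 4 = f p \<or> g 4 = - f p"
  shows "\<exists>T c. T \<subseteq> D_set ({..<5} - {p}) f \<and> type_4A1 T \<and> cross_attached (E6_set f t) T c \<and>
    (c = 32 * frame_cross_poly g t \<or> c = - (32 * frame_cross_poly g t))"
proof -
  have fr_g: "frame g t K" by (rule frame_change_frame[OF g fr])
  note fi = frame_inner[OF fr_g] inner_add_left inner_add_right inner_diff_left inner_diff_right
  have K: "K > 0" by (rule fi)
  let ?S = "A_summand g \<union> B_summand g t \<union> C_summand g t"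
  define a where "a = 2 *\<^sub>R (g 2 + g 3)"
  define T where "T = {b \<in> ?S. a \<bullet> b = 0} \<union> {a, - a}"
  have T: "T = {2 *\<^sub>R (g 2 - g 3), - (2 *\<^sub>R (g 2 - g 3))} \<union> {2 *\<^sub>R (g 0 - g 1), - (2 *\<^sub>R (g 0 - g 1))} \<union> {2 *\<^sub>R (g 0 + g 1), - (2 *\<^sub>R (g 0 + g 1))} \<union> {2 *\<^sub>R (g 2 + g 3), - (2 *\<^sub>R (g 2 + g 3))}"
    unfolding T_def a_def summands_orthogonal_part[OF fr_g] ..
  note F = summands_has_summands[OF fr_g]
  obtain P where P: "positive_system ?S P" using summands_3A2_positive[OF F] by blast
  have S: "?S \<subseteq> E6_set f t" using summands_subset[OF fr_g] E6_set_frame_change[OF g] by simp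
  have D: "D_set {..<5} g = D_set {..<5} f" by (rule D_set_frame_change[OF g])
  have "2 *\<^sub>R (g 2 - g 3) \<in> D_set {..<5} f" "2 *\<^sub>R (g 0 - g 1) \<in> D_set {..<5} f" "2 *\<^sub>R (g 0 + g 1) \<in> D_set {..<5} f" "2 *\<^sub>R (g 2 + g 3) \<in> D_set {..<5} f"
    unfolding D[symmetric] by (rule D_set_memI; simp)+
  then have "T \<subseteq> D_set {..<5} f" using D_set_neg unfolding T by blast
  moreover have "x \<bullet> f p = 0" if "x \<in> T" for x
  proof -
    have "x \<bullet> g 4 = 0" using that unfolding T by (auto simp: fi(2-))
    then show ?thesis using g4 by auto
  qed
  ultimately have TD: "T \<subseteq> D_set ({..<5} - {p}) f"
    using D_set_minus[of f K p] fr p unfolding frame_def by blast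
  have nz: "v \<noteq> 0" if "v \<bullet> v = 8 * K" for v :: "real^'n" using that K by auto
  have "type_4A1 T"
    unfolding T by (rule orthogonal_type_4A1; (rule nz)?; simp add: fi(2-))
  moreover have "cross_attached (E6_set f t) T (discriminant P - sym_act (root_refl a) (discriminant P))"
    unfolding cross_attached_def
  proof (intro exI conjI)
    show "?S \<subseteq> E6_set f t" by (rule S)
    show "has_summands 3 type_A2 {A_summand g, B_summand g t, C_summand g t} ?S" by (rule F)
    show "positive_system ?S P" by (rule P)
    show "a \<in> E6_set f t" using D D_set_memI(1)[of 2 "{..<5}" 3 g] by (simp add: a_def E6_set_def)
    have "a \<bullet> (2 *\<^sub>R (g 3 - g 4)) \<noteq> 0" "a \<bullet> (t - (g 2 + g 3 + g 4) - (g 0 - g 1)) \<noteq> 0" "a \<bullet> (t + (g 2 + g 3 + g 4) - (g 0 + g 1)) \<noteq> 0"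
      using K by (simp_all add: a_def fi(2-))
    moreover have "2 *\<^sub>R (g 3 - g 4) \<in> A_summand g" "t - (g 2 + g 3 + g 4) - (g 0 - g 1) \<in> B_summand g t" "t + (g 2 + g 3 + g 4) - (g 0 + g 1) \<in> C_summand g t"
      unfolding A_summand_def B_summand_def C_summand_def A2_set_def by blast+
    ultimately show "\<forall>A\<in>{A_summand g, B_summand g t, C_summand g t}. \<exists>b\<in>A. a \<bullet> b \<noteq> 0" by blast
    show "T = {b \<in> ?S. a \<bullet> b = 0} \<union> {a, - a}" by (rule T_def)
  qed (rule refl)
  moreover have "discriminant P - sym_act (root_refl a) (discriminant P) = 32 * frame_cross_poly g t \<or>
    discriminant P - sym_act (root_refl a) (discriminant P) = - (32 * frame_cross_poly g t)"
    by (rule cross_reflection[OF fr_g _ discriminant_summands[OF fr_g summands_3A2_half[OF F P]]]) (simp add: a_def)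
  ultimately show ?thesis using TD by blast
qed

text \<open>\<open>X\<close> are the coordinates of a reflecting root in \<open>D5\<close>, and the
  inequalities say that it is orthogonal to none of four roots of \<open>B_summand\<close> and
  \<open>C_summand\<close> outside \<open>D5\<close>. What is left are the roots
  \<open>2 (g i + g j)\<close>, up to sign, with \<open>i, j\<close> among 2, 3, 4.\<close>

lemma cross_coordinates:
  fixes X :: "nat \<Rightarrow> real"
  assumes X: "\<forall>i<5. X i \<in> {0, 2, -2}" "(\<Sum>i<5. X i * X i) = 8"
    and n: "X 0 - X 1 \<noteq> X 2 + X 3 + X 4" "X 0 - X 1 \<noteq> - (X 2 + X 3 + X 4)"
      "X 0 + X 1 \<noteq> X 2 + X 3 + X 4" "X 0 + X 1 \<noteq> - (X 2 + X 3 + X 4)"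
  shows "X 0 = 0 \<and> X 1 = 0 \<and> (X 4 = 0 \<and> X 2 = X 3 \<or> X 3 = 0 \<and> X 2 = X 4 \<or> X 2 = 0 \<and> X 3 = X 4)"
proof -
  obtain a b c d e where v: "X 0 = a" "X 1 = b" "X 2 = c" "X 3 = d" "X 4 = e" by blast
  have "a \<in> {0, 2, -2}" "b \<in> {0, 2, -2}" "c \<in> {0, 2, -2}" "d \<in> {0, 2, -2}" "e \<in> {0, 2, -2}"
    "a * a + b * b + c * c + d * d + e * e = 8"
    using X unfolding all_less_5 sum_lessThan_5 v by blast+
  moreover have "a - b \<noteq> c + d + e" "a - b \<noteq> - (c + d + e)" "a + b \<noteq> c + d + e" "a + b \<noteq> - (c + d + e)"
    using n unfolding v by blast+
  ultimately show ?thesis unfolding v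
    by (simp only: insert_iff empty_iff simp_thms) (elim disjE; simp)
qed

text \<open>Converse of \<open>cross_exists\<close>. As \<open>T\<close> lies in \<open>D5\<close>,
  so does the reflecting root \<open>a\<close>, and no root of \<open>S\<close> outside
  \<open>D5\<close> is orthogonal to \<open>a\<close>. By \<open>cross_coordinates\<close> a
  relabelling of the last three indices makes \<open>a\<close> equal to \<open>2 (h 2 + h 3)\<close>
  up to sign; the roots of \<open>T\<close> then leave only the direction of \<open>h 4\<close> for
  \<open>f p\<close>.\<close>

lemma cross_polynomial:
  fixes f :: "nat \<Rightarrow> real^'n::finite"
  assumes fr: "frame f t K" and p: "p < 5" and T: "T \<subseteq> D_set ({..<5} - {p}) f" and c: "cross_attached (E6_set f t) T c"
  shows "\<exists>g. frame_change f g \<and> (g 4 = f p \<or> g 4 = - f p) \<and> (c = 32 * frame_cross_poly g t \<or> c = - (32 * frame_cross_poly g t))"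
proof -
  have o: "orthogonal_family {..<5} f K" using fr by (simp add: frame_def)
  obtain S F P a where S: "S \<subseteq> E6_set f t" and F: "has_summands 3 type_A2 F S" and P: "positive_system S P"
    and a: "a \<in> E6_set f t" and Fa: "\<forall>A\<in>F. \<exists>b\<in>A. a \<bullet> b \<noteq> 0" and Teq: "T = {b \<in> S. a \<bullet> b = 0} \<union> {a, - a}"
    and ceq: "c = discriminant P - sym_act (root_refl a) (discriminant P)"
    using c unfolding cross_attached_def by blast
  obtain g where g: "frame_change f g" and Fg: "F = {A_summand g, B_summand g t, C_summand g t}"
    using summands_3A2_classification[OF fr F S] by blast
  have Sg: "S = A_summand g \<union> B_summand g t \<union> C_summand g t" using F Fg by (auto simp: has_summands_def)
  have fr_g: "frame g t K" by (rule frame_change_frame[OF g fr])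
  note fi = frame_inner[OF fr_g] inner_add_left inner_add_right inner_diff_left inner_diff_right
  have K: "K > 0" by (rule fi)
  have TD: "T \<subseteq> D_set {..<5} g" and Tp: "\<And>x. x \<in> T \<Longrightarrow> x \<bullet> f p = 0"
    using T D_set_minus[OF o p] D_set_frame_change[OF g] by auto
  have "a \<in> D_set {..<5} g" using TD Teq by blast
  then obtain X where aX: "a = fvec g t X 0" and X: "\<forall>i<5. X i \<in> {0, 2, -2}" "(\<Sum>i<5. X i * X i) = 8"
    by (rule D_set_coords)
  have ag: "a \<bullet> g i = X i * K" if "i < 5" for i unfolding aX using that by (rule fvec_inner(1)[OF fr_g])
  have at: "a \<bullet> t = 0" unfolding aX using fvec_inner(3)[OF fr_g, of X 0] by simp
  have Dt: "x \<bullet> t = 0" if "x \<in> D_set {..<5} g" for x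
    using D_set_coords[OF that, of t] fvec_inner(3)[OF fr_g, of _ 0] by (metis mult_zero_left mult_zero_right)
  \<comment> \<open>A root of \<open>S\<close> orthogonal to \<open>a\<close> belongs to
    \<open>T\<close> and hence to \<open>D5\<close>, where all pairings with \<open>t\<close>
    vanish.\<close>
  have spin: "a \<bullet> b \<noteq> 0" if "b \<in> S" "b \<bullet> t \<noteq> 0" for b
    using Dt TD Teq that by blast
  have mem: "t - (g 2 + g 3 + g 4) - (g 0 - g 1) \<in> S" "2 *\<^sub>R (g 0 - g 1) + (t - (g 2 + g 3 + g 4) - (g 0 - g 1)) \<in> S"
    "t + (g 2 + g 3 + g 4) - (g 0 + g 1) \<in> S" "2 *\<^sub>R (g 0 + g 1) + (t + (g 2 + g 3 + g 4) - (g 0 + g 1)) \<in> S"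
    unfolding Sg B_summand_def C_summand_def A2_set_def by blast+
  have "a \<bullet> (t - (g 2 + g 3 + g 4) - (g 0 - g 1)) \<noteq> 0" "a \<bullet> (2 *\<^sub>R (g 0 - g 1) + (t - (g 2 + g 3 + g 4) - (g 0 - g 1))) \<noteq> 0"
    "a \<bullet> (t + (g 2 + g 3 + g 4) - (g 0 + g 1)) \<noteq> 0" "a \<bullet> (2 *\<^sub>R (g 0 + g 1) + (t + (g 2 + g 3 + g 4) - (g 0 + g 1))) \<noteq> 0"
    by (rule spin[OF mem(1)] spin[OF mem(2)] spin[OF mem(3)] spin[OF mem(4)]; use K in \<open>simp add: fi(2-)\<close>)+
  moreover have "a \<bullet> (t - (g 2 + g 3 + g 4) - (g 0 - g 1)) = K * (- (X 2 + X 3 + X 4) - (X 0 - X 1))"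
    "a \<bullet> (2 *\<^sub>R (g 0 - g 1) + (t - (g 2 + g 3 + g 4) - (g 0 - g 1))) = K * ((X 0 - X 1) - (X 2 + X 3 + X 4))"
    "a \<bullet> (t + (g 2 + g 3 + g 4) - (g 0 + g 1)) = K * ((X 2 + X 3 + X 4) - (X 0 + X 1))"
    "a \<bullet> (2 *\<^sub>R (g 0 + g 1) + (t + (g 2 + g 3 + g 4) - (g 0 + g 1))) = K * ((X 0 + X 1) + (X 2 + X 3 + X 4))"
    by (simp_all add: inner_add_right inner_diff_right ag at algebra_simps)
  ultimately have cs: "X 0 = 0 \<and> X 1 = 0 \<and> (X 4 = 0 \<and> X 2 = X 3 \<or> X 3 = 0 \<and> X 2 = X 4 \<or> X 2 = 0 \<and> X 3 = X 4)"
    by (intro cross_coordinates[OF X]) auto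
  have a_sum: "a = X 2 *\<^sub>R g 2 + X 3 *\<^sub>R g 3 + X 4 *\<^sub>R g 4"
    unfolding aX fvec_def sum_lessThan_5 using cs by simp
  have X2: "X 2 \<in> {0, 2, -2}" "X 3 \<in> {0, 2, -2}" "X 4 \<in> {0, 2, -2}" "X 2 * X 2 + X 3 * X 3 + X 4 * X 4 = 8"
    using X cs unfolding all_less_5 sum_lessThan_5 by simp_all
  \<comment> \<open>Permutations of the indices 2, 3, 4 preserve each summand:
    \<open>A_summand\<close> contains the differences of any two of these vectors, while
    \<open>B_summand\<close> and \<open>C_summand\<close> involve only their sum.\<close>
  have "\<exists>h. frame_change g h \<and> A_summand h = A_summand g \<and> B_summand h t = B_summand g t \<and> C_summand h t = C_summand g t \<and>
    (a = 2 *\<^sub>R (h 2 + h 3) \<or> a = - (2 *\<^sub>R (h 2 + h 3)))"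
  proof -
    consider "X 4 = 0" "X 2 = X 3" | "X 3 = 0" "X 2 = X 4" | "X 2 = 0" "X 3 = X 4" using cs by blast
    then show ?thesis
    proof cases
      case 1
      then have "X 3 = 2 \<or> X 3 = - 2" using X2 by auto
      then have "a = 2 *\<^sub>R (g 2 + g 3) \<or> a = - (2 *\<^sub>R (g 2 + g 3))"
        unfolding a_sum 1 by (auto simp: scaleR_right_distrib)
      then show ?thesis using frame_change_refl by blast
    next
      case 2
      define h where "h n = [g 0, g 1, g 2, g 4, g 3] ! n" for n
      have hv: "h 0 = g 0" "h 1 = g 1" "h 2 = g 2" "h 3 = g 4" "h 4 = g 3" by (simp_all add: h_def)
      have gh: "frame_change g h"
        by (rule frame_changeI[of 0 1 2 4 3 1 1 1 1 1]) (simp_all add: hv del: One_nat_def)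
      have e: "2 *\<^sub>R (g 2 - g 4) = 2 *\<^sub>R (g 2 - g 3) + 2 *\<^sub>R (g 3 - g 4)" "2 *\<^sub>R (g 4 - g 3) = - (2 *\<^sub>R (g 3 - g 4))"
        by (simp_all add: algebra_simps)
      have "A_summand h = A_summand g" unfolding A_summand_def hv e A2_set_def by auto
      moreover have "B_summand h t = B_summand g t" "C_summand h t = C_summand g t"
        unfolding B_summand_def C_summand_def hv by (simp_all add: ac_simps)
      moreover have "X 4 = 2 \<or> X 4 = - 2" using X2 2 by auto
      then have "a = 2 *\<^sub>R (h 2 + h 3) \<or> a = - (2 *\<^sub>R (h 2 + h 3))"
        unfolding a_sum 2 hv by (auto simp: scaleR_right_distrib)
      ultimately show ?thesis using gh by blast
    next
      case 3
      define h where "h n = [g 0, g 1, g 3, g 4, g 2] ! n" for n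
      have hv: "h 0 = g 0" "h 1 = g 1" "h 2 = g 3" "h 3 = g 4" "h 4 = g 2" by (simp_all add: h_def)
      have gh: "frame_change g h"
        by (rule frame_changeI[of 0 1 3 4 2 1 1 1 1 1]) (simp_all add: hv del: One_nat_def)
      have e: "2 *\<^sub>R (g 4 - g 2) = - (2 *\<^sub>R (g 2 - g 3) + 2 *\<^sub>R (g 3 - g 4))"
        by (simp_all add: algebra_simps)
      have "A_summand h = A_summand g" unfolding A_summand_def hv e A2_set_def by auto
      moreover have "B_summand h t = B_summand g t" "C_summand h t = C_summand g t"
        unfolding B_summand_def C_summand_def hv by (simp_all add: ac_simps)
      moreover have "X 4 = 2 \<or> X 4 = - 2" using X2 3 by auto
      then have "a = 2 *\<^sub>R (h 2 + h 3) \<or> a = - (2 *\<^sub>R (h 2 + h 3))"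
        unfolding a_sum 3 hv by (auto simp: scaleR_right_distrib)
      ultimately show ?thesis using gh by blast
    qed
  qed
  then obtain h where gh: "frame_change g h" and Sh: "S = A_summand h \<union> B_summand h t \<union> C_summand h t"
    and ah: "a = 2 *\<^sub>R (h 2 + h 3) \<or> a = - (2 *\<^sub>R (h 2 + h 3))" using Sg by metis
  have fh: "frame_change f h" by (rule frame_change_trans[OF g gh])
  have fr_h: "frame h t K" by (rule frame_change_frame[OF fh fr])
  have Ta: "{b \<in> S. a \<bullet> b = 0} = {b \<in> S. 2 *\<^sub>R (h 2 + h 3) \<bullet> b = 0}" using ah by auto
  have "2 *\<^sub>R (h 2 - h 3) \<in> T" "2 *\<^sub>R (h 0 - h 1) \<in> T" "2 *\<^sub>R (h 0 + h 1) \<in> T"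
    unfolding Teq unfolding Ta unfolding Sh unfolding summands_orthogonal_part[OF fr_h] by blast+
  then have z: "(2 *\<^sub>R (h 2 - h 3)) \<bullet> f p = 0" "(2 *\<^sub>R (h 0 - h 1)) \<bullet> f p = 0" "(2 *\<^sub>R (h 0 + h 1)) \<bullet> f p = 0" "a \<bullet> f p = 0"
    using Tp Teq by blast+
  then have z: "h 0 \<bullet> f p = 0" "h 1 \<bullet> f p = 0" "h 2 \<bullet> f p = 0" "h 3 \<bullet> f p = 0"
    using ah by (auto simp: inner_diff_left inner_add_left)
  obtain \<pi> s where pi: "\<pi> permutes {..<5}" and s: "\<forall>i<5. s i \<in> {1, -1::real}" and fp: "\<forall>i<5. f i = s i *\<^sub>R h (\<pi> i)"
    using frame_change_sym[OF fh] unfolding frame_change_def by blast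
  have lt: "\<pi> p < 5" using permutes_in_image[OF pi, of p] p by simp
  have "h (\<pi> p) \<bullet> f p \<noteq> 0"
    using fp[rule_format, OF p] s[rule_format, OF p] frame_inner(1,2)[OF fr_h] lt by auto
  then have "\<pi> p \<notin> {0, 1, 2, 3}" using z by (metis insert_iff empty_iff)
  then have "\<pi> p = 4" using lt by auto
  then have "h 4 = f p \<or> h 4 = - f p" using fp[rule_format, OF p] s[rule_format, OF p] by auto
  moreover have "c = 32 * frame_cross_poly h t \<or> c = - (32 * frame_cross_poly h t)"
    unfolding ceq
    by (rule cross_reflection[OF fr_h ah discriminant_summands[OF fr_h]]) (use summands_3A2_half[OF F P] Sh in simp)
  ultimately show ?thesis using fh by blast
qed

definition cross_plane :: "(nat \<Rightarrow> real^'n) \<Rightarrow> real^'n \<Rightarrow> nat \<Rightarrow> 'n::finite sym_alg set" where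
  "cross_plane f t p = sym.span {frame_cross_poly g t | g. frame_change f g \<and> (g 4 = f p \<or> g 4 = - f p)}"

lemma cross_span_eq_plane:
  fixes f :: "nat \<Rightarrow> real^'n::finite"
  assumes fr: "frame f t K" and p: "p < 5"
  shows "cross_span (E6_set f t) (D_set ({..<5} - {p}) f) = cross_plane f t p"
proof -
  have sc: "32 * q = sym_scale 32 q" "- (32 * q) = sym_scale (- 32) q" for q :: "'n sym_alg"
    by (simp_all add: sym_scale_numeral sym_scale_neg_numeral)
  show ?thesis
    unfolding cross_span_def cross_plane_def
  proof (intro subset_antisym sym.span_minimal sym.subspace_span)
    show "{c. \<exists>T\<subseteq>D_set ({..<5} - {p}) f. type_4A1 T \<and> cross_attached (E6_set f t) T c} \<subseteq>
      sym.span {frame_cross_poly g t |g. frame_change f g \<and> (g 4 = f p \<or> g 4 = - f p)}"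
    proof clarify
      fix c T assume "T \<subseteq> D_set ({..<5} - {p}) f" "cross_attached (E6_set f t) T c"
      then obtain g where g: "frame_change f g" "g 4 = f p \<or> g 4 = - f p" and c: "c = 32 * frame_cross_poly g t \<or> c = - (32 * frame_cross_poly g t)"
        using cross_polynomial[OF fr p] by blast
      have m: "sym_scale d (frame_cross_poly g t) \<in> sym.span {frame_cross_poly g t |g. frame_change f g \<and> (g 4 = f p \<or> g 4 = - f p)}" for d
        using g by (intro sym.span_scale sym.span_base) blast
      show "c \<in> sym.span {frame_cross_poly g t |g. frame_change f g \<and> (g 4 = f p \<or> g 4 = - f p)}"
        using c by (elim disjE) (simp_all only: m[of 32, folded sc(1)] m[of "- 32", folded sc(2)])
    qed
    show "{frame_cross_poly g t |g. frame_change f g \<and> (g 4 = f p \<or> g 4 = - f p)} \<subseteq>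
      sym.span {c. \<exists>T\<subseteq>D_set ({..<5} - {p}) f. type_4A1 T \<and> cross_attached (E6_set f t) T c}" (is "_ \<subseteq> sym.span ?C")
    proof clarify
      fix g assume g: "frame_change f g" "g 4 = f p \<or> g 4 = - f p"
      obtain T c where "T \<subseteq> D_set ({..<5} - {p}) f" "type_4A1 T" "cross_attached (E6_set f t) T c"
        and c: "c = 32 * frame_cross_poly g t \<or> c = - (32 * frame_cross_poly g t)"
        using cross_exists[OF fr p g] by blast
      then have m: "sym_scale d c \<in> sym.span ?C" for d by (intro sym.span_scale sym.span_base) blast
      have c1: "sym_scale (1/32) (32 * q) = q" for q :: "'n sym_alg" unfolding sc(1) by simp
      have c2: "sym_scale (- 1/32) (- (32 * q)) = q" for q :: "'n sym_alg" unfolding sc(2) by simp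
      have "frame_cross_poly g t = sym_scale (1/32) c \<or> frame_cross_poly g t = sym_scale (- 1/32) c"
        using c by (elim disjE) (simp_all only: c1 c2 simp_thms)
      then show "frame_cross_poly g t \<in> sym.span ?C" by (elim disjE) (simp_all only: m)
    qed
  qed
qed

section \<open>The planes spanned by crosses\<close>

text \<open>\<open>cross_factor\<close> in terms of the product \<open>e\<close> and the power sums
  \<open>s2\<close>, \<open>s4\<close> of four of the variables, so that it can be attached to the
  unordered index set \<open>{..<5} - {p}\<close>.\<close>

definition cross_core :: "'b::comm_ring_1 \<Rightarrow> 'b \<Rightarrow> 'b \<Rightarrow> 'b \<Rightarrow> 'b \<Rightarrow> 'b" where
  "cross_core e s2 s4 w t = 16 * t * e - 2 * w * (t ^ 4 - 2 * t ^ 2 * (s2 - w ^ 2) + 2 * w ^ 2 * s2 - 3 * w ^ 4 + 2 * s4 - s2 ^ 2)"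

definition plane_factor :: "(nat \<Rightarrow> real^'n) \<Rightarrow> real^'n \<Rightarrow> nat \<Rightarrow> 'n::finite sym_alg" where
  "plane_factor f t p = cross_core (\<Prod>i\<in>{..<5} - {p}. sym_incl (f i)) (\<Sum>i\<in>{..<5} - {p}. sym_incl (f i) ^ 2)
     (\<Sum>i\<in>{..<5} - {p}. sym_incl (f i) ^ 4) (sym_incl (f p)) (sym_incl t)"

definition cross_term :: "(nat \<Rightarrow> real^'n) \<Rightarrow> real^'n \<Rightarrow> nat \<Rightarrow> nat \<Rightarrow> nat \<Rightarrow> nat \<Rightarrow> nat \<Rightarrow> 'n::finite sym_alg" where
  "cross_term f t p a b c d = (sym_incl (f a) ^ 2 - sym_incl (f b) ^ 2) * ((sym_incl (f c) ^ 2 - sym_incl (f d) ^ 2) * plane_factor f t p)"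

definition quad :: "nat \<Rightarrow> nat \<Rightarrow> nat \<Rightarrow> nat \<Rightarrow> nat \<Rightarrow> bool" where
  "quad p a b c d \<longleftrightarrow> distinct [a, b, c, d, p] \<and> a < 5 \<and> b < 5 \<and> c < 5 \<and> d < 5 \<and> p < 5"

lemma quad_set:
  assumes "quad p a b c d"
  shows "{..<5} - {p} = {a, b, c, d}" "{..<5} = {a, b, c, d, p}"
proof -
  have "{a, b, c, d, p} \<subseteq> {..<5}" "card {a, b, c, d, p} = 5" using assms by (auto simp: quad_def)
  then have "{a, b, c, d, p} = {..<5}" by (intro card_subset_eq) simp_all
  then show "{..<5} = {a, b, c, d, p}" by simp
  then show "{..<5} - {p} = {a, b, c, d}" using assms by (auto simp: quad_def)
qed

lemma quad_exists:
  assumes "p < 5" shows "\<exists>a b c d. quad p a b c d"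
proof -
  have "p \<in> {0, 1, 2, 3, 4}" using assms by auto
  moreover have "quad 0 1 2 3 4" "quad 1 0 2 3 4" "quad 2 0 1 3 4" "quad 3 0 1 2 4" "quad 4 0 1 2 3"
    by (simp_all add: quad_def)
  ultimately show ?thesis by blast
qed

lemma cross_factor_eq_plane_factor:
  assumes "quad p a b c d"
  shows "cross_factor (sym_incl (f a)) (sym_incl (f b)) (sym_incl (f c)) (sym_incl (f d)) (sym_incl (f p)) (sym_incl t) = plane_factor f t p"
proof -
  have "a \<noteq> b" "a \<noteq> c" "a \<noteq> d" "b \<noteq> c" "b \<noteq> d" "c \<noteq> d" using assms by (auto simp: quad_def)
  then show ?thesis
    unfolding plane_factor_def quad_set(1)[OF assms] cross_core_def cross_factor_def by (simp add: add.assoc mult.assoc)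
qed

text \<open>Up to even polynomials as coefficients, \<open>cross_factor\<close> is a combination of
  \<open>k l u v\<close> and \<open>w\<close>. As the product of all five signs is 1, both of these
  change by \<open>s4\<close>.\<close>

lemma cross_factor_signs:
  assumes "s0 \<in> {1, -1}" "s1 \<in> {1, -1}" "s2 \<in> {1, -1}" "s3 \<in> {1, -1}" "s4 \<in> {1, -1::real}" "s0 * s1 * s2 * s3 * s4 = 1"
  shows "cross_factor (sym_incl (s0 *\<^sub>R k)) (sym_incl (s1 *\<^sub>R l)) (sym_incl (s2 *\<^sub>R u)) (sym_incl (s3 *\<^sub>R v)) (sym_incl (s4 *\<^sub>R w)) \<tau> =
    sym_scale (of_real s4) (cross_factor (sym_incl k) (sym_incl l) (sym_incl u) (sym_incl v) (sym_incl w) \<tau>)"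
proof -
  have m1: "sym_scale (of_real (- 1)) p = - p" for p :: "'a sym_alg" by (simp add: sym.scale_minus_left)
  show ?thesis
    using assms by (simp only: insert_iff empty_iff simp_thms) (elim disjE; simp add: sym_incl_minus cross_factor_def m1)
qed

lemma sym_incl_sign_square: "s \<in> {1, -1} \<Longrightarrow> sym_incl (s *\<^sub>R v) ^ 2 = sym_incl v ^ 2"
  by (auto simp: sym_incl_minus)

lemma frame_cross_poly_eq_term:
  assumes g: "frame_change f g" and p: "p < 5"
    and g4: "g 4 = f p \<or> g 4 = - f p" and fr: "frame f t K"
  shows "\<exists>a b c d s. quad p a b c d \<and> frame_cross_poly g t = sym_scale s (cross_term f t p a b c d)"
proof -
  obtain \<pi> s where pi: "\<pi> permutes {..<5}" and s: "\<forall>i<5. s i \<in> {1, -1::real}" "(\<Prod>i<5. s i) = 1"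
    and gs: "\<forall>i<5. g i = s i *\<^sub>R f (\<pi> i)" using g by (auto simp: frame_change_def)
  have lt: "\<pi> i < 5" if "i < 5" for i using permutes_in_image[OF pi, of i] that by simp
  have inj: "\<pi> i = \<pi> j \<longleftrightarrow> i = j" for i j using permutes_inj[OF pi] by (auto simp: inj_eq)
  have "\<pi> 4 = p"
  proof (rule ccontr)
    assume "\<pi> 4 \<noteq> p"
    then have "f (\<pi> 4) \<bullet> f p = 0" using frame_inner(2)[OF fr lt p, of 4] by simp
    moreover have "g 4 = s 4 *\<^sub>R f (\<pi> 4)" using gs by simp
    ultimately have "g 4 \<bullet> f p = 0" by simp
    then show False using g4 frame_inner(1)[OF fr] frame_inner(2)[OF fr p p] by auto
  qed
  then have q: "quad p (\<pi> 0) (\<pi> 1) (\<pi> 2) (\<pi> 3)" using lt by (auto simp: quad_def inj)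
  have ge: "g 0 = s 0 *\<^sub>R f (\<pi> 0)" "g 1 = s 1 *\<^sub>R f (\<pi> 1)" "g 2 = s 2 *\<^sub>R f (\<pi> 2)" "g 3 = s 3 *\<^sub>R f (\<pi> 3)" "g 4 = s 4 *\<^sub>R f p"
    using gs \<open>\<pi> 4 = p\<close> by simp_all
  have s': "s 0 \<in> {1, -1}" "s 1 \<in> {1, -1}" "s 2 \<in> {1, -1}" "s 3 \<in> {1, -1}" "s 4 \<in> {1, -1}" using s(1) by simp_all
  have prod: "s 0 * s 1 * s 2 * s 3 * s 4 = 1" using s(2) unfolding prod_lessThan_5 .
  have "frame_cross_poly g t = sym_scale (of_real (s 4)) (cross_term f t p (\<pi> 0) (\<pi> 1) (\<pi> 2) (\<pi> 3))"
    unfolding frame_cross_poly_def cross_poly_def cross_term_def ge sym_incl_sign_square[OF s'(1)] sym_incl_sign_square[OF s'(2)]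
      sym_incl_sign_square[OF s'(3)] sym_incl_sign_square[OF s'(4)] cross_factor_signs[OF s' prod]
      cross_factor_eq_plane_factor[OF q] sym_scale_mult_right ..
  then show ?thesis using q by blast
qed

lemma cross_term_mem_plane:
  assumes "quad p a b c d"
  shows "cross_term f t p a b c d \<in> cross_plane f t p"
proof -
  define g where "g n = [f a, f b, f c, f d, f p] ! n" for n
  have gv: "g 0 = f a" "g 1 = f b" "g 2 = f c" "g 3 = f d" "g 4 = f p" by (simp_all add: g_def)
  have "frame_change f g"
    by (rule frame_changeI[of a b c d p 1 1 1 1 1]) (use assms in \<open>simp_all add: quad_def gv del: One_nat_def\<close>)
  moreover have "frame_cross_poly g t = cross_term f t p a b c d"
    unfolding frame_cross_poly_def cross_poly_def cross_term_def gv cross_factor_eq_plane_factor[OF assms] ..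
  ultimately show ?thesis
    unfolding cross_plane_def using gv(5) by (intro sym.span_base) (metis (mono_tags, lifting) mem_Collect_eq)
qed

lemma cross_plane_eq_span_terms:
  assumes fr: "frame f t K" and p: "p < 5"
  shows "cross_plane f t p = sym.span {cross_term f t p a b c d | a b c d. quad p a b c d}"
proof
  show "sym.span {cross_term f t p a b c d | a b c d. quad p a b c d} \<subseteq> cross_plane f t p"
    using cross_term_mem_plane by (intro sym.span_minimal) (auto simp: cross_plane_def)
  show "cross_plane f t p \<subseteq> sym.span {cross_term f t p a b c d | a b c d. quad p a b c d}"
    unfolding cross_plane_def
  proof (intro sym.span_minimal sym.subspace_span, clarify)
    fix g assume "frame_change f g" "g 4 = f p \<or> g 4 = - f p"
    then obtain a b c d s where q: "quad p a b c d" and e: "frame_cross_poly g t = sym_scale s (cross_term f t p a b c d)"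
      using frame_cross_poly_eq_term[OF _ p _ fr] by blast
    show "frame_cross_poly g t \<in> sym.span {cross_term f t p a b c d | a b c d. quad p a b c d}"
      unfolding e using q by (intro sym.span_scale sym.span_base) blast
  qed
qed

text \<open>Four indices split into two pairs in three ways, each written in eight orders. The order
  affects only the sign, and the relation
  \<open>(A - D) (B - C) = (A - C) (B - D) - (A - B) (C - D)\<close> expresses the third splitting
  through the other two.\<close>

lemma cross_term_cases:
  assumes q: "quad p a b c d" and q': "quad p a' b' c' d'"
  shows "cross_term f t p a' b' c' d' \<in> sym.span {cross_term f t p a b c d, cross_term f t p a c b d}"
proof -
  let ?S = "sym.span {cross_term f t p a b c d, cross_term f t p a c b d}"
  let ?Q = "plane_factor f t p"
  define A B C D where "A = sym_incl (f a) ^ 2" and "B = sym_incl (f b) ^ 2" and "C = sym_incl (f c) ^ 2" and "D = sym_incl (f d) ^ 2"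
  have e: "cross_term f t p a b c d = (A - B) * ((C - D) * ?Q)" "cross_term f t p a c b d = (A - C) * ((B - D) * ?Q)"
    by (simp_all add: cross_term_def A_def B_def C_def D_def)
  have 1: "(A - B) * ((C - D) * ?Q) \<in> ?S" and 2: "(A - C) * ((B - D) * ?Q) \<in> ?S"
    unfolding e by (auto intro: sym.span_base)
  have "(A - D) * ((B - C) * ?Q) = (A - C) * ((B - D) * ?Q) - (A - B) * ((C - D) * ?Q)"
    by (simp add: algebra_simps)
  then have 3: "(A - D) * ((B - C) * ?Q) \<in> ?S" using sym.span_diff[OF 2 1] by simp
  have all: "(x - y) * ((z - w) * ?Q) \<in> ?S \<and> (z - w) * ((x - y) * ?Q) \<in> ?S \<and> (y - x) * ((z - w) * ?Q) \<in> ?S \<and> (z - w) * ((y - x) * ?Q) \<in> ?S \<and>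
    (x - y) * ((w - z) * ?Q) \<in> ?S \<and> (w - z) * ((x - y) * ?Q) \<in> ?S \<and> (y - x) * ((w - z) * ?Q) \<in> ?S \<and> (w - z) * ((y - x) * ?Q) \<in> ?S"
    if "(x - y) * ((z - w) * ?Q) \<in> ?S" for x y z w
  proof -
    have m: "- ((x - y) * ((z - w) * ?Q)) \<in> ?S" by (rule sym.span_neg[OF that])
    have eqs: "(z - w) * ((x - y) * ?Q) = (x - y) * ((z - w) * ?Q)" "(y - x) * ((z - w) * ?Q) = - ((x - y) * ((z - w) * ?Q))"
      "(z - w) * ((y - x) * ?Q) = - ((x - y) * ((z - w) * ?Q))" "(x - y) * ((w - z) * ?Q) = - ((x - y) * ((z - w) * ?Q))"
      "(w - z) * ((x - y) * ?Q) = - ((x - y) * ((z - w) * ?Q))" "(y - x) * ((w - z) * ?Q) = (x - y) * ((z - w) * ?Q)"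
      "(w - z) * ((y - x) * ?Q) = (x - y) * ((z - w) * ?Q)"
      by (simp_all add: algebra_simps)
    show ?thesis unfolding eqs using that m by blast
  qed
  have set: "a' \<in> {a, b, c, d}" "b' \<in> {a, b, c, d}" "c' \<in> {a, b, c, d}" "d' \<in> {a, b, c, d}"
    using quad_set(1)[OF q] quad_set(1)[OF q'] by auto
  have dist: "a' \<noteq> b'" "a' \<noteq> c'" "a' \<noteq> d'" "b' \<noteq> c'" "b' \<noteq> d'" "c' \<noteq> d'" using q' by (auto simp: quad_def)
  show ?thesis
    unfolding cross_term_def[of f t p a' b' c' d']
    using set dist by (elim insertE emptyE; simp only: A_def[symmetric] B_def[symmetric] C_def[symmetric] D_def[symmetric] simp_thms all[OF 1] all[OF 2] all[OF 3])
qed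

lemma cross_plane_eq_span_pair:
  assumes fr: "frame f t K" and q: "quad p a b c d"
  shows "cross_plane f t p = sym.span {cross_term f t p a b c d, cross_term f t p a c b d}"
proof
  have p: "p < 5" using q by (simp add: quad_def)
  have q2: "quad p a c b d" using q by (auto simp: quad_def)
  show "cross_plane f t p \<subseteq> sym.span {cross_term f t p a b c d, cross_term f t p a c b d}"
    unfolding cross_plane_eq_span_terms[OF fr p]
  proof (intro sym.span_minimal sym.subspace_span, clarify)
    fix a' b' c' d' assume "quad p a' b' c' d'"
    then show "cross_term f t p a' b' c' d' \<in> sym.span {cross_term f t p a b c d, cross_term f t p a c b d}"
      by (rule cross_term_cases[OF q])
  qed
  show "sym.span {cross_term f t p a b c d, cross_term f t p a c b d} \<subseteq> cross_plane f t p"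
    using cross_term_mem_plane[OF q] cross_term_mem_plane[OF q2]
    by (intro sym.span_minimal) (auto simp: cross_plane_def)
qed

lemma sym_eval_prod: "sym_eval x (\<Prod>i\<in>I. h i) = (\<Prod>i\<in>I. sym_eval x (h i))"
  by (induction I rule: infinite_finite_induct) (simp_all add: sym_eval_mult sym_eval_one)

lemma cross_term_nonzero:
  fixes f :: "nat \<Rightarrow> real^'n::finite"
  assumes fr: "frame f t K" and q: "quad p a b c d"
  shows "cross_term f t p a b c d \<noteq> 0"
proof
  assume 0: "cross_term f t p a b c d = 0"
  \<comment> \<open>At the chosen point \<open>f p\<close> takes the value 0, which leaves of the
    plane factor only the term \<open>16 t e\<close>; the other \<open>f i\<close> take distinct
    positive values and \<open>t\<close> the value 1. The divisors \<open>K\<close> and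
    \<open>3 K\<close> are the squared lengths of the frame vectors.\<close>
  define X where "X i = (if i = p then 0 else real i + 1)" for i
  define x where "x = fvec f t (\<lambda>i. X i / K) (1 / (3 * K))"
  note fi = frame_inner[OF fr]
  have ev: "sym_eval x (sym_incl (f i)) = of_real (X i)" if "i < 5" for i
    unfolding sym_eval_incl x_def fvec_inner(2)[OF fr that] using fi(1) by simp
  have evt: "sym_eval x (sym_incl t) = 1"
    unfolding sym_eval_incl inner_commute[of t] x_def fvec_inner(3)[OF fr] using fi(1) by simp
  have lt: "a < 5" "b < 5" "c < 5" "d < 5" "p < 5" and ne: "a \<noteq> p" "b \<noteq> p" "c \<noteq> p" "d \<noteq> p" "a \<noteq> b" "c \<noteq> d"
    using q by (auto simp: quad_def)
  have P: "(\<Prod>i\<in>{..<5} - {p}. sym_eval x (sym_incl (f i))) = (\<Prod>i\<in>{..<5} - {p}. of_real (X i))"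
    by (intro prod.cong) (auto simp: ev)
  have w: "sym_eval x (sym_incl (f p)) = 0" using ev[OF lt(5)] by (simp add: X_def)
  have nz: "X i \<noteq> 0" if "i \<noteq> p" for i using that by (simp add: X_def add_nonneg_eq_0_iff)
  have "sym_eval x (plane_factor f t p) = 16 * (\<Prod>i\<in>{..<5} - {p}. of_real (X i))"
    unfolding plane_factor_def cross_core_def sym_eval_diff sym_eval_mult sym_eval_numeral evt sym_eval_prod P w by simp
  also have "\<dots> \<noteq> 0" using nz by simp
  finally have Q: "sym_eval x (plane_factor f t p) \<noteq> 0" .
  have sq: "(of_real (X i) :: complex) ^ 2 - of_real (X j) ^ 2 \<noteq> 0" if "i \<noteq> p" "j \<noteq> p" "i \<noteq> j" for i j
  proof -
    have "(real i + 1) ^ 2 \<noteq> (real j + 1) ^ 2" using that by (simp add: power2_eq_iff_nonneg)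
    then have "X i ^ 2 - X j ^ 2 \<noteq> 0" using that by (simp add: X_def)
    then show ?thesis by (metis of_real_0 of_real_diff of_real_eq_iff of_real_power)
  qed
  have "sym_eval x (cross_term f t p a b c d) \<noteq> 0"
    unfolding cross_term_def sym_eval_mult sym_eval_diff sym_eval_power ev[OF lt(1)] ev[OF lt(2)] ev[OF lt(3)] ev[OF lt(4)]
    using sq ne Q by simp
  then show False by (simp add: 0 sym_eval_zero)
qed

section \<open>The action of the Weyl group\<close>

text \<open>Stated for all even signed permutations fixing \<open>t\<close>, to cover both the
  transpositions, which relabel the indices, and the pairs of sign changes, which act by the scalar
  \<open>s p\<close>.\<close>

lemma sym_act_cross_term:
  fixes f :: "nat \<Rightarrow> real^'n::finite"
  assumes w: "linear w" "w t = t" and wf: "\<And>k. k < 5 \<Longrightarrow> w (f k) = s k *\<^sub>R f (\<sigma> k)"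
    and \<sigma>: "\<sigma> permutes {..<5}" and s: "\<And>k. k < 5 \<Longrightarrow> s k \<in> {1, -1::real}" "(\<Prod>k<5. s k) = 1"
    and q: "quad p a b c d"
  shows "quad (\<sigma> p) (\<sigma> a) (\<sigma> b) (\<sigma> c) (\<sigma> d)"
    "sym_act w (cross_term f t p a b c d) = sym_scale (of_real (s p)) (cross_term f t (\<sigma> p) (\<sigma> a) (\<sigma> b) (\<sigma> c) (\<sigma> d))"
proof -
  have lt: "a < 5" "b < 5" "c < 5" "d < 5" "p < 5" using q by (auto simp: quad_def)
  have \<sigma>lt: "\<sigma> k < 5" if "k < 5" for k using permutes_in_image[OF \<sigma>, of k] that by simp
  have inj: "\<sigma> i = \<sigma> j \<longleftrightarrow> i = j" for i j using permutes_inj[OF \<sigma>] by (auto simp: inj_eq)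
  show q': "quad (\<sigma> p) (\<sigma> a) (\<sigma> b) (\<sigma> c) (\<sigma> d)"
    using q \<sigma>lt unfolding quad_def by (simp add: inj)
  have x: "sym_act w (sym_incl (f k)) = sym_incl (s k *\<^sub>R f (\<sigma> k))" if "k < 5" for k
    using sym_act_incl[OF w(1)] wf[OF that] by simp
  have tt: "sym_act w (sym_incl t) = sym_incl t" using sym_act_incl[OF w(1), of t] w(2) by simp
  have ne: "a \<notin> {b, c, d, p}" "b \<notin> {c, d, p}" "c \<notin> {d, p}" "d \<noteq> p" using q by (auto simp: quad_def)
  have pr: "s a * s b * s c * s d * s p = 1"
    using s(2) unfolding quad_set(2)[OF q] using ne by (simp add: mult.assoc)
  have Q: "sym_act w (plane_factor f t p) = sym_scale (of_real (s p)) (plane_factor f t (\<sigma> p))"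
  proof -
    have "sym_act w (plane_factor f t p) = cross_factor (sym_incl (s a *\<^sub>R f (\<sigma> a))) (sym_incl (s b *\<^sub>R f (\<sigma> b)))
      (sym_incl (s c *\<^sub>R f (\<sigma> c))) (sym_incl (s d *\<^sub>R f (\<sigma> d))) (sym_incl (s p *\<^sub>R f (\<sigma> p))) (sym_incl t)"
      unfolding cross_factor_eq_plane_factor[OF q, symmetric] cross_factor_def sym_act_hom sym_act_numeral tt x[OF lt(1)] x[OF lt(2)]
        x[OF lt(3)] x[OF lt(4)] x[OF lt(5)] ..
    then show ?thesis
      unfolding cross_factor_signs[OF s(1)[OF lt(1)] s(1)[OF lt(2)] s(1)[OF lt(3)] s(1)[OF lt(4)] s(1)[OF lt(5)] pr]
        cross_factor_eq_plane_factor[OF q'] .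
  qed
  show "sym_act w (cross_term f t p a b c d) = sym_scale (of_real (s p)) (cross_term f t (\<sigma> p) (\<sigma> a) (\<sigma> b) (\<sigma> c) (\<sigma> d))"
    unfolding cross_term_def sym_act_hom x[OF lt(1)] x[OF lt(2)] x[OF lt(3)] x[OF lt(4)] Q
      sym_incl_sign_square[OF s(1)[OF lt(1)]] sym_incl_sign_square[OF s(1)[OF lt(2)]]
      sym_incl_sign_square[OF s(1)[OF lt(3)]] sym_incl_sign_square[OF s(1)[OF lt(4)]] sym_scale_mult_right ..
qed

lemma root_refl_double:
  assumes "v \<bullet> v = 2 * K" "K \<noteq> 0"
  shows "root_refl (2 *\<^sub>R v) x = x - (x \<bullet> v / K) *\<^sub>R v"
  using assms by (simp add: root_refl_def cartan_int_def)

lemma root_refl_frame: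
  fixes f :: "nat \<Rightarrow> 'a::euclidean_space"
  assumes fr: "frame f t K" and ij: "i < 5" "j < 5" "i \<noteq> j" and k: "k < 5"
  shows "root_refl (2 *\<^sub>R (f i - f j)) (f k) = f (Transposition.transpose i j k)" "root_refl (2 *\<^sub>R (f i - f j)) t = t"
    "root_refl (2 *\<^sub>R (f i + f j)) (root_refl (2 *\<^sub>R (f i - f j)) (f k)) = (if k = i \<or> k = j then -1 else 1) *\<^sub>R f k"
    "root_refl (2 *\<^sub>R (f i + f j)) t = t"
proof -
  note fi = frame_inner[OF fr]
  have K: "K \<noteq> 0" using fi(1) by simp
  have m: "root_refl (2 *\<^sub>R (f i - f j)) x = x - (x \<bullet> (f i - f j) / K) *\<^sub>R (f i - f j)" for x
    using K ij by (intro root_refl_double) (simp_all add: inner_diff_left inner_diff_right fi)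
  have p: "root_refl (2 *\<^sub>R (f i + f j)) x = x - (x \<bullet> (f i + f j) / K) *\<^sub>R (f i + f j)" for x
    using K ij by (intro root_refl_double) (simp_all add: inner_add_left inner_add_right fi)
  show 1: "root_refl (2 *\<^sub>R (f i - f j)) (f k) = f (Transposition.transpose i j k)"
    unfolding m using K ij k by (auto simp: inner_diff_right fi(2) Transposition.transpose_def)
  show "root_refl (2 *\<^sub>R (f i - f j)) t = t" "root_refl (2 *\<^sub>R (f i + f j)) t = t"
    unfolding m p using ij by (simp_all add: inner_diff_right inner_add_right fi(4))
  show "root_refl (2 *\<^sub>R (f i + f j)) (root_refl (2 *\<^sub>R (f i - f j)) (f k)) = (if k = i \<or> k = j then -1 else 1) *\<^sub>R f k"
    unfolding 1 p using K ij k by (auto simp: inner_add_right fi(2) Transposition.transpose_def)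
qed

text \<open>The product of the reflections in two orthogonal roots spanning the plane of
  \<open>f i\<close> and \<open>f j\<close>: it is -1 on that plane and the identity on the
  orthogonal complement.\<close>

definition flip :: "(nat \<Rightarrow> 'a::euclidean_space) \<Rightarrow> nat \<Rightarrow> nat \<Rightarrow> 'a \<Rightarrow> 'a" where
  "flip f i j = root_refl (2 *\<^sub>R (f i + f j)) \<circ> root_refl (2 *\<^sub>R (f i - f j))"

lemma root_refl_weyl: "a \<in> R \<Longrightarrow> root_refl a \<in> weyl_group R"
  using weyl_refl[OF weyl_id, of a R] by simp

lemma transposition_weyl:
  assumes "i < 5" "j < 5" "i \<noteq> j"
  shows "root_refl (2 *\<^sub>R (f i - f j)) \<in> weyl_group (E6_set f t)" "flip f i j \<in> weyl_group (E6_set f t)"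
proof -
  have "2 *\<^sub>R (f i - f j) \<in> E6_set f t" "2 *\<^sub>R (f i + f j) \<in> E6_set f t"
    using D_set_memI[of i "{..<5}" j f] assms by (auto simp: E6_set_def)
  then show "root_refl (2 *\<^sub>R (f i - f j)) \<in> weyl_group (E6_set f t)" "flip f i j \<in> weyl_group (E6_set f t)"
    unfolding flip_def by (auto intro: root_refl_weyl weyl_refl)
qed

lemma flip_cross_term:
  fixes f :: "nat \<Rightarrow> real^'n::finite"
  assumes fr: "frame f t K" and ij: "i < 5" "j < 5" "i \<noteq> j" and q: "quad p a b c d"
  shows "sym_act (flip f i j) (cross_term f t p a b c d) = sym_scale (if p = i \<or> p = j then -1 else 1) (cross_term f t p a b c d)"
proof -
  define s where "s k = (if k = i \<or> k = j then -1 else 1 :: real)" for k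
  have "(\<Prod>k<5. s k) = (\<Prod>k\<in>{i, j}. s k)"
    using ij by (intro prod.mono_neutral_right) (auto simp: s_def)
  then have 1: "(\<Prod>k<5. s k) = 1" using ij by (simp add: s_def)
  have "sym_act (flip f i j) (cross_term f t p a b c d) = sym_scale (of_real (s p)) (cross_term f t (id p) (id a) (id b) (id c) (id d))"
  proof (rule sym_act_cross_term(2)[OF _ _ _ permutes_id _ 1 q])
    show "linear (flip f i j)" unfolding flip_def by (intro linear_compose linear_root_refl)
    show "flip f i j t = t" using root_refl_frame(2,4)[OF fr ij ij(1)] by (simp add: flip_def)
    show "flip f i j (f k) = s k *\<^sub>R f (id k)" if "k < 5" for k
      using root_refl_frame(3)[OF fr ij that] by (simp add: flip_def s_def)
    show "s k \<in> {1, -1}" for k by (simp add: s_def)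
  qed
  then show ?thesis by (simp add: s_def)
qed

lemma transposition_cross_term:
  fixes f :: "nat \<Rightarrow> real^'n::finite"
  assumes fr: "frame f t K" and ij: "i < 5" "j < 5" "i \<noteq> j" and q: "quad p a b c d"
  shows "sym_act (root_refl (2 *\<^sub>R (f i - f j))) (cross_term f t p a b c d) =
    cross_term f t (Transposition.transpose i j p) (Transposition.transpose i j a) (Transposition.transpose i j b) (Transposition.transpose i j c) (Transposition.transpose i j d)"
    "quad (Transposition.transpose i j p) (Transposition.transpose i j a) (Transposition.transpose i j b) (Transposition.transpose i j c) (Transposition.transpose i j d)"
proof -
  have s: "Transposition.transpose i j permutes {..<5}" using ij by (simp add: permutes_swap_id)
  have wf: "root_refl (2 *\<^sub>R (f i - f j)) (f k) = 1 *\<^sub>R f (Transposition.transpose i j k)" if "k < 5" for k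
    using root_refl_frame(1)[OF fr ij that] by simp
  note r = sym_act_cross_term[where s = "\<lambda>_. 1" and \<sigma> = "Transposition.transpose i j" and f = f and t = t, OF linear_root_refl root_refl_frame(2)[OF fr ij ij(1)] wf s _ _ q]
  show "sym_act (root_refl (2 *\<^sub>R (f i - f j))) (cross_term f t p a b c d) =
    cross_term f t (Transposition.transpose i j p) (Transposition.transpose i j a) (Transposition.transpose i j b) (Transposition.transpose i j c) (Transposition.transpose i j d)"
    using r(2) by simp
  show "quad (Transposition.transpose i j p) (Transposition.transpose i j a) (Transposition.transpose i j b) (Transposition.transpose i j c) (Transposition.transpose i j d)"
    using r(1) by simp
qed

lemma subspace_sym_act_eigen: "sym.subspace {v. sym_act w v = sym_scale e v}"
  by (rule sym.subspaceI) (simp_all add: sym_act_add sym_act_scale sym.scale_right_distrib mult.commute)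

lemma flip_cross_plane:
  fixes f :: "nat \<Rightarrow> real^'n::finite"
  assumes fr: "frame f t K" and ij: "i < 5" "j < 5" "i \<noteq> j" and p: "p < 5" and v: "v \<in> cross_plane f t p"
  shows "sym_act (flip f i j) v = sym_scale (if p = i \<or> p = j then -1 else 1) v"
proof -
  have "cross_plane f t p \<subseteq> {v. sym_act (flip f i j) v = sym_scale (if p = i \<or> p = j then -1 else 1) v}"
    unfolding cross_plane_eq_span_terms[OF fr p]
    by (intro sym.span_minimal subspace_sym_act_eigen) (use flip_cross_term[OF fr ij] in blast)
  then show ?thesis using v by blast
qed

text \<open>Every index other than \<open>p\<close> lies in exactly one of the pairs \<open>{a, b}\<close> and \<open>{c, d}\<close>, so that
  the product of the projections onto the fixed spaces of the flips of these pairs kills the planes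
  other than the one of \<open>p\<close>.\<close>

lemma plane_projection:
  fixes f :: "nat \<Rightarrow> real^'n::finite"
  assumes fr: "frame f t K" and p: "p < 5"
  obtains e where "\<And>x y. e (x + y) = e x + e y" "\<And>v. v \<in> cross_plane f t p \<Longrightarrow> e v = v"
    "\<And>q v. q < 5 \<Longrightarrow> q \<noteq> p \<Longrightarrow> v \<in> cross_plane f t q \<Longrightarrow> e v = 0"
    "\<And>U u. subrep (weyl_group (E6_set f t)) U \<Longrightarrow> u \<in> U \<Longrightarrow> e u \<in> U"
proof -
  obtain a b c d where q: "quad p a b c d" using quad_exists[OF p] by blast
  then have ab: "a < 5" "b < 5" "a \<noteq> b" and cd: "c < 5" "d < 5" "c \<noteq> d" by (auto simp: quad_def)
  define h where "h u = u + sym_act (flip f c d) u" for u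
  \<comment> \<open>The factor 1/4 compensates the doubling by each of the two sums on the plane of
    \<open>p\<close>. Being a combination of group elements, \<open>e\<close> preserves every
    subrepresentation, which the irreducibility relies on.\<close>
  define e where "e u = sym_scale (1/4) (h u + sym_act (flip f a b) (h u))" for u
  have h_add: "h (x + y) = h x + h y" for x y by (simp add: h_def sym_act_add)
  have two: "v + v = sym_scale 2 v" for v :: "'n sym_alg" by (simp add: sym_scale_numeral)
  show ?thesis
  proof (rule that[of e])
    show "e (x + y) = e x + e y" for x y
      by (simp add: e_def h_add sym_act_add sym.scale_right_distrib)
    show "e v = v" if v: "v \<in> cross_plane f t p" for v
    proof -
      have "h v = sym_scale 2 v"
        using flip_cross_plane[OF fr cd p v] q by (auto simp: h_def quad_def two)
      moreover have "sym_act (flip f a b) v = v"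
        using flip_cross_plane[OF fr ab p v] q by (auto simp: quad_def)
      ultimately show ?thesis by (simp add: e_def sym_act_scale two)
    qed
    show "e v = 0" if r: "r < 5" "r \<noteq> p" and v: "v \<in> cross_plane f t r" for r v
    proof (cases "r = c \<or> r = d")
      case True
      then have "h v = 0" using flip_cross_plane[OF fr cd r(1) v] by (simp add: h_def)
      then show ?thesis by (simp add: e_def)
    next
      case False
      then have "r = a \<or> r = b" using quad_set(1)[OF q] r by blast
      then have "sym_act (flip f a b) v = - v" using flip_cross_plane[OF fr ab r(1) v] by simp
      moreover have "h v = sym_scale 2 v"
        using flip_cross_plane[OF fr cd r(1) v] False by (simp add: h_def two)
      ultimately show ?thesis by (simp add: e_def sym_act_scale)
    qed
    show "e u \<in> U" if U: "subrep (weyl_group (E6_set f t)) U" and u: "u \<in> U" for U u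
    proof -
      have sub: "sym.subspace U" and act: "\<And>w v. w \<in> weyl_group (E6_set f t) \<Longrightarrow> v \<in> U \<Longrightarrow> sym_act w v \<in> U"
        using U by (auto simp: subrep_def)
      have "h u \<in> U" unfolding h_def using u by (intro sym.subspace_add[OF sub] act transposition_weyl cd)
      then show ?thesis
        unfolding e_def by (intro sym.subspace_scale[OF sub] sym.subspace_add[OF sub] act transposition_weyl ab)
    qed
  qed
qed

lemma additive_sum:
  assumes "\<And>x y. e (x + y) = e x + (e y :: 'b::ab_group_add)"
  shows "e (\<Sum>i\<in>I. h i) = (\<Sum>i\<in>I. e (h i))"
proof -
  have "e 0 = 0" using assms[of 0 0] by simp
  then show ?thesis by (induction I rule: infinite_finite_induct) (simp_all add: assms)
qed

text \<open>The projection onto the plane of \<open>p\<close> reads off the component at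
  \<open>p\<close> from the sum.\<close>

lemma cross_planes_independent:
  fixes f :: "nat \<Rightarrow> real^'n::finite"
  assumes fr: "frame f t K" and v: "\<And>p. p < 5 \<Longrightarrow> v p \<in> cross_plane f t p" and v': "\<And>p. p < 5 \<Longrightarrow> v' p \<in> cross_plane f t p"
    and eq: "(\<Sum>p<5. v p) = (\<Sum>p<5. v' p)" and p: "p < 5"
  shows "v p = v' p"
proof -
  obtain e where e: "\<And>x y. e (x + y) = e x + e y" "\<And>v. v \<in> cross_plane f t p \<Longrightarrow> e v = v"
    "\<And>q v. q < 5 \<Longrightarrow> q \<noteq> p \<Longrightarrow> v \<in> cross_plane f t q \<Longrightarrow> e v = 0"
    using plane_projection[OF fr p] by metis
  have "e (\<Sum>q<5. u q) = u p" if u: "\<And>q. q < 5 \<Longrightarrow> u q \<in> cross_plane f t q" for u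
  proof -
    have "e (\<Sum>q<5. u q) = (\<Sum>q<5. e (u q))" by (rule additive_sum[OF e(1)])
    also have "\<dots> = (\<Sum>q<5. if q = p then u p else 0)"
      using e(2,3) u by (intro sum.cong) auto
    finally show ?thesis using p by simp
  qed
  from this[of v] this[of v'] show ?thesis using v v' eq by simp
qed

lemma cross_plane_subset_coble:
  fixes f :: "nat \<Rightarrow> real^'n::finite"
  assumes fr: "frame f t K"
  shows "cross_plane f t p \<subseteq> coble (E6_set f t)"
  unfolding cross_plane_def
proof (intro sym.span_minimal)
  show "sym.subspace (coble (E6_set f t))" by (simp add: coble_def)
  show "{frame_cross_poly g t |g. frame_change f g \<and> (g 4 = f p \<or> g 4 = - f p)} \<subseteq> coble (E6_set f t)"
  proof clarify
    fix g assume g: "frame_change f g"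
    \<comment> \<open>\<open>h\<close> is the image of \<open>g\<close> under the reflection in
      \<open>2 (g 2 + g 3)\<close>, so the cross of \<open>g\<close> is a difference of two
      generators.\<close>
    define h where "h n = [g 0, g 1, - g 3, - g 2, g 4] ! n" for n
    have hv: "h 0 = g 0" "h 1 = g 1" "h 2 = - g 3" "h 3 = - g 2" "h 4 = g 4" by (simp_all add: h_def)
    have "frame_change g h"
      by (rule frame_changeI[of 0 1 3 2 4 1 1 "-1" "-1" 1]) (simp_all add: hv del: One_nat_def)
    then have h: "frame_change f h" by (rule frame_change_trans[OF g])
    have e: "frame_cross_poly g t = frame_coble_poly g t - frame_coble_poly h t"
      unfolding frame_cross_poly_def frame_coble_poly_def hv sym_incl_minus by (rule coble_poly_reflect[symmetric])
    show "frame_cross_poly g t \<in> coble (E6_set f t)"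
      unfolding coble_eq_span[OF fr] e using g h by (intro sym.span_diff sym.span_base; blast)
  qed
qed

lemma frame_change_index:
  fixes f :: "nat \<Rightarrow> 'a::euclidean_space"
  assumes "frame_change f g" "i < 5"
  obtains p where "p < 5" "g i = f p \<or> g i = - f p"
proof -
  obtain \<pi> s where pi: "\<pi> permutes {..<5}" and s: "\<forall>i<5. s i \<in> {1, -1::real}"
    and gs: "\<forall>i<5. g i = s i *\<^sub>R f (\<pi> i)" using assms(1) by (auto simp: frame_change_def)
  have "\<pi> i < 5" using permutes_in_image[OF pi, of i] assms(2) by simp
  then show ?thesis using that[of "\<pi> i"] gs s assms(2) by auto
qed

lemma coble_eq_plane_sums:
  fixes f :: "nat \<Rightarrow> real^'n::finite"
  assumes fr: "frame f t K"
  shows "coble (E6_set f t) = {\<Sum>p<5. v p | v. \<forall>p<5. v p \<in> cross_plane f t p}" (is "_ = ?V")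
proof
  have subp: "sym.subspace (cross_plane f t p)" for p by (simp add: cross_plane_def)
  have subV: "sym.subspace ?V"
  proof (rule sym.subspaceI)
    show "0 \<in> ?V" by (intro CollectI exI[of _ "\<lambda>_. 0"]) (simp add: sym.subspace_0[OF subp])
    show "x + y \<in> ?V" if x: "x \<in> ?V" and y: "y \<in> ?V" for x y
    proof -
      obtain v where v: "x = (\<Sum>p<5. v p)" "\<forall>p<5. v p \<in> cross_plane f t p" using x by blast
      obtain v' where v': "y = (\<Sum>p<5. v' p)" "\<forall>p<5. v' p \<in> cross_plane f t p" using y by blast
      show ?thesis
        by (intro CollectI exI[of _ "\<lambda>p. v p + v' p"]) (use v v' sym.subspace_add[OF subp] in \<open>simp add: sum.distrib\<close>)
    qed
    show "sym_scale c x \<in> ?V" if x: "x \<in> ?V" for c x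
    proof -
      obtain v where v: "x = (\<Sum>p<5. v p)" "\<forall>p<5. v p \<in> cross_plane f t p" using x by blast
      show ?thesis
        by (intro CollectI exI[of _ "\<lambda>p. sym_scale c (v p)"]) (use v sym.subspace_scale[OF subp] in \<open>simp add: sym.scale_sum_right\<close>)
    qed
  qed
  have plane: "x \<in> ?V" if "p < 5" "x \<in> cross_plane f t p" for p x
  proof -
    have "x = (\<Sum>q<5. if q = p then x else 0)" using that(1) by simp
    moreover have "\<forall>q<5. (if q = p then x else 0) \<in> cross_plane f t q" using that(2) sym.subspace_0[OF subp] by simp
    ultimately show ?thesis by (intro CollectI exI[of _ "\<lambda>q. if q = p then x else 0"]) blast
  qed
  have cross: "frame_cross_poly g t \<in> ?V" if g: "frame_change f g" for g
  proof -
    obtain p where p: "p < 5" "g 4 = f p \<or> g 4 = - f p" by (rule frame_change_index[OF g, of 4]) auto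
    have "frame_cross_poly g t \<in> cross_plane f t p"
      unfolding cross_plane_def using g p(2) by (intro sym.span_base) blast
    then show ?thesis using plane p(1) by blast
  qed
  show "coble (E6_set f t) \<subseteq> ?V"
    unfolding coble_eq_span[OF fr]
  proof (intro sym.span_minimal subV, rule subsetI, elim CollectE exE conjE)
    fix x g assume x: "x = frame_coble_poly g t" and g: "frame_change f g"
    \<comment> \<open>\<open>h\<close> and \<open>k\<close> are the cyclic shifts of the last three
      vectors; the crosses of \<open>g\<close>, \<open>h\<close>, \<open>k\<close> are the three
      terms of \<open>coble_poly_eq_crosses\<close>, each lying in the plane of its last
      index.\<close>
    define h where "h n = [g 0, g 1, g 3, g 4, g 2] ! n" for n
    define k where "k n = [g 0, g 1, g 4, g 2, g 3] ! n" for n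
    have hv: "h 0 = g 0" "h 1 = g 1" "h 2 = g 3" "h 3 = g 4" "h 4 = g 2" by (simp_all add: h_def)
    have kv: "k 0 = g 0" "k 1 = g 1" "k 2 = g 4" "k 3 = g 2" "k 4 = g 3" by (simp_all add: k_def)
    have "frame_change g h"
      by (rule frame_changeI[of 0 1 3 4 2 1 1 1 1 1]) (simp_all add: hv del: One_nat_def)
    moreover have "frame_change g k"
      by (rule frame_changeI[of 0 1 4 2 3 1 1 1 1 1]) (simp_all add: kv del: One_nat_def)
    ultimately have hk: "frame_change f h" "frame_change f k" using frame_change_trans[OF g] by blast+
    have "2 * frame_coble_poly g t = frame_cross_poly g t + frame_cross_poly h t + frame_cross_poly k t"
      unfolding frame_cross_poly_def frame_coble_poly_def hv kv by (rule coble_poly_eq_crosses)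
    then have s: "sym_scale 2 x = frame_cross_poly g t + frame_cross_poly h t + frame_cross_poly k t"
      unfolding sym_scale_numeral x .
    have "sym_scale 2 x \<in> ?V"
      unfolding s by (rule sym.subspace_add[OF subV sym.subspace_add[OF subV cross[OF g] cross[OF hk(1)]] cross[OF hk(2)]])
    then have "sym_scale (1/2) (sym_scale 2 x) \<in> ?V" by (rule sym.subspace_scale[OF subV])
    then show "x \<in> ?V" by simp
  qed
  show "?V \<subseteq> coble (E6_set f t)"
  proof (rule subsetI, elim CollectE exE conjE)
    fix x v assume x: "x = (\<Sum>p<5. v p)" and v: "\<forall>p<5. v p \<in> cross_plane f t p"
    have "sym.subspace (coble (E6_set f t))" by (simp add: coble_def)
    then show "x \<in> coble (E6_set f t)"
      unfolding x using v cross_plane_subset_coble[OF fr] by (intro sym.subspace_sum) auto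
  qed
qed

section \<open>The Coble space as a representation of the whole Weyl group\<close>

lemma root_refl_involution: "a \<noteq> 0 \<Longrightarrow> root_refl a (root_refl a x) = x"
  by (simp add: root_refl_def cartan_int_def inner_diff_left)

lemma weyl_group_isometry:
  assumes R: "root_system R" and w: "w \<in> weyl_group R"
  shows "linear w \<and> (\<forall>x y. w x \<bullet> w y = x \<bullet> y) \<and> w ` R = R"
  using w
proof induction
  case weyl_id
  show ?case by (auto intro!: linearI)
next
  case (weyl_refl w a)
  have a: "a \<noteq> 0" using R weyl_refl by (auto simp: root_system_nonzero)
  have img: "root_refl a ` R = R"
  proof
    show "root_refl a ` R \<subseteq> R" using root_system_refl[OF R weyl_refl(2)] by blast
    show "R \<subseteq> root_refl a ` R"
    proof
      fix x assume "x \<in> R"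
      then show "x \<in> root_refl a ` R"
        using root_system_refl[OF R weyl_refl(2)] by (intro image_eqI[of _ _ "root_refl a x"]) (simp_all add: root_refl_involution[OF a])
    qed
  qed
  have l: "linear (root_refl a \<circ> w)" using weyl_refl.IH by (intro linear_compose linear_root_refl) simp
  have "(root_refl a \<circ> w) ` R = R" using weyl_refl.IH img by (simp only: image_comp[symmetric])
  moreover have "\<forall>x y. (root_refl a \<circ> w) x \<bullet> (root_refl a \<circ> w) y = x \<bullet> y"
    using weyl_refl.IH root_refl_inner[OF a] by simp
  ultimately show ?case using l by blast
qed

lemma D_set_image:
  fixes f :: "nat \<Rightarrow> 'a::euclidean_space"
  assumes "linear w" shows "D_set I (w \<circ> f) = w ` D_set I f"
proof -
  have e: "w (2 *\<^sub>R (s *\<^sub>R f i + r *\<^sub>R f j)) = 2 *\<^sub>R (s *\<^sub>R (w \<circ> f) i + r *\<^sub>R (w \<circ> f) j)" for s r i j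
    by (simp add: linear_scale[OF assms] linear_add[OF assms])
  show ?thesis
  proof
    show "D_set I (w \<circ> f) \<subseteq> w ` D_set I f"
      unfolding D_set_def e[symmetric] by blast
    show "w ` D_set I f \<subseteq> D_set I (w \<circ> f)"
      unfolding D_set_def e[symmetric] by blast
  qed
qed

lemma E6_set_image:
  fixes f :: "nat \<Rightarrow> 'a::euclidean_space"
  assumes "linear w" shows "E6_set (w \<circ> f) (w t) = w ` E6_set f t"
proof -
  have e: "fvec (w \<circ> f) (w t) x y = w (fvec f t x y)" for x y
    by (simp add: fvec_def linear_add[OF assms] linear_sum[OF assms] linear_scale[OF assms])
  show ?thesis unfolding E6_set_def D_set_image[OF assms] e image_Un by blast
qed

text \<open>A Weyl group element need not preserve \<open>D5\<close>, but it carries the frame to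
  another frame of the same \<open>E6\<close>-system, given by \<open>w \<circ> f\<close> and
  \<open>w t\<close>. By \<open>coble_eq_span\<close> the Coble space has the same description
  there, so generators go to generators.\<close>

lemma coble_subrep:
  fixes f :: "nat \<Rightarrow> real^'n::finite"
  assumes fr: "frame f t K" and R: "root_system (E6_set f t)"
  shows "subrep (weyl_group (E6_set f t)) (coble (E6_set f t))"
  unfolding subrep_def
proof (intro conjI ballI)
  show sub: "sym.subspace (coble (E6_set f t))" by (simp add: coble_def)
  fix w u assume w: "w \<in> weyl_group (E6_set f t)" and u: "u \<in> coble (E6_set f t)"
  have lin: "linear w" and iso: "\<And>x y. w x \<bullet> w y = x \<bullet> y" and img: "w ` E6_set f t = E6_set f t"
    using weyl_group_isometry[OF R w] by auto
  have fr': "frame (w \<circ> f) (w t) K" using fr iso by (simp add: frame_def orthogonal_family_def)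
  have E: "E6_set (w \<circ> f) (w t) = E6_set f t" using E6_set_image[OF lin] img by simp
  have "frame_coble_poly g t \<in> {v. sym_act w v \<in> coble (E6_set f t)}" if g: "frame_change f g" for g
  proof -
    have "sym_act w (frame_coble_poly g t) = frame_coble_poly (w \<circ> g) (w t)"
      unfolding frame_coble_poly_def coble_poly_def sym_act_hom sym_act_incl[OF lin] by simp
    moreover have "frame_change (w \<circ> f) (w \<circ> g)"
    proof -
      obtain \<pi> s where "\<pi> permutes {..<5}" "\<forall>i<5. s i \<in> {1, -1::real}" "(\<Prod>i<5. s i) = 1" "\<forall>i<5. g i = s i *\<^sub>R f (\<pi> i)"
        using g by (auto simp: frame_change_def)
      moreover from this have "\<forall>i<5. (w \<circ> g) i = s i *\<^sub>R (w \<circ> f) (\<pi> i)" by (simp add: linear_scale[OF lin])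
      ultimately show ?thesis unfolding frame_change_def by blast
    qed
    then have "frame_coble_poly (w \<circ> g) (w t) \<in> coble (E6_set f t)"
      unfolding E[symmetric] coble_eq_span[OF fr'] by (intro sym.span_base) blast
    ultimately show ?thesis by simp
  qed
  moreover have "sym.subspace {v. sym_act w v \<in> coble (E6_set f t)}"
    by (rule sym.subspaceI)
      (simp_all add: sym_act_add sym_act_scale sym.subspace_0[OF sub] sym.subspace_add[OF sub] sym.subspace_scale[OF sub])
  ultimately have "coble (E6_set f t) \<subseteq> {v. sym_act w v \<in> coble (E6_set f t)}"
    unfolding coble_eq_span[OF fr] by (intro sym.span_minimal) blast
  then show "sym_act w u \<in> coble (E6_set f t)" using u by blast
qed

lemma cross_term_relations:
  "cross_term f t p b a c d = - cross_term f t p a b c d"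
  "cross_term f t p b c a d = cross_term f t p a c b d - cross_term f t p a b c d"
  "cross_term f t p c b a d = cross_term f t p a b c d - cross_term f t p a c b d"
  "cross_term f t p c a b d = - cross_term f t p a c b d"
  by (simp_all add: cross_term_def algebra_simps)

text \<open>On the two crosses the transpositions of \<open>a\<close>, \<open>b\<close>,
  \<open>c\<close> act by the matrices of the two-dimensional irreducible representation of the
  symmetric group on three letters.\<close>

lemma transposition_pair:
  fixes f :: "nat \<Rightarrow> real^'n::finite"
  assumes fr: "frame f t K" and q: "quad p a b c d"
  shows "sym_act (root_refl (2 *\<^sub>R (f a - f b))) (cross_term f t p a b c d) = - cross_term f t p a b c d"
    "sym_act (root_refl (2 *\<^sub>R (f a - f b))) (cross_term f t p a c b d) = cross_term f t p a c b d - cross_term f t p a b c d"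
    "sym_act (root_refl (2 *\<^sub>R (f a - f c))) (cross_term f t p a b c d) = cross_term f t p a b c d - cross_term f t p a c b d"
    "sym_act (root_refl (2 *\<^sub>R (f a - f c))) (cross_term f t p a c b d) = - cross_term f t p a c b d"
    "sym_act (root_refl (2 *\<^sub>R (f b - f c))) (cross_term f t p a b c d) = cross_term f t p a c b d"
    "sym_act (root_refl (2 *\<^sub>R (f b - f c))) (cross_term f t p a c b d) = cross_term f t p a b c d"
proof -
  have q2: "quad p a c b d" using q by (auto simp: quad_def)
  have lt: "a < 5" "b < 5" "c < 5" and ne: "a \<noteq> b" "a \<noteq> c" "b \<noteq> c" "d \<notin> {a, b, c, p}" "p \<notin> {a, b, c}" using q by (auto simp: quad_def)
  note tr = transposition_cross_term(1)[OF fr lt(1,2) ne(1)] transposition_cross_term(1)[OF fr lt(1,3) ne(2)]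
    transposition_cross_term(1)[OF fr lt(2,3) ne(3)]
  note tv = Transposition.transpose_def
  show "sym_act (root_refl (2 *\<^sub>R (f a - f b))) (cross_term f t p a b c d) = - cross_term f t p a b c d"
    using tr(1)[OF q] ne cross_term_relations(1)[of f t p b a c d] by (simp add: tv)
  show "sym_act (root_refl (2 *\<^sub>R (f a - f b))) (cross_term f t p a c b d) = cross_term f t p a c b d - cross_term f t p a b c d"
    using tr(1)[OF q2] ne cross_term_relations(2)[of f t p b c a d] by (simp add: tv)
  show "sym_act (root_refl (2 *\<^sub>R (f a - f c))) (cross_term f t p a b c d) = cross_term f t p a b c d - cross_term f t p a c b d"
    using tr(2)[OF q] ne cross_term_relations(3)[of f t p c b a d] by (simp add: tv)
  show "sym_act (root_refl (2 *\<^sub>R (f a - f c))) (cross_term f t p a c b d) = - cross_term f t p a c b d"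
    using tr(2)[OF q2] ne cross_term_relations(4)[of f t p c a b d] by (simp add: tv)
  show "sym_act (root_refl (2 *\<^sub>R (f b - f c))) (cross_term f t p a b c d) = cross_term f t p a c b d"
    "sym_act (root_refl (2 *\<^sub>R (f b - f c))) (cross_term f t p a c b d) = cross_term f t p a b c d"
    using tr(3)[OF q] tr(3)[OF q2] ne by (simp_all add: tv)
qed

text \<open>For each of the two reflections, subtracting the reflected vector maps the plane to a
  line spanned by one cross. The forms \<open>2 \<alpha> + \<beta>\<close> and
  \<open>\<alpha> + 2 \<beta>\<close> have determinant 3, so not both vanish unless
  \<open>\<alpha>\<close> and \<open>\<beta>\<close> do. Independence of the crosses and
  irreducibility on the plane both rest on this.\<close>

lemma pair_combination:
  fixes f :: "nat \<Rightarrow> real^'n::finite"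
  assumes fr: "frame f t K" and q: "quad p a b c d"
    and v: "v = sym_scale \<alpha> (cross_term f t p a b c d) + sym_scale \<beta> (cross_term f t p a c b d)"
  shows "v - sym_act (root_refl (2 *\<^sub>R (f a - f b))) v = sym_scale (2 * \<alpha> + \<beta>) (cross_term f t p a b c d)"
    "v - sym_act (root_refl (2 *\<^sub>R (f a - f c))) v = sym_scale (\<alpha> + 2 * \<beta>) (cross_term f t p a c b d)"
  unfolding v sym_act_add sym_act_scale transposition_pair[OF fr q]
  by (simp_all add: sym.scale_left_distrib sym.scale_right_diff_distrib flip: sym.scale_scale)
    (simp_all flip: sym_scale_numeral)

lemma pair_independent:
  fixes f :: "nat \<Rightarrow> real^'n::finite"
  assumes fr: "frame f t K" and q: "quad p a b c d"
    and 0: "sym_scale \<alpha> (cross_term f t p a b c d) + sym_scale \<beta> (cross_term f t p a c b d) = 0"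
  shows "\<alpha> = 0 \<and> \<beta> = 0"
proof -
  have q2: "quad p a c b d" using q by (auto simp: quad_def)
  have "sym_scale (2 * \<alpha> + \<beta>) (cross_term f t p a b c d) = 0" "sym_scale (\<alpha> + 2 * \<beta>) (cross_term f t p a c b d) = 0"
    using pair_combination[OF fr q 0[symmetric]] by simp_all
  then have "2 * \<alpha> + \<beta> = 0" "\<alpha> + 2 * \<beta> = 0"
    using cross_term_nonzero[OF fr q] cross_term_nonzero[OF fr q2] by auto
  then have "\<beta> = - (2 * \<alpha>)" "\<alpha> + 2 * \<beta> = 0" by (simp_all add: eq_neg_iff_add_eq_0 add.commute)
  then show ?thesis by simp
qed

lemma pair_basis:
  fixes f :: "nat \<Rightarrow> real^'n::finite"
  assumes fr: "frame f t K" and q: "quad p a b c d"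
  shows "cross_term f t p a b c d \<noteq> cross_term f t p a c b d" "sym.dim (cross_plane f t p) = 2"
proof -
  let ?x = "cross_term f t p a b c d" and ?y = "cross_term f t p a c b d"
  show ne: "?x \<noteq> ?y"
  proof
    assume "?x = ?y"
    then have "sym_scale 1 ?x + sym_scale (- 1) ?y = 0" by (simp only: sym.scale_minus_left sym.scale_one) simp
    then show False using pair_independent[OF fr q, of 1 "- 1"] by simp
  qed
  have "sym.independent {?x, ?y}"
  proof
    assume "sym.dependent {?x, ?y}"
    then obtain u where u: "\<exists>v\<in>{?x, ?y}. u v \<noteq> 0" "(\<Sum>v\<in>{?x, ?y}. sym_scale (u v) v) = 0"
      unfolding sym.dependent_finite[of "{?x, ?y}", simplified] by auto
    then have "sym_scale (u ?x) ?x + sym_scale (u ?y) ?y = 0" using ne by simp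
    from pair_independent[OF fr q this] u(1) show False by auto
  qed
  then have "sym.dim (sym.span {?x, ?y}) = card {?x, ?y}" by (rule sym.dim_span_eq_card_independent)
  then show "sym.dim (cross_plane f t p) = 2"
    unfolding cross_plane_eq_span_pair[OF fr q] using ne by simp
qed

lemma coble_irreducible:
  fixes f :: "nat \<Rightarrow> real^'n::finite"
  assumes fr: "frame f t K" and R: "root_system (E6_set f t)"
  shows "irreducible_subrep (weyl_group (E6_set f t)) (coble (E6_set f t))"
  unfolding irreducible_subrep_def
proof (intro conjI allI impI coble_subrep[OF fr R])
  have q0: "quad 4 0 1 2 3" by (simp add: quad_def)
  show "coble (E6_set f t) \<noteq> {0}"
    using cross_term_mem_plane[OF q0] cross_plane_subset_coble[OF fr] cross_term_nonzero[OF fr q0] by blast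
  fix U assume U: "subrep (weyl_group (E6_set f t)) U \<and> U \<subseteq> coble (E6_set f t)"
  then have sub: "sym.subspace U" and act: "\<And>w v. w \<in> weyl_group (E6_set f t) \<Longrightarrow> v \<in> U \<Longrightarrow> sym_act w v \<in> U"
    by (auto simp: subrep_def)
  have act': "sym_act (root_refl (2 *\<^sub>R (f i - f j))) v \<in> U" if "v \<in> U" "i < 5" "j < 5" "i \<noteq> j" for i j v
    using act[OF transposition_weyl(1)[OF that(2-4)] that(1)] .
  show "U = {0} \<or> U = coble (E6_set f t)"
  proof (cases "U = {0}")
    case False
    then obtain u where u: "u \<in> U" "u \<noteq> 0" using sym.subspace_0[OF sub] by blast
    then obtain v where v: "u = (\<Sum>p<5. v p)" "\<forall>p<5. v p \<in> cross_plane f t p"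
      using U coble_eq_plane_sums[OF fr] by blast
    have "\<exists>p<5. v p \<noteq> 0"
    proof (rule ccontr)
      assume "\<not> (\<exists>p<5. v p \<noteq> 0)"
      then have "(\<Sum>p<5. v p) = 0" by simp
      then show False using u v by simp
    qed
    then obtain p where p: "p < 5" "v p \<noteq> 0" by blast
    obtain e where e: "\<And>x y. e (x + y) = e x + e y" "\<And>v. v \<in> cross_plane f t p \<Longrightarrow> e v = v"
      "\<And>q v. q < 5 \<Longrightarrow> q \<noteq> p \<Longrightarrow> v \<in> cross_plane f t q \<Longrightarrow> e v = 0"
      "\<And>U u. subrep (weyl_group (E6_set f t)) U \<Longrightarrow> u \<in> U \<Longrightarrow> e u \<in> U"
      by (rule plane_projection[OF fr p(1)]) blast
    have "e u = (\<Sum>q<5. e (v q))" unfolding v(1) by (rule additive_sum[OF e(1)])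
    also have "\<dots> = (\<Sum>q<5. if q = p then v p else 0)"
      using e(2,3) v(2) by (intro sum.cong) auto
    also have "\<dots> = v p" using p(1) by simp
    finally have vU: "v p \<in> U" using e(4)[of U u] U u(1) by simp
    obtain a b c d where q: "quad p a b c d" using quad_exists[OF p(1)] by blast
    then have q2: "quad p a c b d" and lt: "a < 5" "b < 5" "c < 5" "a \<noteq> b" "a \<noteq> c" "b \<noteq> c" by (auto simp: quad_def)
    let ?x = "cross_term f t p a b c d" and ?y = "cross_term f t p a c b d"
    have "v p \<in> sym.span {?x, ?y}" using v(2) p(1) cross_plane_eq_span_pair[OF fr q] by blast
    then obtain \<alpha> \<beta> where ab: "v p = sym_scale \<alpha> ?x + sym_scale \<beta> ?y"
      by (auto simp: sym.span_insert algebra_simps)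
    have "sym_scale (2 * \<alpha> + \<beta>) ?x \<in> U" "sym_scale (\<alpha> + 2 * \<beta>) ?y \<in> U"
      unfolding pair_combination[OF fr q ab, symmetric]
      by (rule sym.subspace_diff[OF sub vU act'[OF vU lt(1,2,4)]], rule sym.subspace_diff[OF sub vU act'[OF vU lt(1,3,5)]])
    moreover have "2 * \<alpha> + \<beta> \<noteq> 0 \<or> \<alpha> + 2 * \<beta> \<noteq> 0"
    proof (rule ccontr)
      assume "\<not> ?thesis"
      then have "\<beta> = - (2 * \<alpha>)" "\<alpha> + 2 * \<beta> = 0" by (simp_all add: eq_neg_iff_add_eq_0 add.commute)
      then have "\<alpha> = 0" "\<beta> = 0" by simp_all
      then show False using ab p(2) by simp
    qed
    moreover have "z \<in> U" if "sym_scale k z \<in> U" "k \<noteq> 0" for k z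
      using sym.subspace_scale[OF sub that(1), of "1 / k"] that(2) by simp
    ultimately have "?x \<in> U \<or> ?y \<in> U" by blast
    \<comment> \<open>The transposition of \<open>b\<close> and \<open>c\<close> exchanges the two
      crosses.\<close>
    then have "?x \<in> U" "?y \<in> U"
      using act'[OF _ lt(2,3,6), of ?x] act'[OF _ lt(2,3,6), of ?y] transposition_pair(5,6)[OF fr q] by auto
    then have plane_p: "cross_plane f t p \<subseteq> U"
      unfolding cross_plane_eq_span_pair[OF fr q] by (intro sym.span_minimal sub) auto
    have plane: "cross_plane f t r \<subseteq> U" if r: "r < 5" for r
    proof (cases "r = p")
      case False
      show ?thesis
        unfolding cross_plane_eq_span_terms[OF fr r]
      proof (intro sym.span_minimal sub, clarify)
        fix a b c d assume q: "quad r a b c d"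
        \<comment> \<open>The transposition of \<open>r\<close> and \<open>p\<close> carries a cross
          in the plane of \<open>p\<close>, already known to lie in \<open>U\<close>, to the given
          cross in the plane of \<open>r\<close>.\<close>
        let ?\<tau> = "Transposition.transpose r p"
        note tr = transposition_cross_term[OF fr r p(1) False]
        have q': "quad p (?\<tau> a) (?\<tau> b) (?\<tau> c) (?\<tau> d)" using tr(2)[OF q] by simp
        have "cross_term f t p (?\<tau> a) (?\<tau> b) (?\<tau> c) (?\<tau> d) \<in> U" using cross_term_mem_plane[OF q'] plane_p by blast
        from act'[OF this r p(1) False] tr(1)[OF q'] show "cross_term f t r a b c d \<in> U" by simp
      qed
    qed (use plane_p in simp)
    have "coble (E6_set f t) \<subseteq> U"
      unfolding coble_eq_plane_sums[OF fr]
    proof (rule subsetI, elim CollectE exE conjE)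
      fix x v assume x: "x = (\<Sum>p<5. v p)" and v: "\<forall>p<5. v p \<in> cross_plane f t p"
      show "x \<in> U" unfolding x using v plane by (intro sym.subspace_sum[OF sub]) auto
    qed
    then show ?thesis using U by blast
  qed simp
qed

lemma coble_dim:
  fixes f :: "nat \<Rightarrow> real^'n::finite"
  assumes fr: "frame f t K"
  shows "sym.dim (coble (E6_set f t)) = 10"
proof -
  have "\<forall>p. \<exists>x y. p < 5 \<longrightarrow> x \<noteq> y \<and> cross_plane f t p = sym.span {x, y} \<and> (\<forall>\<alpha> \<beta>. sym_scale \<alpha> x + sym_scale \<beta> y = 0 \<longrightarrow> \<alpha> = 0 \<and> \<beta> = 0)"
  proof
    fix p
    show "\<exists>x y. p < 5 \<longrightarrow> x \<noteq> y \<and> cross_plane f t p = sym.span {x, y} \<and> (\<forall>\<alpha> \<beta>. sym_scale \<alpha> x + sym_scale \<beta> y = 0 \<longrightarrow> \<alpha> = 0 \<and> \<beta> = 0)"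
    proof (cases "p < 5")
      case True
      then obtain a b c d where q: "quad p a b c d" using quad_exists by blast
      show ?thesis
        using pair_basis(1)[OF fr q] cross_plane_eq_span_pair[OF fr q] pair_independent[OF fr q] by blast
    qed simp
  qed
  then obtain x y where xy: "\<And>p. p < 5 \<Longrightarrow> x p \<noteq> y p" "\<And>p. p < 5 \<Longrightarrow> cross_plane f t p = sym.span {x p, y p}"
    "\<And>p \<alpha> \<beta>. p < 5 \<Longrightarrow> sym_scale \<alpha> (x p) + sym_scale \<beta> (y p) = 0 \<Longrightarrow> \<alpha> = 0 \<and> \<beta> = 0" by metis
  have mem: "x p \<in> cross_plane f t p" "y p \<in> cross_plane f t p" if "p < 5" for p
    unfolding xy(2)[OF that] by (auto intro: sym.span_base)
  have subp: "sym.subspace (cross_plane f t p)" for p by (simp add: cross_plane_def)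
  have nz: "0 \<notin> {x p, y p}" if "p < 5" for p
    using xy(3)[OF that, of 1 0] xy(3)[OF that, of 0 1] by auto
  have disj: "{x p, y p} \<inter> {x q, y q} = {}" if "p < 5" "q < 5" "p \<noteq> q" for p q
  proof (rule ccontr)
    assume "{x p, y p} \<inter> {x q, y q} \<noteq> {}"
    then obtain z where z: "z \<in> {x p, y p}" "z \<in> {x q, y q}" by blast
    have zp: "z \<in> cross_plane f t p" and zq: "z \<in> cross_plane f t q"
      using mem(1)[OF that(1)] mem(2)[OF that(1)] mem(1)[OF that(2)] mem(2)[OF that(2)] z by auto
    have "(if p = p then z else 0) = (if p = q then z else 0)"
      by (rule cross_planes_independent[OF fr, of "\<lambda>r. if r = p then z else 0" "\<lambda>r. if r = q then z else 0"])
        (use that zp zq sym.subspace_0[OF subp] in auto)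
    then have "z = 0" using that(3) by simp
    then show False using nz[OF that(1)] z by blast
  qed
  define B where "B = (\<Union>p<5. {x p, y p})"
  have fin: "finite B" by (simp add: B_def)
  have "card B = (\<Sum>p<5. card {x p, y p})"
    unfolding B_def using disj by (intro card_UN_disjoint) auto
  then have card: "card B = 10" using xy(1) by simp
  have ind: "sym.independent B"
  proof
    assume "sym.dependent B"
    then obtain u where u: "\<exists>v\<in>B. u v \<noteq> 0" "(\<Sum>v\<in>B. sym_scale (u v) v) = 0"
      unfolding sym.dependent_finite[OF fin] by blast
    \<comment> \<open>A relation is grouped by planes; the directness of the sum makes each
      \<open>z p\<close> vanish, and independence within the plane makes its two coefficients
      vanish.\<close>
    define z where "z p = sym_scale (u (x p)) (x p) + sym_scale (u (y p)) (y p)" for p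
    have "(\<Sum>v\<in>B. sym_scale (u v) v) = (\<Sum>p<5. \<Sum>v\<in>{x p, y p}. sym_scale (u v) v)"
      unfolding B_def using disj by (intro sum.UNION_disjoint) auto
    also have "\<dots> = (\<Sum>p<5. z p)" using xy(1) by (intro sum.cong) (auto simp: z_def)
    finally have s: "(\<Sum>p<5. z p) = (\<Sum>p<5::nat. 0)" using u(2) by simp
    have zm: "z p \<in> cross_plane f t p" if "p < 5" for p
      unfolding z_def using mem[OF that] by (intro sym.subspace_add[OF subp] sym.subspace_scale[OF subp])
    have "z p = 0" if "p < 5" for p
      using cross_planes_independent[OF fr zm _ s that] sym.subspace_0[OF subp] by simp
    then have "u (x p) = 0 \<and> u (y p) = 0" if "p < 5" for p
      using xy(3)[OF that] that unfolding z_def by blast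
    then show False using u(1) by (auto simp: B_def)
  qed
  have "coble (E6_set f t) = sym.span B"
  proof
    have "cross_plane f t p \<subseteq> sym.span B" if "p < 5" for p
      unfolding xy(2)[OF that] by (rule sym.span_mono) (use that in \<open>auto simp: B_def\<close>)
    then show "coble (E6_set f t) \<subseteq> sym.span B"
      unfolding coble_eq_plane_sums[OF fr] by (auto intro!: sym.span_sum)
    have "B \<subseteq> coble (E6_set f t)"
      using mem cross_plane_subset_coble[OF fr] unfolding B_def by blast
    then show "sym.span B \<subseteq> coble (E6_set f t)"
      by (intro sym.span_minimal) (simp_all add: coble_def)
  qed
  then show ?thesis using sym.dim_span_eq_card_independent[OF ind] card by simp
qed

section \<open>Subsystems of type \<open>D\<^sub>4\<close>\<close>

lemma D_set_reindex:
  fixes f :: "nat \<Rightarrow> 'a::euclidean_space"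
  assumes b: "bij_betw h J I"
  shows "D_set I f = D_set J (f \<circ> h)"
proof
  show "D_set J (f \<circ> h) \<subseteq> D_set I f"
  proof
    fix x assume "x \<in> D_set J (f \<circ> h)"
    then obtain s r i j where x: "x = 2 *\<^sub>R (s *\<^sub>R f (h i) + r *\<^sub>R f (h j))" "i \<in> J" "j \<in> J" "i \<noteq> j" "s \<in> {1, -1}" "r \<in> {1, -1}"
      unfolding D_set_def by auto
    have "h i \<in> I" "h j \<in> I" "h i \<noteq> h j" using b x(2-4) by (auto simp: bij_betw_def inj_on_eq_iff)
    then show "x \<in> D_set I f" using x unfolding D_set_def by blast
  qed
  show "D_set I f \<subseteq> D_set J (f \<circ> h)"
  proof
    fix x assume "x \<in> D_set I f"
    then obtain s r i j where x: "x = 2 *\<^sub>R (s *\<^sub>R f i + r *\<^sub>R f j)" "i \<in> I" "j \<in> I" "i \<noteq> j" "s \<in> {1, -1}" "r \<in> {1, -1}"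
      unfolding D_set_def by blast
    obtain i' j' where "i' \<in> J" "j' \<in> J" "i = h i'" "j = h j'" using b x(2,3) by (auto simp: bij_betw_def)
    then show "x \<in> D_set J (f \<circ> h)" using x unfolding D_set_def by auto
  qed
qed

lemma D4_index_frame:
  fixes f :: "nat \<Rightarrow> 'a::euclidean_space"
  assumes o: "orthogonal_family {..<5} f K" and p: "p < 5"
  obtains g where "orthogonal_family {..<4} g K" "D_set ({..<5} - {p}) f = D_set {..<4} g"
proof -
  have "card ({..<5} - {p}) = 4" using p by simp
  then obtain h where h: "bij_betw h {..<4::nat} ({..<5} - {p})"
    using ex_bij_betw_nat_finite[of "{..<5} - {p}"] by (auto simp: atLeast0LessThan)
  have "orthogonal_family {..<4} (f \<circ> h) K"
    unfolding orthogonal_family_def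
  proof (intro conjI ballI)
    fix i j :: nat assume ij: "i \<in> {..<4}" "j \<in> {..<4}"
    then have "h i \<in> {..<5}" "h j \<in> {..<5}" "h i = h j \<longleftrightarrow> i = j"
      using h by (auto simp: bij_betw_def inj_on_eq_iff)
    then show "(f \<circ> h) i \<bullet> (f \<circ> h) j = (if i = j then K else 0)" using o by (simp add: orthogonal_family_def)
  qed (use o in \<open>auto simp: orthogonal_family_def\<close>)
  then show ?thesis using that D_set_reindex[OF h] by blast
qed

text \<open>Guarantees that the deletion of any index from \<open>D5\<close> gives a
  \<open>D4\<close>-subsystem, so that all five occur.\<close>

lemma D_set_type_D4:
  fixes g :: "nat \<Rightarrow> 'a::euclidean_space"
  assumes o: "orthogonal_family {..<4} g K"
  shows "type_D4 (D_set {..<4} g)"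
proof -
  let ?S = "D_set {..<4} g"
  have K: "K > 0" and gg: "\<And>i j. i < 4 \<Longrightarrow> j < 4 \<Longrightarrow> g i \<bullet> g j = (if i = j then K else 0)"
    using o by (auto simp: orthogonal_family_def)
  have pair: "a \<bullet> a = 8 * K \<and> (\<exists>n::int. a \<bullet> b = 4 * K * of_int n)" if a: "a \<in> ?S" and b: "b \<in> ?S" for a b
  proof -
    obtain s r i j where a': "a = 2 *\<^sub>R (s *\<^sub>R g i + r *\<^sub>R g j)" "i < 4" "j < 4" "i \<noteq> j" "s \<in> {1, -1}" "r \<in> {1, -1}"
      using a unfolding D_set_def by blast
    obtain s' r' k l where b': "b = 2 *\<^sub>R (s' *\<^sub>R g k + r' *\<^sub>R g l)" "k < 4" "l < 4" "k \<noteq> l" "s' \<in> {1, -1}" "r' \<in> {1, -1}"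
      using b unfolding D_set_def by blast
    have 1: "a \<bullet> a = 8 * K" using a' by (auto simp: inner_add_left inner_add_right gg)
    have "x * y \<in> \<int>" if "x \<in> {1, -1}" "y \<in> {1, -1}" for x y :: real using that by auto
    then have "s * s' * (if i = k then 1 else 0) + s * r' * (if i = l then 1 else 0) + r * s' * (if j = k then 1 else 0) + r * r' * (if j = l then 1 else 0) \<in> \<int>"
      using a' b' by (intro Ints_add Ints_mult[of "_ * _" "if _ then _ else _"]) auto
    moreover have "a \<bullet> b = 4 * K * (s * s' * (if i = k then 1 else 0) + s * r' * (if i = l then 1 else 0) + r * s' * (if j = k then 1 else 0) + r * r' * (if j = l then 1 else 0))"
      using a' b' by (simp add: inner_add_left inner_add_right gg algebra_simps)
    ultimately show ?thesis using 1 by (auto elim!: Ints_cases)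
  qed
  have "root_system ?S"
    unfolding root_system_def
  proof (intro conjI ballI allI impI)
    show "finite ?S" by (rule card_D_set_eq(2)[OF o o])
    show "0 \<notin> ?S" using pair[of 0 0] K by auto
    fix a assume a: "a \<in> ?S"
    fix t assume "t *\<^sub>R a \<in> ?S"
    then have "t * t * (8 * K) = 8 * K" using pair[of "t *\<^sub>R a" "t *\<^sub>R a"] pair[of a a] a by simp
    then have "t * t = 1" using K by simp
    then show "t = 1 \<or> t = - 1" by (simp add: square_eq_1_iff)
  next
    fix a b assume a: "a \<in> ?S" and b: "b \<in> ?S"
    obtain n :: int where n: "b \<bullet> a = 4 * K * of_int n" using pair[OF b a] by blast
    have "cartan_int b a = of_int n" using pair[OF a a] K n by (simp add: cartan_int_def)
    then show "cartan_int b a \<in> \<int>" by simp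
    obtain s r i j where a': "a = 2 *\<^sub>R (s *\<^sub>R g i + r *\<^sub>R g j)" "i < 4" "j < 4" "i \<noteq> j" "s \<in> {1, -1}" "r \<in> {1, -1}"
      using a unfolding D_set_def by blast
    obtain s' r' k l where b': "b = 2 *\<^sub>R (s' *\<^sub>R g k + r' *\<^sub>R g l)" "k < 4" "l < 4" "k \<noteq> l" "s' \<in> {1, -1}" "r' \<in> {1, -1}"
      using b unfolding D_set_def by blast
    \<comment> \<open>The reflection in \<open>2 (s g i + r g j)\<close> is a signed transposition:
      it sends \<open>g i\<close> to \<open>- s r\<close> times \<open>g j\<close> and conversely,
      and fixes the other \<open>g m\<close>.\<close>
    define \<epsilon> where "\<epsilon> m = (if m = i \<or> m = j then - s * r else 1)" for m
    let ?\<tau> = "Transposition.transpose i j"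
    have "(s *\<^sub>R g i + r *\<^sub>R g j) \<bullet> (s *\<^sub>R g i + r *\<^sub>R g j) = 2 * K" using a' by (auto simp: inner_add_left inner_add_right gg)
    then have refl: "root_refl a x = x - (x \<bullet> (s *\<^sub>R g i + r *\<^sub>R g j) / K) *\<^sub>R (s *\<^sub>R g i + r *\<^sub>R g j)" for x
      unfolding a'(1) using K by (intro root_refl_double) simp_all
    have m: "root_refl a (g m) = \<epsilon> m *\<^sub>R g (?\<tau> m)" if "m < 4" for m
      unfolding refl \<epsilon>_def using a' K that by (auto simp: inner_add_right gg Transposition.transpose_def algebra_simps)
    have "root_refl a b = 2 *\<^sub>R ((s' * \<epsilon> k) *\<^sub>R g (?\<tau> k) + (r' * \<epsilon> l) *\<^sub>R g (?\<tau> l))"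
      unfolding b'(1) by (simp add: linear_scale[OF linear_root_refl] linear_add[OF linear_root_refl] m b')
    moreover have "?\<tau> k \<in> {..<4}" "?\<tau> l \<in> {..<4}" "?\<tau> k \<noteq> ?\<tau> l" using a' b' by (auto simp: Transposition.transpose_def)
    moreover have "s' * \<epsilon> k \<in> {1, -1}" "r' * \<epsilon> l \<in> {1, -1}" using a' b' by (auto simp: \<epsilon>_def)
    ultimately show "root_refl a b \<in> ?S" unfolding D_set_def by blast
  qed
  moreover define a where "a n = [2 *\<^sub>R (g 0 - g 1), 2 *\<^sub>R (g 1 - g 2), 2 *\<^sub>R (g 2 - g 3), 2 *\<^sub>R (g 2 + g 3)] ! n" for n
  have av: "a 0 = 2 *\<^sub>R (g 0 - g 1)" "a 1 = 2 *\<^sub>R (g 1 - g 2)" "a 2 = 2 *\<^sub>R (g 2 - g 3)" "a 3 = 2 *\<^sub>R (g 2 + g 3)"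
    by (simp_all add: a_def)
  have cart: "cartan_int (a i) (a j) = (if i = j then 2 else if {i, j} \<in> {{0, 1}, {1, 2}, {1, 3}} then -1 else 0)" if "i < 4" "j < 4" for i j
  proof -
    have "i \<in> {0, 1, 2, 3}" "j \<in> {0, 1, 2, 3}" using that by auto
    then show ?thesis
      using K
      by (elim insertE emptyE;
          simp add: av cartan_int_def inner_diff_left inner_diff_right inner_add_left inner_add_right gg doubleton_eq_iff del: One_nat_def)
  qed
  have inj: "inj_on a {..<4}"
  proof (rule inj_onI)
    fix i j assume "i \<in> {..<4}" "j \<in> {..<4::nat}" "a i = a j"
    then have "cartan_int (a i) (a j) = 2" using cart[of i i] by simp
    then show "i = j" using cart[of i j] \<open>i \<in> {..<4}\<close> \<open>j \<in> {..<4}\<close> by (auto split: if_splits)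
  qed
  have four: "{..<4::nat} = {0, 1, 2, 3}" by auto
  have sum4: "(\<Sum>b\<in>a ` {..<4}. c b *\<^sub>R b) = c (a 0) *\<^sub>R a 0 + c (a 1) *\<^sub>R a 1 + c (a 2) *\<^sub>R a 2 + c (a 3) *\<^sub>R a 3" for c
    unfolding sum.reindex[OF inj] by (simp add: four add.assoc)
  have "root_basis (a ` {..<4}) ?S"
    unfolding root_basis_def
  proof (intro conjI ballI)
    show "a ` {..<4} \<subseteq> ?S"
      using D_set_memI[of _ "{..<4}" _ g] by (auto simp: four av simp del: One_nat_def)
    show "independent (a ` {..<4})"
    proof (rule independent_if_scalars_zero)
      fix c x assume 0: "(\<Sum>b\<in>a ` {..<4}. c b *\<^sub>R b) = 0" and x: "x \<in> a ` {..<4}"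
      define x0 x1 x2 x3 where "x0 = c (a 0)" and "x1 = c (a 1)" and "x2 = c (a 2)" and "x3 = c (a 3)"
      have v: "x0 *\<^sub>R a 0 + x1 *\<^sub>R a 1 + x2 *\<^sub>R a 2 + x3 *\<^sub>R a 3 = 0" using 0 unfolding sum4 x0_def x1_def x2_def x3_def .
      have e: "(x0 *\<^sub>R a 0 + x1 *\<^sub>R a 1 + x2 *\<^sub>R a 2 + x3 *\<^sub>R a 3) \<bullet> g i = 0" for i unfolding v by simp
      have "2 * x0 * K = 0 * K" "2 * (x1 - x0) * K = 0 * K" "2 * (x2 + x3 - x1) * K = 0 * K" "2 * (x3 - x2) * K = 0 * K"
        using e[of 0] e[of 1] e[of 2] e[of 3]
        by (simp_all add: av inner_add_left inner_diff_left gg algebra_simps del: One_nat_def)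
      from this[THEN scale_cancel[OF K]] have "x0 = 0 \<and> x1 = 0 \<and> x2 = 0 \<and> x3 = 0" by auto
      then have "c (a 0) = 0" "c (a 1) = 0" "c (a 2) = 0" "c (a 3) = 0" by (simp_all add: x0_def x1_def x2_def x3_def)
      then show "c x = 0" using x unfolding four by auto
    qed simp
    have posI: "x \<in> positive_roots (a ` {..<4}) ?S" if "x \<in> ?S" "x = real n0 *\<^sub>R a 0 + real n1 *\<^sub>R a 1 + real n2 *\<^sub>R a 2 + real n3 *\<^sub>R a 3" for x n0 n1 n2 n3
    proof -
      define m where "m b = [n0, n1, n2, n3] ! (inv_into {..<4} a b)" for b
      have mv: "m (a i) = [n0, n1, n2, n3] ! i" if "i < 4" for i using that inj by (simp add: m_def)
      have "x = (\<Sum>b\<in>a ` {..<4}. real (m b) *\<^sub>R b)"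
        unfolding sum4 that(2) by (simp add: mv)
      then show ?thesis using that(1) unfolding positive_roots_def by blast
    qed
    \<comment> \<open>The twelve positive roots with their coefficients at \<open>a 0\<close>, ...,
      \<open>a 3\<close>; the highest root \<open>2 (g 0 + g 1)\<close> has the coefficient 2 at the
      branch node \<open>a 1\<close>.\<close>
    have p01m: "2 *\<^sub>R (g 0 - g 1) \<in> positive_roots (a ` {..<4}) ?S"
      by (rule posI[of _ 1 0 0 0]; (rule D_set_memI; simp)?; simp add: av scaleR_2 algebra_simps del: One_nat_def)
    have p02m: "2 *\<^sub>R (g 0 - g 2) \<in> positive_roots (a ` {..<4}) ?S"
      by (rule posI[of _ 1 1 0 0]; (rule D_set_memI; simp)?; simp add: av scaleR_2 algebra_simps del: One_nat_def)
    have p03m: "2 *\<^sub>R (g 0 - g 3) \<in> positive_roots (a ` {..<4}) ?S"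
      by (rule posI[of _ 1 1 1 0]; (rule D_set_memI; simp)?; simp add: av scaleR_2 algebra_simps del: One_nat_def)
    have p12m: "2 *\<^sub>R (g 1 - g 2) \<in> positive_roots (a ` {..<4}) ?S"
      by (rule posI[of _ 0 1 0 0]; (rule D_set_memI; simp)?; simp add: av scaleR_2 algebra_simps del: One_nat_def)
    have p13m: "2 *\<^sub>R (g 1 - g 3) \<in> positive_roots (a ` {..<4}) ?S"
      by (rule posI[of _ 0 1 1 0]; (rule D_set_memI; simp)?; simp add: av scaleR_2 algebra_simps del: One_nat_def)
    have p23m: "2 *\<^sub>R (g 2 - g 3) \<in> positive_roots (a ` {..<4}) ?S"
      by (rule posI[of _ 0 0 1 0]; (rule D_set_memI; simp)?; simp add: av scaleR_2 algebra_simps del: One_nat_def)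
    have p23p: "2 *\<^sub>R (g 2 + g 3) \<in> positive_roots (a ` {..<4}) ?S"
      by (rule posI[of _ 0 0 0 1]; (rule D_set_memI; simp)?; simp add: av scaleR_2 algebra_simps del: One_nat_def)
    have p13p: "2 *\<^sub>R (g 1 + g 3) \<in> positive_roots (a ` {..<4}) ?S"
      by (rule posI[of _ 0 1 0 1]; (rule D_set_memI; simp)?; simp add: av scaleR_2 algebra_simps del: One_nat_def)
    have p03p: "2 *\<^sub>R (g 0 + g 3) \<in> positive_roots (a ` {..<4}) ?S"
      by (rule posI[of _ 1 1 0 1]; (rule D_set_memI; simp)?; simp add: av scaleR_2 algebra_simps del: One_nat_def)
    have p12p: "2 *\<^sub>R (g 1 + g 2) \<in> positive_roots (a ` {..<4}) ?S"
      by (rule posI[of _ 0 1 1 1]; (rule D_set_memI; simp)?; simp add: av scaleR_2 algebra_simps del: One_nat_def)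
    have p02p: "2 *\<^sub>R (g 0 + g 2) \<in> positive_roots (a ` {..<4}) ?S"
      by (rule posI[of _ 1 1 1 1]; (rule D_set_memI; simp)?; simp add: av scaleR_2 algebra_simps del: One_nat_def)
    have p01p: "2 *\<^sub>R (g 0 + g 1) \<in> positive_roots (a ` {..<4}) ?S"
      by (rule posI[of _ 1 2 1 1]; (rule D_set_memI; simp)?; simp add: av scaleR_2 algebra_simps del: One_nat_def)
    have pos: "2 *\<^sub>R (g i - g j) \<in> positive_roots (a ` {..<4}) ?S \<and> 2 *\<^sub>R (g i + g j) \<in> positive_roots (a ` {..<4}) ?S" if "i < j" "j < 4" for i j
    proof -
      have "i = 0 \<and> j = 1 \<or> i = 0 \<and> j = 2 \<or> i = 0 \<and> j = 3 \<or> i = 1 \<and> j = 2 \<or> i = 1 \<and> j = 3 \<or> i = 2 \<and> j = 3"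
        using that by linarith
      then show ?thesis using p01m p02m p03m p12m p13m p23m p23p p13p p03p p12p p02p p01p by blast
    qed
    have signs: "x \<in> positive_roots (a ` {..<4}) ?S \<or> - x \<in> positive_roots (a ` {..<4}) ?S"
      if x: "x = 2 *\<^sub>R (s *\<^sub>R g i + r *\<^sub>R g j)" "s \<in> {1, -1}" "r \<in> {1, -1}" and ij: "i < j" "j < 4" for x s r i j
    proof -
      have "x = 2 *\<^sub>R (g i - g j) \<or> x = 2 *\<^sub>R (g i + g j) \<or> - x = 2 *\<^sub>R (g i - g j) \<or> - x = 2 *\<^sub>R (g i + g j)"
        using x by (auto simp: algebra_simps)
      then show ?thesis using pos[OF ij] by metis
    qed
    fix x assume "x \<in> ?S"
    then obtain s r i j where x: "x = 2 *\<^sub>R (s *\<^sub>R g i + r *\<^sub>R g j)" "i < 4" "j < 4" "i \<noteq> j" "s \<in> {1, -1}" "r \<in> {1, -1}"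
      unfolding D_set_def by blast
    show "x \<in> positive_roots (a ` {..<4}) ?S \<or> - x \<in> positive_roots (a ` {..<4}) ?S"
      using signs[OF x(1,5,6)] signs[of x r j s i] x by (cases "i < j") (auto simp: add.commute)
  qed
  ultimately show ?thesis
    unfolding type_D4_def has_dynkin_type_def using inj cart by blast
qed

text \<open>Disjoint pairs cover an even number of points, and 5 is odd.\<close>

lemma supports_miss_index:
  assumes S: "\<And>S. S \<in> \<S> \<Longrightarrow> S \<subseteq> {..<5::nat} \<and> card S = 2"
    and disj: "\<And>S T. S \<in> \<S> \<Longrightarrow> T \<in> \<S> \<Longrightarrow> S \<inter> T = {} \<or> S = T"
  shows "\<exists>p<5. \<forall>S\<in>\<S>. p \<notin> S"
proof (rule ccontr)
  assume "\<not> ?thesis"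
  then have U: "\<Union>\<S> = {..<5}" using S by fastforce
  have fin: "finite \<S>" using S by (intro finite_subset[of \<S> "Pow {..<5}"]) auto
  have "card (\<Union>\<S>) = (\<Sum>S\<in>\<S>. card S)"
    using S disj by (intro card_Union_disjoint) (auto simp: pairwise_def disjnt_def intro: finite_subset)
  also have "\<dots> = 2 * card \<S>" using S by simp
  finally have "5 = 2 * card \<S>" using U by simp
  then show False by presburger
qed

text \<open>Four orthogonal roots of \<open>R'\<close> span its space. As roots of \<open>D5\<close>
  they have equal or disjoint supports, which miss an index \<open>p\<close>. Hence
  \<open>R'\<close> is orthogonal to \<open>f p\<close>, and it equals the subsystem without
  \<open>p\<close> because both have the same number of roots.\<close>

lemma D4_subsystem_D_set:
  fixes f :: "nat \<Rightarrow> 'a::euclidean_space"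
  assumes o: "orthogonal_family {..<5} f K" and sub: "R' \<subseteq> D_set {..<5} f" and D4: "type_D4 R'"
  shows "\<exists>p<5. R' = D_set ({..<5} - {p}) f"
proof -
  obtain g K' where og: "orthogonal_family {..<4} g K'" and R': "R' = D_set {..<4} g"
    by (rule type_D4_D_set[OF D4])
  have ff: "\<And>i j. i < 5 \<Longrightarrow> j < 5 \<Longrightarrow> f i \<bullet> f j = (if i = j then K else 0)"
    using o by (auto simp: orthogonal_family_def)
  have gg: "\<And>i j. i < 4 \<Longrightarrow> j < 4 \<Longrightarrow> g i \<bullet> g j = (if i = j then K' else 0)"
    using og by (auto simp: orthogonal_family_def)
  define V where "V = {2 *\<^sub>R (g 0 - g 1), 2 *\<^sub>R (g 0 + g 1), 2 *\<^sub>R (g 2 - g 3), 2 *\<^sub>R (g 2 + g 3)}"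
  have VR: "V \<subseteq> D_set {..<5} f" using D_set_memI[of _ "{..<4}" _ g] sub unfolding V_def R' by auto
  have orth: "v \<bullet> w = 0" if "v \<in> V" "w \<in> V" "v \<noteq> w" for v w
    using that unfolding V_def
    by (elim insertE emptyE; simp add: inner_add_left inner_add_right inner_diff_left inner_diff_right gg del: One_nat_def)
  define \<S> where "\<S> = {{i, j} | v i j s r. v \<in> V \<and> D_rep f v i j s r}"
  have "\<exists>p<5. \<forall>S\<in>\<S>. p \<notin> S"
  proof (rule supports_miss_index)
    show "S \<subseteq> {..<5} \<and> card S = 2" if "S \<in> \<S>" for S using that by (auto simp: \<S>_def D_rep_def)
    show "S \<inter> T = {} \<or> S = T" if ST: "S \<in> \<S>" "T \<in> \<S>" for S T
    proof -
      obtain v i j s r where v: "v \<in> V" "S = {i, j}" "D_rep f v i j s r" using ST(1) unfolding \<S>_def by blast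
      obtain w k l s' r' where w: "w \<in> V" "T = {k, l}" "D_rep f w k l s' r'" using ST(2) unfolding \<S>_def by blast
      show ?thesis
      proof (cases "v = w")
        case False
        then show ?thesis using D_rep_orthogonal[OF o v(3) w(3) orth[OF v(1) w(1)]] v(2) w(2) by simp
      next
        case True
        have inner: "v \<bullet> f m \<noteq> 0 \<longleftrightarrow> m \<in> {i, j}" if v: "D_rep f v i j s r" and m: "m < 5" for i j s r m
          using v m o unfolding D_rep_def orthogonal_family_def by (auto simp: inner_add_left)
        have "m \<in> S \<longleftrightarrow> m \<in> T" if "m < 5" for m
          using inner[OF v(3) that] inner[OF w(3)[folded True] that] v(2) w(2) by simp
        moreover have "S \<subseteq> {..<5}" "T \<subseteq> {..<5}" using v w by (auto simp: D_rep_def)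
        ultimately have "S = T" by blast
        then show ?thesis ..
      qed
    qed
  qed
  then obtain p where p: "p < 5" "\<And>S. S \<in> \<S> \<Longrightarrow> p \<notin> S" by blast
  have Vp: "v \<bullet> f p = 0" if v: "v \<in> V" for v
  proof -
    obtain i j s r where r: "D_rep f v i j s r" using D_rep_exists[of v f] VR v by blast
    then have "{i, j} \<in> \<S>" using v unfolding \<S>_def by blast
    then have "p \<noteq> i" "p \<noteq> j" using p(2) by auto
    then show ?thesis using r p(1) by (auto simp: D_rep_def inner_add_left ff)
  qed
  have "2 *\<^sub>R (g 0 - g 1) \<bullet> f p = 0" "2 *\<^sub>R (g 0 + g 1) \<bullet> f p = 0" "2 *\<^sub>R (g 2 - g 3) \<bullet> f p = 0" "2 *\<^sub>R (g 2 + g 3) \<bullet> f p = 0"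
    by (rule Vp; simp add: V_def)+
  then have g0: "g 0 \<bullet> f p = 0" "g 1 \<bullet> f p = 0" "g 2 \<bullet> f p = 0" "g 3 \<bullet> f p = 0"
    by (simp_all add: inner_add_left inner_diff_left)
  have gp: "g i \<bullet> f p = 0" if "i < 4" for i
  proof -
    have "i = 0 \<or> i = 1 \<or> i = 2 \<or> i = 3" using that by linarith
    then show ?thesis using g0 by blast
  qed
  have "x \<bullet> f p = 0" if "x \<in> R'" for x
    using that gp unfolding R' D_set_def by (auto simp: inner_add_left inner_diff_left)
  then have sub': "R' \<subseteq> D_set ({..<5} - {p}) f" using sub D_set_minus[OF o p(1)] by blast
  obtain h where h: "orthogonal_family {..<4} h K" "D_set ({..<5} - {p}) f = D_set {..<4} h"
    by (rule D4_index_frame[OF o p(1)])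
  have "R' = D_set ({..<5} - {p}) f"
    using card_D_set_eq[OF og h(1)] card_D_set_eq(2)[OF h(1) h(1)] sub' unfolding R' h(2)
    by (intro card_subset_eq) auto
  then show ?thesis using p(1) by blast
qed

lemma D4_subsystems_D_set:
  fixes f :: "nat \<Rightarrow> 'a::euclidean_space"
  assumes o: "orthogonal_family {..<5} f K"
  shows "D4_subsystems (D_set {..<5} f) = (\<lambda>p. D_set ({..<5} - {p}) f) ` {..<5}" "inj_on (\<lambda>p. D_set ({..<5} - {p}) f) {..<5}"
proof -
  have K: "K > 0" and ff: "\<And>i j. i < 5 \<Longrightarrow> j < 5 \<Longrightarrow> f i \<bullet> f j = (if i = j then K else 0)"
    using o by (auto simp: orthogonal_family_def)
  show "D4_subsystems (D_set {..<5} f) = (\<lambda>p. D_set ({..<5} - {p}) f) ` {..<5}"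
  proof
    show "D4_subsystems (D_set {..<5} f) \<subseteq> (\<lambda>p. D_set ({..<5} - {p}) f) ` {..<5}"
      using D4_subsystem_D_set[OF o] unfolding D4_subsystems_def by blast
    have "D_set ({..<5} - {p}) f \<in> D4_subsystems (D_set {..<5} f)" if p: "p < 5" for p
    proof -
      obtain h where "orthogonal_family {..<4} h K" "D_set ({..<5} - {p}) f = D_set {..<4} h"
        by (rule D4_index_frame[OF o p])
      then have "type_D4 (D_set ({..<5} - {p}) f)" using D_set_type_D4 by metis
      then show ?thesis using D_set_minus[OF o p] by (auto simp: D4_subsystems_def)
    qed
    then show "(\<lambda>p. D_set ({..<5} - {p}) f) ` {..<5} \<subseteq> D4_subsystems (D_set {..<5} f)" by blast
  qed
  show "inj_on (\<lambda>p. D_set ({..<5} - {p}) f) {..<5}"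
  proof (rule inj_onI, rule ccontr)
    fix p q :: nat assume p: "p \<in> {..<5}" and q: "q \<in> {..<5}" and eq: "D_set ({..<5} - {p}) f = D_set ({..<5} - {q}) f" and ne: "p \<noteq> q"
    have p5: "p < 5" and q5: "q < 5" using p q by auto
    obtain a b c d where abcd: "quad p a b c d" using quad_exists[OF p5] by blast
    have set: "{..<5} - {p} = {a, b, c, d}" by (rule quad_set(1)[OF abcd])
    \<comment> \<open>With a third index \<open>r\<close>, the root \<open>2 (f q + f r)\<close>
      belongs to the subsystem without \<open>p\<close> but not to the one without
      \<open>q\<close>.\<close>
    obtain r where r: "r \<in> {..<5} - {p}" "r \<noteq> q"
    proof (cases "a = q")
      case True
      then have "b \<noteq> q" using abcd by (auto simp: quad_def)
      then show ?thesis using that[of b] set by blast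
    next
      case False
      then show ?thesis using that[of a] set by blast
    qed
    have "2 *\<^sub>R (f q + f r) \<in> D_set ({..<5} - {p}) f" using r q ne by (intro D_set_memI) auto
    then have "2 *\<^sub>R (f q + f r) \<bullet> f q = 0" unfolding eq D_set_minus[OF o q5] by blast
    then show False using r q5 K by (simp add: inner_add_left ff)
  qed
qed

theorem theorem4p9:
  fixes R Ro :: "(real^'n::finite) set"
  assumes "type_E6 R" and "Ro \<subseteq> R" and "type_D5 Ro"
  shows "card (D4_subsystems Ro) = 5 \<and>
    (\<forall>R'\<in>D4_subsystems Ro. cross_span R R' \<subseteq> coble R \<and> sym.dim (cross_span R R') = 2) \<and>
    direct_sum_decomp (D4_subsystems Ro) (cross_span R) (coble R) \<and>
    irreducible_subrep (weyl_group R) (coble R) \<and>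
    sym.dim (coble R) = 10"
proof -
  obtain f t K where fr: "frame f t K" and R: "R = E6_set f t" and Ro: "Ro = D_set {..<5} f"
    by (rule E6_frame[OF assms])
  have RS: "root_system (E6_set f t)" using assms(1) by (simp add: R type_E6_def has_dynkin_type_def)
  have o: "orthogonal_family {..<5} f K" using fr by (simp add: frame_def)
  let ?D = "\<lambda>p. D_set ({..<5} - {p}) f"
  have I: "D4_subsystems Ro = ?D ` {..<5}" and inj: "inj_on ?D {..<5}"
    unfolding Ro by (rule D4_subsystems_D_set[OF o])+
  have V: "cross_span R (?D p) = cross_plane f t p" if "p < 5" for p
    unfolding R by (rule cross_span_eq_plane[OF fr that])
  have "card (D4_subsystems Ro) = 5" unfolding I card_image[OF inj] by simp
  moreover have "cross_span R R' \<subseteq> coble R \<and> sym.dim (cross_span R R') = 2" if R': "R' \<in> D4_subsystems Ro" for R'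
  proof -
    obtain p where p: "p < 5" "R' = ?D p" using R' unfolding I by blast
    obtain a b c d where q: "quad p a b c d" using quad_exists[OF p(1)] by blast
    show ?thesis
      unfolding p(2) V[OF p(1)] using cross_plane_subset_coble[OF fr] pair_basis(2)[OF fr q] unfolding R by blast
  qed
  moreover have "direct_sum_decomp (D4_subsystems Ro) (cross_span R) (coble R)"
    unfolding direct_sum_decomp_def
  proof (intro conjI ballI)
    show "finite (D4_subsystems Ro)" unfolding I by simp
    show "sym.subspace (cross_span R i)" for i by (simp add: cross_span_def)
    have sum: "(\<Sum>i\<in>D4_subsystems Ro. F i) = (\<Sum>p<5. F (?D p))" for F :: "(real^'n) set \<Rightarrow> 'n sym_alg"
      unfolding I sum.reindex[OF inj] by simp
    show "bij_betw (\<lambda>F. \<Sum>i\<in>D4_subsystems Ro. F i) (\<Pi>\<^sub>E i\<in>D4_subsystems Ro. cross_span R i) (coble R)"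
      unfolding bij_betw_def
    proof
      show "inj_on (\<lambda>F. \<Sum>i\<in>D4_subsystems Ro. F i) (\<Pi>\<^sub>E i\<in>D4_subsystems Ro. cross_span R i)"
      proof (rule inj_onI)
        fix F G assume F: "F \<in> (\<Pi>\<^sub>E i\<in>D4_subsystems Ro. cross_span R i)" and G: "G \<in> (\<Pi>\<^sub>E i\<in>D4_subsystems Ro. cross_span R i)"
          and eq: "(\<Sum>i\<in>D4_subsystems Ro. F i) = (\<Sum>i\<in>D4_subsystems Ro. G i)"
        have mem: "H (?D p) \<in> cross_plane f t p" if "H \<in> (\<Pi>\<^sub>E i\<in>D4_subsystems Ro. cross_span R i)" "p < 5" for H p
          unfolding V[OF that(2), symmetric] by (rule PiE_mem[OF that(1)]) (use that(2) in \<open>simp add: I\<close>)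
        have "F (?D p) = G (?D p)" if "p < 5" for p
          by (rule cross_planes_independent[OF fr, of "\<lambda>p. F (?D p)" "\<lambda>p. G (?D p)", OF mem[OF F] mem[OF G] eq[unfolded sum] that])
        then have "F i = G i" if "i \<in> D4_subsystems Ro" for i using that unfolding I by blast
        then show "F = G" by (rule PiE_ext[OF F G])
      qed
      show "(\<lambda>F. \<Sum>i\<in>D4_subsystems Ro. F i) ` (\<Pi>\<^sub>E i\<in>D4_subsystems Ro. cross_span R i) = coble R"
      proof
        show "(\<lambda>F. \<Sum>i\<in>D4_subsystems Ro. F i) ` (\<Pi>\<^sub>E i\<in>D4_subsystems Ro. cross_span R i) \<subseteq> coble R"
        proof (rule image_subsetI)
          fix F assume F: "F \<in> (\<Pi>\<^sub>E i\<in>D4_subsystems Ro. cross_span R i)"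
          have "F (?D p) \<in> cross_plane f t p" if "p < 5" for p
            unfolding V[OF that, symmetric] by (rule PiE_mem[OF F]) (use that in \<open>simp add: I\<close>)
          then show "(\<Sum>i\<in>D4_subsystems Ro. F i) \<in> coble R"
            unfolding R coble_eq_plane_sums[OF fr] sum by blast
        qed
        show "coble R \<subseteq> (\<lambda>F. \<Sum>i\<in>D4_subsystems Ro. F i) ` (\<Pi>\<^sub>E i\<in>D4_subsystems Ro. cross_span R i)"
        proof
          fix x assume "x \<in> coble R"
          then obtain v where x: "x = (\<Sum>p<5. v p)" and v: "\<And>p. p < 5 \<Longrightarrow> v p \<in> cross_plane f t p"
            unfolding R coble_eq_plane_sums[OF fr] by blast
          \<comment> \<open>A family over the indices becomes one over the subsystems through the
            inverse of the indexing; \<open>restrict\<close> makes it extensional, as membership in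
            the product requires.\<close>
          define F where "F = restrict (\<lambda>i. v (the_inv_into {..<5} ?D i)) (D4_subsystems Ro)"
          have FD: "F (?D p) = v p" if "p < 5" for p
            using that the_inv_into_f_f[OF inj, of p] by (simp add: F_def I)
          have "F \<in> (\<Pi>\<^sub>E i\<in>D4_subsystems Ro. cross_span R i)"
          proof (rule PiE_I)
            fix i assume "i \<in> D4_subsystems Ro"
            then obtain p where p: "p < 5" "i = ?D p" unfolding I by blast
            show "F i \<in> cross_span R i" unfolding p(2) FD[OF p(1)] V[OF p(1)] by (rule v[OF p(1)])
          qed (simp add: F_def)
          moreover have "x = (\<Sum>i\<in>D4_subsystems Ro. F i)" unfolding sum x by (intro sum.cong) (simp_all add: FD)
          ultimately show "x \<in> (\<lambda>F. \<Sum>i\<in>D4_subsystems Ro. F i) ` (\<Pi>\<^sub>E i\<in>D4_subsystems Ro. cross_span R i)" by blast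
        qed
      qed
    qed
  qed
  moreover have "irreducible_subrep (weyl_group R) (coble R)" unfolding R by (rule coble_irreducible[OF fr RS])
  moreover have "sym.dim (coble R) = 10" unfolding R by (rule coble_dim[OF fr])
  ultimately show ?thesis by blast
qed

end
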